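(* For $0\le\mu<\Lambda_{N,s}$ one has $S_\mu\ge\big(1-\frac{\mu}{\Lambda_{N,s}}\big)S>0$, and the map $\mu\mapsto S_\mu$ is strictly decreasing on $[0,\Lambda_{N,s})$. Consequently, if $\mu_1,\dots,\mu_k\ge0$ satisfy $\sum_{i=1}^k\mu_i<\Lambda_{N,s}$, then $$S_*=S_{\mu_{\max}},\qquad\text{and}\qquad S_{\mu_j}=S_*\ \text{ exactly for } j\in J_*.$$
   Context: Let $N\in\mathbb N$, $s\in(0,1)$, $N>2s$, $2_s^*=\frac{2N}{N-2s}$. For measurable $u:\mathbb R^N\to\mathbb R$ put $[u]_s^2=\frac{C_{N,s}}2\iint_{\mathbb R^{2N}}\frac{|u(x)-u(y)|^2}{|x-y|^{N+2s}}dxdy$, with $C_{N,s}=\big(\int_{\mathbb R^N}\frac{1-\cos\zeta_1}{|\zeta|^{N+2s}}d\zeta\big)^{-1}$. $\dot H^s(\mathbb R^N)$ is the completion of $C_c^\infty(\mathbb R^N)$ with respect to $[\cdot]_s$. $\Lambda_{N,s}=2^{2s}\Gamma(\frac{N+2s}4)^2/\Gamma(\frac{N-2s}4)^2$ (the sharp fractional Hardy constant). For $0\le\mu<\Lambda_{N,s}$, $S_\mu=\inf_{u\in\dot H^s(\mathbb R^N)\setminus\{0\}}\frac{[u]_s^2-\mu\int_{\mathbb R^N}|x|^{-2s}u^2dx}{\|u\|^2_{L^{2_s^*}(\mathbb R^N)}}$, and $S=S_0$. For $k\ge1$ and masses $\mu_1,\dots,\mu_k\ge 0$: $\mu_{\max}=\max_i\mu_i$,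 $J_*=\{j\in\{1,\dots,k\}:\mu_j=\mu_{\max}\}$, $S_*=\min\{S,S_{\mu_1},\dots,S_{\mu_k}\}$. *)

theory Defs
  imports "HOL-Analysis.Analysis"
begin

text \<open>
  \<open>\<real>\<^sup>N\<close> is \<open>real ^ 'n\<close> with \<open>N = CARD('n)\<close>. All integrals are with respect to Lebesgue measure
  on the Borel sets; every class of Lebesgue measurable functions modulo null sets has a Borel
  representative, so \<open>borel_measurable borel\<close> loses nothing.
\<close>

definition crit_exponent :: "nat \<Rightarrow> real \<Rightarrow> real" where
  "crit_exponent N s = 2 * real N / (real N - 2 * s)"

text \<open>
  The coordinate \<open>\<zeta>\<^sub>1\<close> is rendered by an arbitrary fixed index; the integral does not depend on
  which one, because permutations of the coordinates preserve \<open>norm\<close> and \<open>lborel\<close>.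
\<close>

definition frac_const :: "'n::finite itself \<Rightarrow> real \<Rightarrow> real" where
  "frac_const _ s =
     inverse (LINT \<zeta>|(lborel :: (real ^ 'n) measure).
       (1 - cos (\<zeta> $ (SOME i. True))) / norm \<zeta> powr (real CARD('n) + 2 * s))"

definition gagliardo_sq :: "real \<Rightarrow> (real ^ 'n::finite \<Rightarrow> real) \<Rightarrow> ennreal" where
  "gagliardo_sq s u =
     ennreal (frac_const TYPE('n) s / 2) *
     (\<integral>\<^sup>+ (x, y). ennreal (\<bar>u x - u y\<bar>\<^sup>2 / norm (x - y) powr (real CARD('n) + 2 * s))
        \<partial>(lborel \<Otimes>\<^sub>M lborel))"

primrec C_k :: "nat \<Rightarrow> ('a::real_normed_vector \<Rightarrow> real) \<Rightarrow> bool" where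
  "C_k 0 f \<longleftrightarrow> continuous_on UNIV f"
| "C_k (Suc k) f \<longleftrightarrow>
     (\<forall>x. f differentiable (at x)) \<and> (\<forall>v. C_k k (\<lambda>x. frechet_derivative f (at x) v))"

definition test_functions :: "('a::real_normed_vector \<Rightarrow> real) set" where
  "test_functions = {\<phi>. (\<forall>k. C_k k \<phi>) \<and> compact (closure {x. \<phi> x \<noteq> 0})}"

text \<open>
  The completion of the test functions, realised as usual as a space of functions (elements are
  identified when they agree almost everywhere). As \<open>N > 2 * s\<close>, the fractional Sobolev
  inequality makes every Cauchy sequence of test functions converge in \<open>L\<close> of the critical
  exponent, and by Fatou's lemma also in \<open>gagliardo_sq\<close> to the same limit, whence the completion
  is the closure of the test functions inside that \<open>L\<close> space. The integrability condition
  excludes the nonzero constants, on which \<open>gagliardo_sq\<close> vanishes.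
\<close>

definition Hdot :: "real \<Rightarrow> (real ^ 'n::finite \<Rightarrow> real) set" where
  "Hdot s = {u. u \<in> borel_measurable borel \<and>
     integrable lborel (\<lambda>x. \<bar>u x\<bar> powr crit_exponent CARD('n) s) \<and>
     (\<exists>\<phi>. (\<forall>m. \<phi> m \<in> test_functions) \<and>
        (\<lambda>m::nat. gagliardo_sq s (\<lambda>x. u x - \<phi> m x)) \<longlonglongrightarrow> 0)}"

definition Lp_norm :: "real \<Rightarrow> (real ^ 'n::finite \<Rightarrow> real) \<Rightarrow> real" where
  "Lp_norm p u = (LINT x|lborel. \<bar>u x\<bar> powr p) powr (1 / p)"

definition hardy_const :: "nat \<Rightarrow> real \<Rightarrow> real" where
  "hardy_const N s =
     2 powr (2 * s) * (Gamma ((real N + 2 * s) / 4))\<^sup>2 / (Gamma ((real N - 2 * s) / 4))\<^sup>2"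

text \<open>
  For \<open>u \<in> Hdot s\<close> the numerator involves only finite quantities: \<open>gagliardo_sq s u\<close> is finite by
  the triangle inequality, the potential term by Hardy's inequality.
\<close>

definition rayleigh_quotient :: "real \<Rightarrow> real \<Rightarrow> (real ^ 'n::finite \<Rightarrow> real) \<Rightarrow> real" where
  "rayleigh_quotient s \<mu> u =
     (enn2real (gagliardo_sq s u) - \<mu> * (LINT x|lborel. norm x powr (- 2 * s) * (u x)\<^sup>2)) /
     (Lp_norm (crit_exponent CARD('n) s) u)\<^sup>2"

definition S_mu :: "'n::finite itself \<Rightarrow> real \<Rightarrow> real \<Rightarrow> real" where
  "S_mu _ s \<mu> =
     (INF u \<in> {u \<in> Hdot s. \<not> (AE x in lborel. u x = 0)}.
        rayleigh_quotient s \<mu> (u :: real ^ 'n \<Rightarrow> real))"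

definition S_0 :: "'n::finite itself \<Rightarrow> real \<Rightarrow> real" where
  "S_0 T s = S_mu T s 0"

definition mu_max :: "nat \<Rightarrow> (nat \<Rightarrow> real) \<Rightarrow> real" where
  "mu_max k \<mu> = Max (\<mu> ` {1..k})"

definition J_star :: "nat \<Rightarrow> (nat \<Rightarrow> real) \<Rightarrow> nat set" where
  "J_star k \<mu> = {j \<in> {1..k}. \<mu> j = mu_max k \<mu>}"

definition S_star :: "'n::finite itself \<Rightarrow> real \<Rightarrow> nat \<Rightarrow> (nat \<Rightarrow> real) \<Rightarrow> real" where
  "S_star T s k \<mu> = Min (insert (S_0 T s) ((\<lambda>i. S_mu T s (\<mu> i)) ` {1..k}))"

end

theory Submission
  imports Defs "HOL-Probability.Probability"
begin

text \<open>
  The lower bound is the sharp Hardy inequality. Writing \<open>|z|\<^sup>-\<^sup>N\<^sup>-\<^sup>2\<^sup>s\<close> as an average of heat kernels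
  \<open>q\<^sub>t\<close> over \<open>t powr (- 1 - s) dt\<close>, one tests each kernel against the ground state \<open>w = |x| powr (- (N - 2 s) / 2)\<close>
  by the Picone inequality \<open>(a - b)\<^sup>2 + a\<^sup>2 w(y) / w(x) + b\<^sup>2 w(x) / w(y) \<ge> a\<^sup>2 + b\<^sup>2\<close>. Since \<open>w\<close> is itself an average of
  heat kernels, \<open>q\<^sub>t * w\<close> is explicit, and a Beta integral in \<open>t\<close> produces the Gamma quotient.

  The Sobolev inequality follows from \<open>u(x)\<^sup>2 \<le> 2 (u(x) - u(y))\<^sup>2 + 2 u(y)\<^sup>2\<close>, averaged over \<open>y\<close> in a ball about \<open>x\<close>
  whose radius is then optimised. This gives the stronger bound of the critical norm by the seminorm and the Morrey norm
  \<open>sup r powr (- 2 s) \<integral> u\<^sup>2\<close> over balls of radius \<open>r\<close>. Hence a near-minimiser for \<open>S\<close> has, after a translation,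
  a Hardy term bounded away from \<open>0\<close>, so \<open>S\<^sub>\<mu> < S\<close> for \<open>\<mu> > 0\<close>. As an infimum of affine functions
  \<open>\<mu> \<mapsto> S\<^sub>\<mu>\<close> is concave, and strict monotonicity follows; no minimiser is needed.
\<close>

section \<open>Gaussian and Gamma integrals\<close>

text \<open>Testing the singular kernel directly against the ground state would call for principal
  values. At a fixed time the heat kernel has finite mass, so a finite L2 term can be cancelled
  there, and the singularity in t enters only through moments that converge separately. These
  cancellations need a finite L2 norm and a finite Hardy integral; hence the Hardy inequality is
  proved for test functions and carried to \<open>Hdot\<close> by Fatou's lemma, the Sobolev
  inequality supplying an almost everywhere convergent subsequence. Most estimates live in
  \<open>ennreal\<close>, where Tonelli's theorem asks for no integrability. The Hardy weight is at
  least r powr (-2s) on the ball of radius r about 0, so the Hardy integrals of the translates of u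
  control its Morrey norm, while translation fixes the seminorm and the critical norm. This makes
  the improved Sobolev inequality a uniform gain for almost minimisers, in place of compactness.
  Concavity then spreads the inequality between mass b and mass 0 to all pairs a < b.\<close>

lemma nn_integral_translate:
  fixes f :: "'a::euclidean_space \<Rightarrow> ennreal"
  assumes [measurable]: "f \<in> borel_measurable borel"
  shows "(\<integral>\<^sup>+x. f (a + x) \<partial>lborel) = (\<integral>\<^sup>+x. f x \<partial>lborel)"
proof -
  have "(\<integral>\<^sup>+x. f x \<partial>lborel) = (\<integral>\<^sup>+x. f x \<partial>distr lborel borel ((+) a))"
    by (simp add: lborel_distr_plus)
  also have "\<dots> = (\<integral>\<^sup>+x. f (a + x) \<partial>lborel)"
    by (subst nn_integral_distr) auto
  finally show ?thesis ..
qed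

lemma nn_integral_exp_square:
  fixes c :: real
  assumes "c > 0"
  shows "(\<integral>\<^sup>+x. ennreal (exp (- c * x\<^sup>2)) \<partial>lborel) = ennreal (sqrt (pi / c))"
proof -
  define \<sigma> where "\<sigma> = 1 / sqrt (2 * c)"
  have \<sigma>: "\<sigma> > 0" "\<sigma>\<^sup>2 = 1 / (2 * c)"
    using assms by (auto simp: \<sigma>_def power_divide)
  have eq: "exp (- c * x\<^sup>2) = sqrt (pi / c) * normal_density 0 \<sigma> x" for x
  proof -
    have "normal_density 0 \<sigma> x = 1 / sqrt (pi / c) * exp (- c * x\<^sup>2)"
      using assms by (simp add: normal_density_def \<sigma>(2))
    then show ?thesis using assms by simp
  qed
  have "(\<integral>\<^sup>+x. ennreal (exp (- c * x\<^sup>2)) \<partial>lborel)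
      = ennreal (sqrt (pi / c)) * (\<integral>\<^sup>+x. ennreal (normal_density 0 \<sigma> x) \<partial>lborel)"
    unfolding eq using assms by (subst nn_integral_cmult[symmetric]) (auto simp: ennreal_mult)
  also have "(\<integral>\<^sup>+x. ennreal (normal_density 0 \<sigma> x) \<partial>lborel) = 1"
    using \<sigma> by (subst nn_integral_eq_integral) (auto simp: integrable_normal_density integral_normal_density)
  finally show ?thesis by simp
qed

lemma exp_norm_square_eq_prod:
  fixes x :: "'a::euclidean_space"
  shows "exp (- c * (norm x)\<^sup>2) = (\<Prod>b\<in>Basis. exp (- c * (x \<bullet> b)\<^sup>2))"
proof -
  have "(norm x)\<^sup>2 = (\<Sum>b\<in>Basis. (x \<bullet> b)\<^sup>2)"
    unfolding power2_norm_eq_inner by (subst euclidean_inner) (simp add: power2_eq_square)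
  then show ?thesis
    by (simp add: exp_sum[symmetric] sum_negf sum_distrib_left)
qed

lemma nn_integral_exp_norm_square:
  fixes z :: "'a::euclidean_space"
  assumes "c > 0"
  shows "(\<integral>\<^sup>+x. ennreal (exp (- c * (norm (x - z))\<^sup>2)) \<partial>lborel) = ennreal ((pi / c) powr (DIM('a) / 2))"
proof -
  have "(\<integral>\<^sup>+x. ennreal (exp (- c * (norm (x - z))\<^sup>2)) \<partial>lborel)
      = (\<integral>\<^sup>+x. ennreal (exp (- c * (norm (x::'a))\<^sup>2)) \<partial>lborel)"
    using nn_integral_translate[of "\<lambda>x::'a. ennreal (exp (- c * (norm x)\<^sup>2))" "-z"] by simp
  also have "\<dots> = (\<integral>\<^sup>+(x::'a). (\<Prod>b\<in>Basis. ennreal (exp (- c * (x \<bullet> b)\<^sup>2))) \<partial>lborel)"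
    unfolding exp_norm_square_eq_prod by (subst prod_ennreal) auto
  also have "\<dots> = (\<Prod>b\<in>(Basis::'a set). (\<integral>\<^sup>+x. ennreal (exp (- c * x\<^sup>2)) \<partial>lborel))"
    by (rule nn_integral_lborel_prod) auto
  also have "\<dots> = ennreal (sqrt (pi / c) ^ DIM('a))"
    unfolding nn_integral_exp_square[OF assms] using assms by (simp add: ennreal_power)
  also have "sqrt (pi / c) ^ DIM('a) = (pi / c) powr (DIM('a) / 2)"
    using assms by (simp add: powr_half_sqrt[symmetric] powr_realpow[symmetric] powr_powr)
  finally show ?thesis .
qed

text \<open>The substitution v = A / t carries the Gamma integral into this one. With A a multiple
  of the squared norm it is the integral that mixes heat kernels into powers of the norm.\<close>

lemma nn_integral_inverse_gamma:
  fixes A c :: real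
  assumes "A > 0" "c > 0"
  shows "(\<integral>\<^sup>+t\<in>{0<..}. ennreal (t powr (- 1 - c) * exp (- A / t)) \<partial>lborel) = ennreal (Gamma c * A powr (- c))"
proof -
  define f where "f = (\<lambda>v::real. v powr (c - 1) / exp v)"
  have "(f has_integral Gamma c) {0..}"
    unfolding f_def using Gamma_integral_real assms by blast
  moreover have "negligible {x \<in> {0..} - {0<..}. f x \<noteq> 0}" "negligible {x \<in> {0<..} - {0..}. f x \<noteq> 0}"
    by (rule negligible_subset[of "{0}"]; force)+
  ultimately have f: "(f has_integral Gamma c) {0<..}"
    by (simp add: has_integral_spike_set_eq[of "{0..}" "{0<..}" f])
  have fabs: "f absolutely_integrable_on {0<..}"
    using f by (intro nonnegative_absolutely_integrable_1) (auto simp: f_def has_integral_integrable)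
  have im: "(\<lambda>t. A / t) ` {0<..} = {0<..}"
  proof
    show "{0<..} \<subseteq> (\<lambda>t. A / t) ` {0<..}"
    proof
      fix v :: real assume "v \<in> {0<..}"
      then show "v \<in> (\<lambda>t. A / t) ` {0<..}" using assms by (intro image_eqI[of _ _ "A / v"]) auto
    qed
  qed (use assms in auto)
  have "(\<lambda>t. \<bar>- (A / t\<^sup>2)\<bar> * f (A / t)) absolutely_integrable_on {0<..} \<and>
           integral {0<..} (\<lambda>t. \<bar>- (A / t\<^sup>2)\<bar> * f (A / t)) = Gamma c
     \<longleftrightarrow> f absolutely_integrable_on (\<lambda>t. A / t) ` {0<..} \<and> integral ((\<lambda>t. A / t) ` {0<..}) f = Gamma c"
    using assms by (intro has_absolute_integral_change_of_variables_1')
      (auto intro!: derivative_eq_intros inj_onI simp: power2_eq_square)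
  then have "(\<lambda>t. \<bar>- (A / t\<^sup>2)\<bar> * f (A / t)) absolutely_integrable_on {0<..} \<and>
           integral {0<..} (\<lambda>t. \<bar>- (A / t\<^sup>2)\<bar> * f (A / t)) = Gamma c"
    using f fabs unfolding im by (simp add: integral_unique)
  then have "((\<lambda>t. \<bar>- (A / t\<^sup>2)\<bar> * f (A / t)) has_integral Gamma c) {0<..}"
    using set_lebesgue_integral_eq_integral(1) by (auto simp: has_integral_iff)
  then have "((\<lambda>t. A powr (- c) * (\<bar>- (A / t\<^sup>2)\<bar> * f (A / t))) has_integral A powr (- c) * Gamma c) {0<..}"
    by (rule has_integral_mult_right)
  also have "?this \<longleftrightarrow> ((\<lambda>t. t powr (- 1 - c) * exp (- A / t)) has_integral A powr (- c) * Gamma c) {0<..}"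
  proof (rule has_integral_cong)
    fix t :: real assume t: "t \<in> {0<..}"
    have "A powr - c * (\<bar>- (A / t\<^sup>2)\<bar> * f (A / t))
        = (A powr - c * A * A powr (c - 1)) * (t powr (1 - c) / t\<^sup>2) * exp (- A / t)"
      using t assms by (simp add: f_def powr_divide exp_minus powr_diff field_simps)
    also have "A powr - c * A * A powr (c - 1) = 1"
      using assms by (simp add: powr_diff powr_minus field_simps)
    also have "t powr (1 - c) / t\<^sup>2 = t powr (- 1 - c)"
      using t by (simp add: powr_diff powr_minus power2_eq_square field_simps)
    finally show "A powr - c * (\<bar>- (A / t\<^sup>2)\<bar> * f (A / t)) = t powr (- 1 - c) * exp (- A / t)" by simp
  qed
  finally show ?thesis
    by (subst nn_integral_has_integral_lebesgue') (auto simp: mult_ac)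
qed

text \<open>After the scaling x = \<sigma> y with \<sigma>^2 = 2t the Gaussian becomes the standard
  normal density up to a constant, and its characteristic function at \<sigma> is exp(-t).\<close>

lemma nn_integral_cos_exp_square:
  fixes t :: real
  assumes "t > 0"
  shows "(\<integral>\<^sup>+x. ennreal ((1 - cos x) * exp (- x\<^sup>2 / (4 * t))) \<partial>lborel) = ennreal (sqrt (4 * pi * t) * (1 - exp (- t)))"
proof -
  define \<sigma> where "\<sigma> = sqrt (2 * t)"
  have \<sigma>: "\<sigma> > 0" "\<sigma>\<^sup>2 = 2 * t"
    using assms by (auto simp: \<sigma>_def)
  have int: "integrable std_normal_distribution (\<lambda>x. iexp (\<sigma> * x))"
    by (intro prob_space.integrable_iexp real_distribution.axioms(1) real_dist_normal_dist) auto
  have "(CLINT x|std_normal_distribution. iexp (\<sigma> * x)) = complex_of_real (exp (- (\<sigma>^2) / 2))"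
    using char_std_normal_distribution unfolding char_def by meson
  then have "Re (CLINT x|std_normal_distribution. iexp (\<sigma> * x)) = exp (- t)"
    using \<sigma> by simp
  then have 1: "(LINT x|std_normal_distribution. cos (\<sigma> * x)) = exp (- t)"
    using int by (subst (asm) integral_Re[symmetric]) (auto simp: Re_exp)
  have 2: "integrable std_normal_distribution (\<lambda>x. cos (\<sigma> * x))"
    using integrable_Re[OF int] by (simp add: Re_exp)
  have 3: "(LINT x|std_normal_distribution. 1 - cos (\<sigma> * x)) = 1 - exp (- t)"
    using 1 2 prob_space.prob_space[OF real_distribution.axioms(1)[OF real_dist_normal_dist]]
    by (subst Bochner_Integration.integral_diff) (auto intro!: prob_space.finite_measure finite_measure.integrable_const real_distribution.axioms(1) real_dist_normal_dist)
  have "(\<integral>\<^sup>+x. ennreal (1 - cos (\<sigma> * x)) \<partial>std_normal_distribution) = ennreal (1 - exp (- t))"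
    using 2 3 by (subst nn_integral_eq_integral) (auto intro!: Bochner_Integration.integrable_diff prob_space.finite_measure finite_measure.integrable_const real_distribution.axioms(1) real_dist_normal_dist)
  then have 4: "(\<integral>\<^sup>+x. ennreal (std_normal_density x) * ennreal (1 - cos (\<sigma> * x)) \<partial>lborel) = ennreal (1 - exp (- t))"
    by (subst (asm) nn_integral_density) auto
  have "(\<integral>\<^sup>+x. ennreal ((1 - cos x) * exp (- x\<^sup>2 / (4 * t))) \<partial>lborel)
     = ennreal \<sigma> * (\<integral>\<^sup>+x. ennreal ((1 - cos (\<sigma> * x)) * exp (- (\<sigma> * x)\<^sup>2 / (4 * t))) \<partial>lborel)"
    using \<sigma> by (subst nn_integral_real_affine[where c = \<sigma> and t = 0]) auto
  also have "(\<lambda>x. ennreal ((1 - cos (\<sigma> * x)) * exp (- (\<sigma> * x)\<^sup>2 / (4 * t)))) =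
      (\<lambda>x. ennreal (sqrt (2 * pi)) * (ennreal (std_normal_density x) * ennreal (1 - cos (\<sigma> * x))))"
    using assms \<sigma> by (auto simp: fun_eq_iff std_normal_density_def ennreal_mult'[symmetric] power_mult_distrib)
  also have "(\<integral>\<^sup>+x. ennreal (sqrt (2 * pi)) * (ennreal (std_normal_density x) * ennreal (1 - cos (\<sigma> * x))) \<partial>lborel)
     = ennreal (sqrt (2 * pi)) * ennreal (1 - exp (- t))"
    by (subst nn_integral_cmult) (auto simp: 4)
  also have "ennreal \<sigma> * (ennreal (sqrt (2 * pi)) * ennreal (1 - exp (- t))) = ennreal (sqrt (4 * pi * t) * (1 - exp (- t)))"
    using \<sigma> assms by (simp add: ennreal_mult'[symmetric] \<sigma>_def real_sqrt_mult[symmetric] mult_ac)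
  finally show ?thesis .
qed

section \<open>The unnormalised heat kernel and its mixtures in time\<close>

text \<open>The factor \<open>(4 * pi) powr (- (DIM('a) / 2))\<close> of the usual heat kernel is
  left out; it returns as the total mass \<open>(4 * pi) powr (DIM('a) / 2)\<close>.\<close>

definition heat :: "real \<Rightarrow> 'a::euclidean_space \<Rightarrow> real" where
  "heat t x = t powr (- (DIM('a) / 2)) * exp (- (norm x)\<^sup>2 / (4 * t))"

lemma heat_nonneg [simp]: "heat t x \<ge> 0"
  by (simp add: heat_def)

lemma heat_minus_commute: "heat t (x - y) = heat t (y - x)"
  by (simp add: heat_def norm_minus_commute)

lemma heat_measurable [measurable (raw)]:
  fixes g :: "'b \<Rightarrow> 'a::euclidean_space"
  assumes [measurable]: "f \<in> borel_measurable M" "g \<in> borel_measurable M"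
  shows "(\<lambda>x. heat (f x) (g x)) \<in> borel_measurable M"
  unfolding heat_def by measurable

lemma nn_integral_heat:
  fixes z :: "'a::euclidean_space"
  assumes "t > 0"
  shows "(\<integral>\<^sup>+x. ennreal (heat t (x - z)) \<partial>lborel) = ennreal ((4 * pi) powr (DIM('a) / 2))"
proof -
  have "(\<integral>\<^sup>+x. ennreal (heat t (x - z)) \<partial>lborel)
      = ennreal (t powr (- (DIM('a) / 2))) * (\<integral>\<^sup>+x. ennreal (exp (- (1 / (4 * t)) * (norm (x - z))\<^sup>2)) \<partial>lborel)"
    by (subst nn_integral_cmult[symmetric]) (auto simp: heat_def ennreal_mult)
  also have "\<dots> = ennreal (t powr (- (DIM('a) / 2))) * ennreal ((pi / (1 / (4 * t))) powr (DIM('a) / 2))"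
    using assms by (subst nn_integral_exp_norm_square) auto
  also have "\<dots> = ennreal (t powr (- (DIM('a) / 2)) * (4 * pi * t) powr (DIM('a) / 2))"
    using assms by (simp add: ennreal_mult'[symmetric] mult_ac)
  also have "t powr (- (DIM('a) / 2)) * (4 * pi * t) powr (DIM('a) / 2) = (4 * pi) powr (DIM('a) / 2)"
    using assms by (simp add: powr_mult powr_minus field_simps)
  finally show ?thesis .
qed

text \<open>Completing the square in \<open>y\<close>; the cross term dictates the centre
  \<open>(r / (t + r)) *\<^sub>R x\<close>.\<close>

lemma norm_square_convex_split:
  fixes x y :: "'a::euclidean_space"
  assumes "t > 0" "r > 0"
  shows "(norm (x - y))\<^sup>2 / (4 * t) + (norm y)\<^sup>2 / (4 * r)
       = (t + r) / (4 * t * r) * (norm (y - (r / (t + r)) *\<^sub>R x))\<^sup>2 + (norm x)\<^sup>2 / (4 * (t + r))"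
proof -
  have tr: "t + r \<noteq> 0" using assms by simp
  show ?thesis
    unfolding power2_norm_eq_inner inner_diff_left inner_diff_right inner_scaleR_left inner_scaleR_right
    using assms tr by (simp add: inner_commute[of y x] divide_simps) (simp add: algebra_simps power2_eq_square)
qed

text \<open>Semigroup law. The Gaussian in \<open>y\<close> left after completing the square
  integrates to a constant, and the missing normalisation leaves one factor
  \<open>(4 * pi) powr (DIM('a) / 2)\<close>.\<close>

lemma nn_integral_heat_heat:
  fixes x :: "'a::euclidean_space"
  assumes "t > 0" "r > 0"
  shows "(\<integral>\<^sup>+y. ennreal (heat t (x - y)) * ennreal (heat r y) \<partial>lborel)
       = ennreal ((4 * pi) powr (DIM('a) / 2)) * ennreal (heat (t + r) x)"
proof -
  define n where "n = DIM('a) / 2"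
  define c where "c = (t + r) / (4 * t * r)"
  have c: "c > 0" using assms by (simp add: c_def)
  have eq: "heat t (x - y) * heat r y = (t powr (- n) * r powr (- n) * exp (- (norm x)\<^sup>2 / (4 * (t + r))))
      * exp (- c * (norm (y - (r / (t + r)) *\<^sub>R x))\<^sup>2)" for y
  proof -
    have "exp (- (norm (x - y))\<^sup>2 / (4 * t)) * exp (- (norm y)\<^sup>2 / (4 * r))
       = exp (- ((norm (x - y))\<^sup>2 / (4 * t) + (norm y)\<^sup>2 / (4 * r)))"
      by (simp add: exp_add[symmetric])
    also have "\<dots> = exp (- (norm x)\<^sup>2 / (4 * (t + r))) * exp (- c * (norm (y - (r / (t + r)) *\<^sub>R x))\<^sup>2)"
      unfolding norm_square_convex_split[OF assms] c_def by (simp add: exp_add[symmetric])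
    finally show ?thesis unfolding heat_def n_def by (simp add: mult_ac)
  qed
  have "(\<integral>\<^sup>+y. ennreal (heat t (x - y)) * ennreal (heat r y) \<partial>lborel)
     = ennreal (t powr (- n) * r powr (- n) * exp (- (norm x)\<^sup>2 / (4 * (t + r)))) *
       (\<integral>\<^sup>+y. ennreal (exp (- c * (norm (y - (r / (t + r)) *\<^sub>R x))\<^sup>2)) \<partial>lborel)"
    by (subst nn_integral_cmult[symmetric]) (auto simp: ennreal_mult[symmetric] eq)
  also have "\<dots> = ennreal (t powr (- n) * r powr (- n) * exp (- (norm x)\<^sup>2 / (4 * (t + r))) * (pi / c) powr n)"
    using c by (subst nn_integral_exp_norm_square) (auto simp: ennreal_mult'[symmetric] n_def)
  also have "t powr (- n) * r powr (- n) * exp (- (norm x)\<^sup>2 / (4 * (t + r))) * (pi / c) powr n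
      = (4 * pi) powr n * heat (t + r) x"
    using assms by (simp add: heat_def n_def[symmetric] c_def powr_mult powr_divide powr_minus field_simps)
  finally show ?thesis by (simp add: ennreal_mult n_def)
qed

text \<open>Taking b = -s yields the kernel of the seminorm, a positive b yields powers such as the
  ground state. Convergence at t = 0 comes from x \<noteq> 0, at infinity from the bound on
  b.\<close>

lemma nn_integral_time_heat:
  fixes x :: "'a::euclidean_space" and b :: real
  assumes "x \<noteq> 0" "b < DIM('a) / 2"
  shows "(\<integral>\<^sup>+t\<in>{0<..}. ennreal (t powr (b - 1) * heat t x) \<partial>lborel)
       = ennreal (Gamma (DIM('a) / 2 - b) * 4 powr (DIM('a) / 2 - b) * norm x powr (2 * b - DIM('a)))"
proof -
  define c where "c = DIM('a) / 2 - b"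
  have "(\<integral>\<^sup>+t\<in>{0<..}. ennreal (t powr (b - 1) * heat t x) \<partial>lborel)
      = (\<integral>\<^sup>+t\<in>{0<..}. ennreal (t powr (- 1 - c) * exp (- ((norm x)\<^sup>2 / 4) / t)) \<partial>lborel)"
  proof (intro nn_integral_cong)
    fix t :: real
    have "t powr (b - 1) * t powr (- (DIM('a) / 2)) = t powr (- 1 - c)" if "t > 0"
      using that by (subst powr_add[symmetric]) (simp add: c_def algebra_simps)
    then show "ennreal (t powr (b - 1) * heat t x) * indicator {0<..} t
      = ennreal (t powr (- 1 - c) * exp (- ((norm x)\<^sup>2 / 4) / t)) * indicator {0<..} t"
      by (auto simp: heat_def indicator_def mult.assoc[symmetric])
  qed
  also have "\<dots> = ennreal (Gamma c * ((norm x)\<^sup>2 / 4) powr (- c))"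
    using assms by (intro nn_integral_inverse_gamma) (auto simp: c_def)
  also have "((norm x)\<^sup>2 / 4) powr (- c) = 4 powr c * norm x powr (- (2 * c))"
    using assms by (simp add: powr_divide powr_minus powr_powr power2_eq_square powr_mult powr_add[symmetric] field_simps)
  finally show ?thesis by (simp add: c_def algebra_simps)
qed

section \<open>Time integrals with a power weight\<close>

lemma nn_integral_powr_tail:
  fixes r s :: real
  assumes "r > 0" "s > 0"
  shows "(\<integral>\<^sup>+t\<in>{r<..}. ennreal (t powr (- 1 - s)) \<partial>lborel) = ennreal (r powr (- s) / s)"
proof -
  have "((\<lambda>x. x powr (- 1 - s)) has_integral - (r powr (- 1 - s + 1)) / (- 1 - s + 1)) {r..}"
    using assms by (intro has_integral_powr_to_inf) auto
  then have "(\<integral>\<^sup>+t\<in>{r..}. ennreal (t powr (- 1 - s)) \<partial>lborel) = ennreal (r powr (- s) / s)"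
    by (subst nn_integral_has_integral_lebesgue') auto
  also have "(\<integral>\<^sup>+t\<in>{r..}. ennreal (t powr (- 1 - s)) \<partial>lborel) = (\<integral>\<^sup>+t\<in>{r<..}. ennreal (t powr (- 1 - s)) \<partial>lborel)"
    by (intro nn_integral_cong_AE eventually_mono[OF AE_lborel_singleton[of r]]) (auto simp: indicator_def)
  finally show ?thesis .
qed

text \<open>Integration by parts without boundary terms: \<open>F\<close> is written as the integral
  of \<open>f\<close>, and Tonelli leaves the tail of \<open>t powr (- 1 - s)\<close> over t > r. It
  serves \<open>1 - exp (- t)\<close> and \<open>1 - pos_powr a t\<close>, whose vanishing at 0
  tames the weight.\<close>

lemma nn_integral_powr_times_primitive:
  fixes f :: "real \<Rightarrow> real" and F :: "real \<Rightarrow> ennreal"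
  assumes [measurable]: "f \<in> borel_measurable borel" and s: "s > 0"
    and F: "\<And>t. t > 0 \<Longrightarrow> F t = (\<integral>\<^sup>+r\<in>{0<..<t}. ennreal (f r) \<partial>lborel)"
  shows "(\<integral>\<^sup>+t\<in>{0<..}. ennreal (t powr (- 1 - s)) * F t \<partial>lborel)
       = (\<integral>\<^sup>+r\<in>{0<..}. ennreal (r powr (- s) / s) * ennreal (f r) \<partial>lborel)"
proof -
  have "(\<integral>\<^sup>+t\<in>{0<..}. ennreal (t powr (- 1 - s)) * F t \<partial>lborel)
      = (\<integral>\<^sup>+t. (\<integral>\<^sup>+r. ennreal (t powr (- 1 - s)) * ennreal (f r) * indicator {(t,r). 0 < r \<and> r < t} (t, r) \<partial>lborel) \<partial>lborel)"
  proof (intro nn_integral_cong)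
    fix t :: real
    show "ennreal (t powr (- 1 - s)) * F t * indicator {0<..} t
      = (\<integral>\<^sup>+r. ennreal (t powr (- 1 - s)) * ennreal (f r) * indicator {(t,r). 0 < r \<and> r < t} (t, r) \<partial>lborel)"
    proof (cases "t > 0")
      case True
      then show ?thesis
        by (subst F) (auto simp: nn_integral_cmult[symmetric] mult.assoc indicator_def intro!: nn_integral_cong)
    next
      case False
      then have "(\<lambda>r. ennreal (t powr (- 1 - s)) * ennreal (f r) * indicator {(t,r). 0 < r \<and> r < t} (t, r)) = (\<lambda>r. 0)"
        by (auto simp: indicator_def)
      then show ?thesis using False by simp
    qed
  qed
  also have "\<dots> = (\<integral>\<^sup>+r. (\<integral>\<^sup>+t. ennreal (t powr (- 1 - s)) * ennreal (f r) * indicator {(t,r). 0 < r \<and> r < t} (t, r) \<partial>lborel) \<partial>lborel)"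
    by (rule lborel_pair.Fubini') measurable
  also have "\<dots> = (\<integral>\<^sup>+r\<in>{0<..}. ennreal (r powr (- s) / s) * ennreal (f r) \<partial>lborel)"
  proof (intro nn_integral_cong)
    fix r :: real
    show "(\<integral>\<^sup>+t. ennreal (t powr (- 1 - s)) * ennreal (f r) * indicator {(t,r). 0 < r \<and> r < t} (t, r) \<partial>lborel)
      = ennreal (r powr (- s) / s) * ennreal (f r) * indicator {0<..} r"
    proof (cases "r > 0")
      case True
      have "(\<integral>\<^sup>+t. ennreal (t powr (- 1 - s)) * ennreal (f r) * indicator {(t,r). 0 < r \<and> r < t} (t, r) \<partial>lborel)
         = (\<integral>\<^sup>+t. (ennreal (t powr (- 1 - s)) * indicator {r<..} t) * ennreal (f r) \<partial>lborel)"
        using True by (auto simp: indicator_def intro!: nn_integral_cong)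
      also have "\<dots> = ennreal (r powr (- s) / s) * ennreal (f r)"
        using True s by (subst nn_integral_multc) (auto simp: nn_integral_powr_tail)
      finally show ?thesis using True by simp
    next
      case False
      then have "(\<lambda>t. ennreal (t powr (- 1 - s)) * ennreal (f r) * indicator {(t,r). 0 < r \<and> r < t} (t, r)) = (\<lambda>r. 0)"
        by (auto simp: indicator_def)
      then show ?thesis using False by simp
    qed
  qed
  finally show ?thesis .
qed

lemma nn_integral_one_minus_exp:
  fixes s :: real
  assumes "0 < s" "s < 1"
  shows "(\<integral>\<^sup>+t\<in>{0<..}. ennreal (t powr (- 1 - s) * (1 - exp (- t))) \<partial>lborel) = ennreal (Gamma (1 - s) / s)"
proof -
  have F: "ennreal (1 - exp (- t)) = (\<integral>\<^sup>+r\<in>{0<..<t}. ennreal (exp (- r)) \<partial>lborel)" if "t > 0" for t :: real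
  proof -
    have "((\<lambda>r. exp (- r)) has_integral (- exp (- t)) - (- exp (- 0))) {0..t}"
      using that by (intro fundamental_theorem_of_calculus)
        (auto intro!: derivative_eq_intros simp flip: has_real_derivative_iff_has_vector_derivative)
    then have "((\<lambda>r. exp (- r)) has_integral (1 - exp (- t))) {0<..<t}"
      by (simp add: has_integral_Icc_iff_Ioo)
    then show ?thesis by (subst nn_integral_has_integral_lebesgue') auto
  qed
  have "(\<integral>\<^sup>+t\<in>{0<..}. ennreal (t powr (- 1 - s) * (1 - exp (- t))) \<partial>lborel)
     = (\<integral>\<^sup>+t\<in>{0<..}. ennreal (t powr (- 1 - s)) * ennreal (1 - exp (- t)) \<partial>lborel)"
    by (intro nn_integral_cong) (auto simp: indicator_def ennreal_mult')
  also have "\<dots> = (\<integral>\<^sup>+r\<in>{0<..}. ennreal (r powr (- s) / s) * ennreal (exp (- r)) \<partial>lborel)"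
    using assms F by (intro nn_integral_powr_times_primitive) auto
  also have "\<dots> = (\<integral>\<^sup>+r\<in>{0..}. ennreal (r powr (1 - s - 1) / exp r / s) \<partial>lborel)"
    using assms by (intro nn_integral_cong_AE eventually_mono[OF AE_lborel_singleton[of 0]])
      (auto simp: indicator_def ennreal_mult[symmetric] exp_minus field_simps)
  also have "\<dots> = ennreal (Gamma (1 - s) / s)"
    using assms by (intro nn_integral_has_integral_lebesgue' has_integral_divide Gamma_integral_real) auto
  finally show ?thesis .
qed

text \<open>This truncated power appears when the times of a heat mixture are shifted: (r - t) powr
  a restricted to r > t is \<open>r powr a * pos_powr a (t / r)\<close>.\<close>

definition pos_powr :: "real \<Rightarrow> real \<Rightarrow> real" where
  "pos_powr a t = (if t < 1 then (1 - t) powr a else 0)"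

lemma pos_powr_nonneg [simp]: "pos_powr a t \<ge> 0"
  by (simp add: pos_powr_def)

lemma pos_powr_le_1: "a \<ge> 0 \<Longrightarrow> t \<ge> 0 \<Longrightarrow> pos_powr a t \<le> 1"
  by (auto simp: pos_powr_def powr_le1)

lemma pos_powr_measurable [measurable]: "pos_powr a \<in> borel_measurable borel"
  unfolding pos_powr_def by measurable

lemma nn_integral_pos_powr:
  fixes s a :: real
  assumes "s < 1" "0 < a"
  shows "(\<integral>\<^sup>+t\<in>{0<..}. ennreal (t powr (- s) * pos_powr (a - 1) t) \<partial>lborel) = ennreal (Beta (1 - s) a)"
proof -
  have "((\<lambda>t. t powr (1 - s - 1) * (1 - t) powr (a - 1)) has_integral Beta (1 - s) a) {0..1}"
    using assms by (intro has_integral_Beta_real) auto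
  then have "(\<integral>\<^sup>+t\<in>{0<..<1}. ennreal (t powr (- s) * (1 - t) powr (a - 1)) \<partial>lborel) = ennreal (Beta (1 - s) a)"
    by (subst nn_integral_has_integral_lebesgue') (auto simp: has_integral_Icc_iff_Ioo)
  also have "(\<integral>\<^sup>+t\<in>{0<..<1}. ennreal (t powr (- s) * (1 - t) powr (a - 1)) \<partial>lborel) =
    (\<integral>\<^sup>+t\<in>{0<..}. ennreal (t powr (- s) * pos_powr (a - 1) t) \<partial>lborel)"
    by (intro nn_integral_cong) (auto simp: indicator_def pos_powr_def)
  finally show ?thesis .
qed

lemma nn_integral_one_minus_pos_powr:
  fixes s a :: real
  assumes "0 < s" "s < 1" "0 < a"
  shows "(\<integral>\<^sup>+t\<in>{0<..}. ennreal (t powr (- 1 - s) * (1 - pos_powr a t)) \<partial>lborel) = ennreal (a / s * Beta (1 - s) a)"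
proof -
  have F: "ennreal (1 - pos_powr a t) = (\<integral>\<^sup>+r\<in>{0<..<t}. ennreal (a * pos_powr (a - 1) r) \<partial>lborel)" if "t > 0" for t :: real
  proof (cases "t < 1")
    case True
    have "((\<lambda>r. a * (1 - r) powr (a - 1)) has_integral (- ((1 - t) powr a)) - (- ((1 - 0) powr a))) {0..t}"
      using that True by (intro fundamental_theorem_of_calculus)
        (auto intro!: derivative_eq_intros simp flip: has_real_derivative_iff_has_vector_derivative)
    then have "((\<lambda>r. a * (1 - r) powr (a - 1)) has_integral (1 - (1 - t) powr a)) {0<..<t}"
      by (simp add: has_integral_Icc_iff_Ioo)
    then have "(\<integral>\<^sup>+r\<in>{0<..<t}. ennreal (a * (1 - r) powr (a - 1)) \<partial>lborel) = ennreal (1 - (1 - t) powr a)"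
      using assms by (subst nn_integral_has_integral_lebesgue') auto
    also have "(\<integral>\<^sup>+r\<in>{0<..<t}. ennreal (a * (1 - r) powr (a - 1)) \<partial>lborel)
       = (\<integral>\<^sup>+r\<in>{0<..<t}. ennreal (a * pos_powr (a - 1) r) \<partial>lborel)"
      using True by (intro nn_integral_cong) (auto simp: indicator_def pos_powr_def)
    finally show ?thesis using True by (simp add: pos_powr_def)
  next
    case False
    \<comment> \<open>Beyond t = 1 the primitive is complete and equals a times Beta 1 a, which is
      1. The inert factor \<open>r powr (- 0)\<close> matches \<open>nn_integral_pos_powr\<close> at
      s = 0.\<close>
    have "(\<integral>\<^sup>+r\<in>{0<..<t}. ennreal (a * pos_powr (a - 1) r) \<partial>lborel)
       = (\<integral>\<^sup>+r. ennreal a * (ennreal (r powr (- 0) * pos_powr (a - 1) r) * indicator {0<..} r) \<partial>lborel)"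
      using False assms by (intro nn_integral_cong) (auto simp: indicator_def pos_powr_def ennreal_mult)
    also have "\<dots> = ennreal a * ennreal (Beta (1 - 0) a)"
      using assms by (subst nn_integral_cmult) (auto simp: nn_integral_pos_powr simp del: powr_zero_eq_one minus_zero)
    also have "\<dots> = 1"
    proof -
      have "Gamma (a + 1) = a * Gamma a"
        using assms by (intro Gamma_plus1) (auto dest: nonpos_Ints_nonpos)
      then show ?thesis
        using assms Gamma_real_pos[OF assms(3)] by (simp add: Beta_def less_imp_neq[THEN not_sym] ennreal_mult'[symmetric] add.commute[of 1 a])
    qed
    finally show ?thesis using False by (simp add: pos_powr_def)
  qed
  have "(\<integral>\<^sup>+t\<in>{0<..}. ennreal (t powr (- 1 - s) * (1 - pos_powr a t)) \<partial>lborel)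
     = (\<integral>\<^sup>+t\<in>{0<..}. ennreal (t powr (- 1 - s)) * ennreal (1 - pos_powr a t) \<partial>lborel)"
    by (intro nn_integral_cong) (auto simp: indicator_def ennreal_mult')
  also have "\<dots> = (\<integral>\<^sup>+r\<in>{0<..}. ennreal (r powr (- s) / s) * ennreal (a * pos_powr (a - 1) r) \<partial>lborel)"
    using assms F by (intro nn_integral_powr_times_primitive) auto
  also have "\<dots> = (\<integral>\<^sup>+r. ennreal (a / s) * (ennreal (r powr (- s) * pos_powr (a - 1) r) * indicator {0<..} r) \<partial>lborel)"
    using assms by (intro nn_integral_cong) (auto simp: indicator_def ennreal_mult[symmetric])
  also have "\<dots> = ennreal (a / s) * ennreal (Beta (1 - s) a)"
    using assms by (subst nn_integral_cmult) (auto simp: nn_integral_pos_powr)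
  finally show ?thesis using assms by (simp add: ennreal_mult'[symmetric])
qed

lemma nn_integral_set_cmult:
  assumes [measurable]: "f \<in> borel_measurable M" "A \<in> sets M"
  shows "(\<integral>\<^sup>+x\<in>A. c * f x \<partial>M) = c * (\<integral>\<^sup>+x\<in>A. f x \<partial>M)"
  by (subst nn_integral_cmult[symmetric]) (auto simp: mult_ac)

lemma divide_powr_eq: "c / x powr p = c * x powr (- p)" for c x p :: real
  by (simp add: powr_minus_divide)

section \<open>Subordination to the heat kernel and the fractional constant\<close>

lemma nn_integral_subordination:
  fixes f :: "'a::euclidean_space \<Rightarrow> ennreal" and s :: real
  assumes [measurable]: "f \<in> borel_measurable borel" and s: "0 < s"
  shows "ennreal (Gamma (DIM('a) / 2 + s) * 4 powr (DIM('a) / 2 + s)) *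
           (\<integral>\<^sup>+z. f z * ennreal (norm z powr (- (DIM('a) + 2 * s))) \<partial>lborel)
       = (\<integral>\<^sup>+t\<in>{0<..}. ennreal (t powr (- 1 - s)) * (\<integral>\<^sup>+z. f z * ennreal (heat t z) \<partial>lborel) \<partial>lborel)"
proof -
  define K where "K = Gamma (DIM('a) / 2 + s) * 4 powr (DIM('a) / 2 + s)"
  have K: "K \<ge> 0" unfolding K_def using s by (intro mult_nonneg_nonneg Gamma_real_nonneg) auto
  have *: "ennreal (K * norm z powr (- (DIM('a) + 2 * s)))
      = (\<integral>\<^sup>+t\<in>{0<..}. ennreal (t powr (- 1 - s) * heat t z) \<partial>lborel)" if "z \<noteq> 0" for z :: 'a
  proof -
    have e: "DIM('a) / 2 - - s = DIM('a) / 2 + s" "2 * - s - DIM('a) = - (DIM('a) + 2 * s)" "- s - 1 = - 1 - s"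
      by simp_all
    have "- s < DIM('a) / 2" using s by (smt (verit) divide_nonneg_nonneg of_nat_0_le_iff)
    from nn_integral_time_heat[OF that this] show ?thesis
      unfolding e K_def by simp
  qed
  have "ennreal K * (\<integral>\<^sup>+z. f z * ennreal (norm z powr (- (DIM('a) + 2 * s))) \<partial>lborel)
      = (\<integral>\<^sup>+z. ennreal K * (f z * ennreal (norm z powr (- (DIM('a) + 2 * s)))) \<partial>lborel)"
    by (subst nn_integral_cmult) auto
  also have "\<dots> = (\<integral>\<^sup>+z. (\<integral>\<^sup>+t. f z * (ennreal (t powr (- 1 - s) * heat t z) * indicator {0<..} t) \<partial>lborel) \<partial>lborel)"
  \<comment> \<open>At z = 0 the two sides may disagree: \<open>powr\<close> returns 0 there, while
    the time integral diverges. The origin is a null set.\<close>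
  proof (intro nn_integral_cong_AE eventually_mono[OF AE_lborel_singleton[of 0]])
    fix z :: 'a assume "z \<noteq> 0"
    have "ennreal K * (f z * ennreal (norm z powr (- (DIM('a) + 2 * s))))
       = f z * ennreal (K * norm z powr (- (DIM('a) + 2 * s)))"
      using K by (simp add: ennreal_mult' mult_ac)
    then show "ennreal K * (f z * ennreal (norm z powr (- (DIM('a) + 2 * s))))
      = (\<integral>\<^sup>+t. f z * (ennreal (t powr (- 1 - s) * heat t z) * indicator {0<..} t) \<partial>lborel)"
      by (subst nn_integral_cmult, measurable, simp only: *[OF \<open>z \<noteq> 0\<close>])
  qed
  also have "\<dots> = (\<integral>\<^sup>+t. (\<integral>\<^sup>+z. f z * (ennreal (t powr (- 1 - s) * heat t z) * indicator {0<..} t) \<partial>lborel) \<partial>lborel)"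
    by (rule lborel_pair.Fubini') measurable
  also have "\<dots> = (\<integral>\<^sup>+t\<in>{0<..}. ennreal (t powr (- 1 - s)) * (\<integral>\<^sup>+z. f z * ennreal (heat t z) \<partial>lborel) \<partial>lborel)"
    by (intro nn_integral_cong)
      (auto simp: indicator_def ennreal_mult mult_ac nn_integral_cmult[symmetric] intro!: nn_integral_cong)
  finally show ?thesis unfolding K_def .
qed

text \<open>The Gaussian factorises over the coordinates and only the factor in direction
  \<open>e\<close> sees the cosine. In Fourier terms the heat semigroup multiplies a wave of unit
  frequency by exp(-t).\<close>

lemma nn_integral_cos_heat:
  fixes e :: "'a::euclidean_space"
  assumes "t > 0" "e \<in> Basis"
  shows "(\<integral>\<^sup>+z. ennreal (1 - cos (z \<bullet> e)) * ennreal (heat t z) \<partial>lborel)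
    = ennreal ((4 * pi) powr (DIM('a) / 2) * (1 - exp (- t)))"
proof -
  define F where "F = (\<lambda>b x. ennreal (if b = e then (1 - cos x) * exp (- (1 / (4 * t)) * x\<^sup>2) else exp (- (1 / (4 * t)) * x\<^sup>2)))"
  have "(\<integral>\<^sup>+z. ennreal (1 - cos (z \<bullet> e)) * ennreal (heat t z) \<partial>lborel)
     = ennreal (t powr (- (DIM('a) / 2))) * (\<integral>\<^sup>+(z::'a). (\<Prod>b\<in>Basis. F b (z \<bullet> b)) \<partial>lborel)"
  proof (subst nn_integral_cmult[symmetric])
    show "(\<lambda>z::'a. \<Prod>b\<in>Basis. F b (z \<bullet> b)) \<in> borel_measurable lborel"
      unfolding F_def by measurable
    have "(\<Prod>b\<in>Basis. F b (z \<bullet> b)) = ennreal ((1 - cos (z \<bullet> e)) * exp (- (1 / (4 * t)) * (norm z)\<^sup>2))" for z :: 'a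
    proof -
      have "(\<Prod>b\<in>Basis. F b (z \<bullet> b)) = ennreal (\<Prod>b\<in>Basis. (if b = e then 1 - cos (z \<bullet> e) else 1) * exp (- (1 / (4 * t)) * (z \<bullet> b)\<^sup>2))"
        unfolding F_def by (subst prod_ennreal) (auto intro!: arg_cong[where f = ennreal] prod.cong)
      also have "\<dots> = ennreal ((1 - cos (z \<bullet> e)) * exp (- (1 / (4 * t)) * (norm z)\<^sup>2))"
        unfolding exp_norm_square_eq_prod prod.distrib using assms by simp
      finally show ?thesis .
    qed
    then show "(\<integral>\<^sup>+z. ennreal (1 - cos (z \<bullet> e)) * ennreal (heat t z) \<partial>lborel)
       = (\<integral>\<^sup>+(z::'a). ennreal (t powr (- (DIM('a) / 2))) * (\<Prod>b\<in>Basis. F b (z \<bullet> b)) \<partial>lborel)"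
      by (auto simp: heat_def ennreal_mult'[symmetric] mult_ac intro!: nn_integral_cong)
  qed
  also have "(\<integral>\<^sup>+(z::'a). (\<Prod>b\<in>Basis. F b (z \<bullet> b)) \<partial>lborel) = (\<Prod>b\<in>Basis. (\<integral>\<^sup>+x. F b x \<partial>lborel))"
    by (rule nn_integral_lborel_prod) (auto simp: F_def)
  also have "(\<Prod>b\<in>Basis. (\<integral>\<^sup>+x. F b x \<partial>lborel))
      = (\<Prod>b\<in>(Basis::'a set). ennreal ((if b = e then 1 - exp (- t) else 1) * sqrt (4 * pi * t)))"
    using nn_integral_cos_exp_square[OF assms(1)] nn_integral_exp_square[of "1 / (4 * t)"] assms
    by (intro prod.cong) (auto simp: F_def mult_ac)
  also have "\<dots> = ennreal ((1 - exp (- t)) * sqrt (4 * pi * t) ^ DIM('a))"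
    using assms by (subst prod_ennreal) (auto simp: prod.distrib)
  also have "ennreal (t powr (- (DIM('a) / 2))) * \<dots>
     = ennreal (t powr (- (DIM('a) / 2)) * sqrt (4 * pi * t) ^ DIM('a) * (1 - exp (- t)))"
    using assms by (simp add: ennreal_mult'[symmetric] mult_ac)
  also have "t powr (- (DIM('a) / 2)) * sqrt (4 * pi * t) ^ DIM('a) = (4 * pi) powr (DIM('a) / 2)"
  proof -
    have "sqrt (4 * pi * t) ^ DIM('a) = (4 * pi * t) powr (DIM('a) / 2)"
      using assms by (simp add: powr_half_sqrt[symmetric] powr_realpow[symmetric] powr_powr)
    then show ?thesis using assms by (simp add: powr_mult powr_minus field_simps)
  qed
  finally show ?thesis .
qed

lemma nn_integral_cos_kernel:
  fixes e :: "'a::euclidean_space" and s :: real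
  assumes "e \<in> Basis" "0 < s" "s < 1"
  shows "ennreal (Gamma (DIM('a) / 2 + s) * 4 powr (DIM('a) / 2 + s)) *
           (\<integral>\<^sup>+z. ennreal (1 - cos (z \<bullet> e)) * ennreal (norm z powr (- (DIM('a) + 2 * s))) \<partial>lborel)
       = ennreal ((4 * pi) powr (DIM('a) / 2) * (Gamma (1 - s) / s))"
proof -
  have "ennreal (Gamma (DIM('a) / 2 + s) * 4 powr (DIM('a) / 2 + s)) *
           (\<integral>\<^sup>+z. ennreal (1 - cos (z \<bullet> e)) * ennreal (norm z powr (- (DIM('a) + 2 * s))) \<partial>lborel)
      = (\<integral>\<^sup>+t\<in>{0<..}. ennreal (t powr (- 1 - s)) * (\<integral>\<^sup>+z. ennreal (1 - cos (z \<bullet> e)) * ennreal (heat t z) \<partial>lborel) \<partial>lborel)"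
    using assms by (intro nn_integral_subordination) auto
  also have "\<dots> = (\<integral>\<^sup>+t\<in>{0<..}. ennreal ((4 * pi) powr (DIM('a) / 2)) * ennreal (t powr (- 1 - s) * (1 - exp (- t))) \<partial>lborel)"
  proof (intro nn_integral_cong)
    fix t :: real
    show "ennreal (t powr (- 1 - s)) * (\<integral>\<^sup>+z. ennreal (1 - cos (z \<bullet> e)) * ennreal (heat t z) \<partial>lborel) * indicator {0<..} t
      = ennreal ((4 * pi) powr (DIM('a) / 2)) * ennreal (t powr (- 1 - s) * (1 - exp (- t))) * indicator {0<..} t"
    proof (cases "t > 0")
      case True
      then show ?thesis
        unfolding nn_integral_cos_heat[OF True assms(1)] by (simp add: ennreal_mult'[symmetric] mult_ac)
    qed simp
  qed
  also have "\<dots> = ennreal ((4 * pi) powr (DIM('a) / 2)) * ennreal (Gamma (1 - s) / s)"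
    using assms by (subst nn_integral_set_cmult) (auto simp: nn_integral_one_minus_exp)
  finally show ?thesis by (simp only: ennreal_mult'[OF powr_ge_zero])
qed

text \<open>A closed form is needed because the Gamma quotient of \<open>hardy_const\<close> has to
  come out exactly. Subordination reduces the defining integral to
  \<open>nn_integral_one_minus_exp\<close>; it is finite, so the Bochner integral in the definition
  is not a default 0.\<close>

lemma frac_const_eq:
  assumes "0 < s" "s < 1"
  shows "frac_const TYPE('n::finite) s =
    Gamma (CARD('n) / 2 + s) * 4 powr (CARD('n) / 2 + s) * s / ((4 * pi) powr (CARD('n) / 2) * Gamma (1 - s))"
proof -
  define i :: 'n where "i = (SOME i. True)"
  define K where "K = Gamma (CARD('n) / 2 + s) * 4 powr (CARD('n) / 2 + s)"
  define R where "R = (4 * pi) powr (CARD('n) / 2) * (Gamma (1 - s) / s)"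
  define I where "I = (LINT \<zeta>|(lborel :: (real ^ 'n) measure). (1 - cos (\<zeta> $ i)) / norm \<zeta> powr (real CARD('n) + 2 * s))"
  have K: "K > 0" unfolding K_def using assms by (intro mult_pos_pos Gamma_real_pos) (auto simp: add_nonneg_pos)
  have R: "R > 0" unfolding R_def using assms by (intro mult_pos_pos Gamma_real_pos divide_pos_pos) auto
  have "I = enn2real (\<integral>\<^sup>+\<zeta>. ennreal ((1 - cos (\<zeta> $ i)) / norm (\<zeta> :: real^'n) powr (real CARD('n) + 2 * s)) \<partial>lborel)"
    unfolding I_def by (intro integral_eq_nn_integral) auto
  also have "(\<integral>\<^sup>+\<zeta>. ennreal ((1 - cos (\<zeta> $ i)) / norm (\<zeta> :: real^'n) powr (real CARD('n) + 2 * s)) \<partial>lborel)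
     = (\<integral>\<^sup>+z. ennreal (1 - cos (z \<bullet> axis i 1)) * ennreal (norm (z :: real^'n) powr (- (DIM(real^'n) + 2 * s))) \<partial>lborel)"
    by (intro nn_integral_cong) (simp only: inner_axis inner_real_def mult_1_right DIM_cart DIM_real divide_powr_eq, simp add: ennreal_mult')
  finally have I: "I = enn2real \<dots>" .
  have "ennreal K * (\<integral>\<^sup>+z. ennreal (1 - cos (z \<bullet> axis i 1)) * ennreal (norm (z :: real^'n) powr (- (DIM(real^'n) + 2 * s))) \<partial>lborel) = ennreal R"
    using nn_integral_cos_kernel[of "axis i 1 :: real^'n" s] assms by (simp add: K_def R_def axis_in_Basis_iff)
  then have "K * I = R"
    unfolding I using K R by (auto dest!: arg_cong[of _ _ enn2real] simp: enn2real_mult)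
  then have "inverse I = K / R" using K R by (auto simp: field_simps)
  then show ?thesis
    unfolding frac_const_def I_def i_def K_def R_def using assms by simp
qed

text \<open>The Picone inequality is multiplied by the heat kernel, integrated in both variables and
  symmetrised by Tonelli. Each term stays on the side where it is nonnegative, so infinite integrals
  do no harm and cancellation is left to the application.\<close>

lemma heat_picone:
  fixes u w :: "'a::euclidean_space \<Rightarrow> real"
  assumes [measurable]: "u \<in> borel_measurable borel" "w \<in> borel_measurable borel"
    and w: "\<And>x. x \<noteq> 0 \<Longrightarrow> w x > 0" and t: "t > 0"
  shows "2 * ennreal ((4 * pi) powr (DIM('a) / 2)) * (\<integral>\<^sup>+x. ennreal ((u x)\<^sup>2) \<partial>lborel)
    \<le> (\<integral>\<^sup>+x. (\<integral>\<^sup>+y. ennreal ((u x - u y)\<^sup>2) * ennreal (heat t (x - y)) \<partial>lborel) \<partial>lborel)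
      + 2 * (\<integral>\<^sup>+x. ennreal ((u x)\<^sup>2) * ennreal (1 / w x) * (\<integral>\<^sup>+y. ennreal (heat t (x - y)) * ennreal (w y) \<partial>lborel) \<partial>lborel)"
proof -
  let ?k = "ennreal ((4 * pi) powr (DIM('a) / 2))"
  define P where "P = (\<lambda>x y. ennreal ((u x)\<^sup>2 * (w y / w x) * heat t (x - y)))"
  define Q where "Q = (\<lambda>x y. ennreal ((u x)\<^sup>2 * heat t (x - y)))"
  define V where "V = (\<lambda>x y. ennreal ((u x - u y)\<^sup>2 * heat t (x - y)))"
  have [measurable]: "(\<lambda>p. P (fst p) (snd p)) \<in> borel_measurable (borel \<Otimes>\<^sub>M borel)"
     "(\<lambda>p. Q (fst p) (snd p)) \<in> borel_measurable (borel \<Otimes>\<^sub>M borel)"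
     "(\<lambda>p. V (fst p) (snd p)) \<in> borel_measurable (borel \<Otimes>\<^sub>M borel)"
    unfolding P_def Q_def V_def by measurable
  have Q1: "(\<integral>\<^sup>+x. (\<integral>\<^sup>+y. Q x y \<partial>lborel) \<partial>lborel) = ?k * (\<integral>\<^sup>+x. ennreal ((u x)\<^sup>2) \<partial>lborel)"
  proof -
    have "(\<integral>\<^sup>+y. Q x y \<partial>lborel) = ?k * ennreal ((u x)\<^sup>2)" for x
    proof -
      have "(\<integral>\<^sup>+y. Q x y \<partial>lborel) = ennreal ((u x)\<^sup>2) * (\<integral>\<^sup>+y. ennreal (heat t (y - x)) \<partial>lborel)"
        unfolding Q_def by (subst nn_integral_cmult[symmetric]) (auto simp: ennreal_mult heat_minus_commute)
      then show ?thesis using t by (simp add: nn_integral_heat mult.commute)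
    qed
    then show ?thesis by (simp add: nn_integral_cmult)
  qed
  have P1: "(\<integral>\<^sup>+x. (\<integral>\<^sup>+y. P x y \<partial>lborel) \<partial>lborel)
     = (\<integral>\<^sup>+x. ennreal ((u x)\<^sup>2) * ennreal (1 / w x) * (\<integral>\<^sup>+y. ennreal (heat t (x - y)) * ennreal (w y) \<partial>lborel) \<partial>lborel)"
  proof (intro nn_integral_cong_AE eventually_mono[OF AE_lborel_singleton[of 0]])
    fix x :: 'a assume "x \<noteq> 0"
    then have "w x > 0" by (rule w)
    \<comment> \<open>Only the sign of \<open>w\<close> off the origin is known; if w y < 0, both
      sides are truncated to 0 by \<open>ennreal\<close>.\<close>
    then have "P x y = ennreal ((u x)\<^sup>2) * ennreal (1 / w x) * (ennreal (heat t (x - y)) * ennreal (w y))" for y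
      unfolding P_def by (cases "w y \<ge> 0") (auto simp: ennreal_mult'[symmetric] ennreal_neg field_simps mult_nonneg_nonpos zero_le_mult_iff mult_le_0_iff divide_le_0_iff intro!: ennreal_neg)
    then show "(\<integral>\<^sup>+y. P x y \<partial>lborel) = ennreal ((u x)\<^sup>2) * ennreal (1 / w x) * (\<integral>\<^sup>+y. ennreal (heat t (x - y)) * ennreal (w y) \<partial>lborel)"
      by (simp add: nn_integral_cmult)
  qed
  have Q2: "(\<integral>\<^sup>+x. (\<integral>\<^sup>+y. Q y x \<partial>lborel) \<partial>lborel) = (\<integral>\<^sup>+x. (\<integral>\<^sup>+y. Q x y \<partial>lborel) \<partial>lborel)"
    by (rule lborel_pair.Fubini') measurable
  have P2: "(\<integral>\<^sup>+x. (\<integral>\<^sup>+y. P y x \<partial>lborel) \<partial>lborel) = (\<integral>\<^sup>+x. (\<integral>\<^sup>+y. P x y \<partial>lborel) \<partial>lborel)"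
    by (rule lborel_pair.Fubini') measurable
  have le: "Q x y + Q y x \<le> V x y + (P x y + P y x)" if "x \<noteq> 0" "y \<noteq> 0" for x y
  proof -
    have wx: "w x > 0" "w y > 0" using w that by auto
    define r where "r = w y / w x"
    have r: "r > 0" "w x / w y = 1 / r" using wx by (auto simp: r_def)
    \<comment> \<open>Picone in the ratio r = w y / w x: expanding this expression gives exactly the
      difference of its two sides.\<close>
    have "0 \<le> (u x * r - u y)\<^sup>2 / r" using r by simp
    also have "\<dots> = (u x - u y)\<^sup>2 + ((u x)\<^sup>2 * r + (u y)\<^sup>2 * (1 / r)) - ((u x)\<^sup>2 + (u y)\<^sup>2)"
      using r by (simp add: field_simps power2_eq_square)
    finally have "((u x)\<^sup>2 + (u y)\<^sup>2) * heat t (x - y) \<le> ((u x - u y)\<^sup>2 + ((u x)\<^sup>2 * (w y / w x) + (u y)\<^sup>2 * (w x / w y))) * heat t (x - y)"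
      unfolding r(2) r_def[symmetric] by (intro mult_right_mono) auto
    then show ?thesis
      unfolding Q_def V_def P_def heat_minus_commute[of t y x] using wx
      by (simp add: ennreal_plus[symmetric] algebra_simps del: ennreal_plus)
  qed
  have "?k * (\<integral>\<^sup>+x. ennreal ((u x)\<^sup>2) \<partial>lborel) + ?k * (\<integral>\<^sup>+x. ennreal ((u x)\<^sup>2) \<partial>lborel)
      = (\<integral>\<^sup>+x. (\<integral>\<^sup>+y. Q x y + Q y x \<partial>lborel) \<partial>lborel)"
  proof -
    have "(\<integral>\<^sup>+x. (\<integral>\<^sup>+y. Q x y + Q y x \<partial>lborel) \<partial>lborel) = (\<integral>\<^sup>+x. (\<integral>\<^sup>+y. Q x y \<partial>lborel) + (\<integral>\<^sup>+y. Q y x \<partial>lborel) \<partial>lborel)"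
      unfolding Q_def by (intro nn_integral_cong nn_integral_add) measurable
    also have "\<dots> = (\<integral>\<^sup>+x. (\<integral>\<^sup>+y. Q x y \<partial>lborel) \<partial>lborel) + (\<integral>\<^sup>+x. (\<integral>\<^sup>+y. Q y x \<partial>lborel) \<partial>lborel)"
      unfolding Q_def by (intro nn_integral_add) measurable
    finally show ?thesis by (simp add: Q1 Q2)
  qed
  also have "\<dots> \<le> (\<integral>\<^sup>+x. (\<integral>\<^sup>+y. V x y + (P x y + P y x) \<partial>lborel) \<partial>lborel)"
    by (intro nn_integral_mono_AE eventually_mono[OF AE_lborel_singleton[of 0]] le) auto
  also have "\<dots> = (\<integral>\<^sup>+x. (\<integral>\<^sup>+y. V x y \<partial>lborel) \<partial>lborel) + ((\<integral>\<^sup>+x. (\<integral>\<^sup>+y. P x y \<partial>lborel) \<partial>lborel) + (\<integral>\<^sup>+x. (\<integral>\<^sup>+y. P x y \<partial>lborel) \<partial>lborel))"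
  proof -
    have "(\<integral>\<^sup>+x. (\<integral>\<^sup>+y. V x y + (P x y + P y x) \<partial>lborel) \<partial>lborel)
      = (\<integral>\<^sup>+x. (\<integral>\<^sup>+y. V x y \<partial>lborel) + (\<integral>\<^sup>+y. P x y + P y x \<partial>lborel) \<partial>lborel)"
      unfolding V_def P_def by (intro nn_integral_cong nn_integral_add) measurable
    also have "\<dots> = (\<integral>\<^sup>+x. (\<integral>\<^sup>+y. V x y \<partial>lborel) + ((\<integral>\<^sup>+y. P x y \<partial>lborel) + (\<integral>\<^sup>+y. P y x \<partial>lborel)) \<partial>lborel)"
      unfolding V_def P_def by (intro nn_integral_cong arg_cong2[where f = "(+)"] refl nn_integral_add) measurable
    also have "\<dots> = (\<integral>\<^sup>+x. (\<integral>\<^sup>+y. V x y \<partial>lborel) \<partial>lborel) + (\<integral>\<^sup>+x. (\<integral>\<^sup>+y. P x y \<partial>lborel) + (\<integral>\<^sup>+y. P y x \<partial>lborel) \<partial>lborel)"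
      unfolding V_def P_def by (intro nn_integral_add) measurable
    also have "(\<integral>\<^sup>+x. (\<integral>\<^sup>+y. P x y \<partial>lborel) + (\<integral>\<^sup>+y. P y x \<partial>lborel) \<partial>lborel)
      = (\<integral>\<^sup>+x. (\<integral>\<^sup>+y. P x y \<partial>lborel) \<partial>lborel) + (\<integral>\<^sup>+x. (\<integral>\<^sup>+y. P y x \<partial>lborel) \<partial>lborel)"
      unfolding V_def P_def by (intro nn_integral_add) measurable
    finally show ?thesis by (simp add: P2)
  qed
  finally show ?thesis
    unfolding P1 V_def by (simp add: ennreal_mult mult_2 distrib_right)
qed

section \<open>The sharp fractional Hardy inequality\<close>

lemma nn_integral_powr_dilate:
  fixes g :: "real \<Rightarrow> real"
  assumes [measurable]: "g \<in> borel_measurable borel" and "r > 0"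
  shows "(\<integral>\<^sup>+t\<in>{0<..}. ennreal (t powr (- 1 - s) * g (t / r)) \<partial>lborel)
     = ennreal (r powr (- s)) * (\<integral>\<^sup>+t\<in>{0<..}. ennreal (t powr (- 1 - s) * g t) \<partial>lborel)"
proof -
  have "(\<integral>\<^sup>+t\<in>{0<..}. ennreal (t powr (- 1 - s) * g (t / r)) \<partial>lborel)
     = ennreal r * (\<integral>\<^sup>+t. ennreal ((r * t) powr (- 1 - s) * g (r * t / r)) * indicator {0<..} (r * t) \<partial>lborel)"
    using assms by (subst nn_integral_real_affine[where c = r and t = 0]) auto
  also have "\<dots> = (\<integral>\<^sup>+t. ennreal (r powr (- s)) * (ennreal (t powr (- 1 - s) * g t) * indicator {0<..} t) \<partial>lborel)"
  proof (subst nn_integral_cmult[symmetric])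
    show "(\<integral>\<^sup>+t. ennreal r * (ennreal ((r * t) powr (- 1 - s) * g (r * t / r)) * indicator {0<..} (r * t)) \<partial>lborel)
      = (\<integral>\<^sup>+t. ennreal (r powr (- s)) * (ennreal (t powr (- 1 - s) * g t) * indicator {0<..} t) \<partial>lborel)"
    proof (intro nn_integral_cong)
      fix t :: real
      have "r * (r * t) powr (- 1 - s) = r powr (- s) * t powr (- 1 - s)" if "t > 0"
        using that assms by (simp add: powr_mult powr_diff powr_minus field_simps)
      then show "ennreal r * (ennreal ((r * t) powr (- 1 - s) * g (r * t / r)) * indicator {0<..} (r * t))
        = ennreal (r powr (- s)) * (ennreal (t powr (- 1 - s) * g t) * indicator {0<..} t)"
        using assms by (auto simp: indicator_def ennreal_mult'[symmetric] zero_less_mult_iff mult.assoc[symmetric])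
    qed
  qed (use assms in auto)
  also have "\<dots> = ennreal (r powr (- s)) * (\<integral>\<^sup>+t\<in>{0<..}. ennreal (t powr (- 1 - s) * g t) \<partial>lborel)"
    by (subst nn_integral_cmult) auto
  finally show ?thesis .
qed

text \<open>After exchanging the time integrals, dilating t by r pulls out
  \<open>r powr (- s)\<close> and leaves the moment \<open>G\<close> of \<open>g\<close>. What
  remains is a heat mixture with exponent a - s, so the profile \<open>g\<close> enters the result
  only through \<open>G\<close>.\<close>

lemma nn_integral_power_kernel_heat:
  fixes x :: "'a::euclidean_space" and g :: "real \<Rightarrow> real" and a s :: real
  assumes [measurable]: "g \<in> borel_measurable borel" and g: "\<And>t. t > 0 \<Longrightarrow> g t \<ge> 0"
    and G: "(\<integral>\<^sup>+t\<in>{0<..}. ennreal (t powr (- 1 - s) * g t) \<partial>lborel) = ennreal G" "G \<ge> 0"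
    and x: "x \<noteq> 0" and a: "a - s < DIM('a) / 2"
  shows "(\<integral>\<^sup>+t\<in>{0<..}. ennreal (t powr (- 1 - s)) *
            (\<integral>\<^sup>+r\<in>{0<..}. ennreal (r powr (a - 1) * g (t / r) * heat r x) \<partial>lborel) \<partial>lborel)
     = ennreal (G * (Gamma (DIM('a) / 2 - a + s) * 4 powr (DIM('a) / 2 - a + s) * norm x powr (2 * (a - s) - DIM('a))))"
proof -
  have "(\<integral>\<^sup>+t\<in>{0<..}. ennreal (t powr (- 1 - s)) *
            (\<integral>\<^sup>+r\<in>{0<..}. ennreal (r powr (a - 1) * g (t / r) * heat r x) \<partial>lborel) \<partial>lborel)
     = (\<integral>\<^sup>+t. (\<integral>\<^sup>+r. ennreal (r powr (a - 1) * heat r x) * indicator {0<..} r * (ennreal (t powr (- 1 - s) * g (t / r)) * indicator {0<..} t) \<partial>lborel) \<partial>lborel)"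
  proof (intro nn_integral_cong)
    fix t :: real
    show "ennreal (t powr (- 1 - s)) * (\<integral>\<^sup>+r\<in>{0<..}. ennreal (r powr (a - 1) * g (t / r) * heat r x) \<partial>lborel) * indicator {0<..} t
      = (\<integral>\<^sup>+r. ennreal (r powr (a - 1) * heat r x) * indicator {0<..} r * (ennreal (t powr (- 1 - s) * g (t / r)) * indicator {0<..} t) \<partial>lborel)"
    proof (cases "t > 0")
      case True
      have "ennreal (t powr (- 1 - s)) * (ennreal (r powr (a - 1) * g (t / r) * heat r x) * indicator {0<..} r)
         = ennreal (r powr (a - 1) * heat r x) * indicator {0<..} r * (ennreal (t powr (- 1 - s) * g (t / r)))" for r
        by (auto simp: indicator_def ennreal_mult'[symmetric] mult_ac)
      then show ?thesis using True by (subst nn_integral_cmult[symmetric]) auto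
    qed simp
  qed
  also have "\<dots> = (\<integral>\<^sup>+r. (\<integral>\<^sup>+t. ennreal (r powr (a - 1) * heat r x) * indicator {0<..} r * (ennreal (t powr (- 1 - s) * g (t / r)) * indicator {0<..} t) \<partial>lborel) \<partial>lborel)"
    by (rule lborel_pair.Fubini') measurable
  also have "\<dots> = (\<integral>\<^sup>+r. ennreal G * (ennreal (r powr (a - s - 1) * heat r x) * indicator {0<..} r) \<partial>lborel)"
  proof (intro nn_integral_cong)
    fix r :: real
    show "(\<integral>\<^sup>+t. ennreal (r powr (a - 1) * heat r x) * indicator {0<..} r * (ennreal (t powr (- 1 - s) * g (t / r)) * indicator {0<..} t) \<partial>lborel)
      = ennreal G * (ennreal (r powr (a - s - 1) * heat r x) * indicator {0<..} r)"
    proof (cases "r > 0")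
      case True
      have "r powr (a - 1) * r powr (- s) = r powr (a - s - 1)"
        by (simp add: powr_add[symmetric] algebra_simps)
      then have "r powr (a - 1) * heat r x * (r powr (- s) * G) = G * (r powr (a - s - 1) * heat r x)"
        by (metis (no_types, opaque_lifting) mult.assoc mult.commute)
      then show ?thesis using True G(2)
        by (subst nn_integral_cmult) (auto simp: nn_integral_powr_dilate G(1) ennreal_mult'[symmetric])
    qed simp
  qed
  also have "\<dots> = ennreal G * (\<integral>\<^sup>+r\<in>{0<..}. ennreal (r powr (a - s - 1) * heat r x) \<partial>lborel)"
    by (subst nn_integral_cmult) auto
  also have "\<dots> = ennreal G * ennreal (Gamma (DIM('a) / 2 - (a - s)) * 4 powr (DIM('a) / 2 - (a - s)) * norm x powr (2 * (a - s) - DIM('a)))"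
    by (subst nn_integral_time_heat[OF x a]) simp
  also have "DIM('a) / 2 - (a - s) = DIM('a) / 2 - a + s" by simp
  finally show ?thesis using G(2) by (simp only: ennreal_mult'[OF G(2)])
qed

text \<open>By the semigroup law, convolving with the heat kernel moves each time r of the mixture
  to r + t. In the shifted time the weight is (r - t) powr (a - 1) on r > t, which
  \<open>pos_powr (a - 1) (t / r)\<close> expresses relative to
  \<open>r powr (a - 1)\<close>.\<close>

lemma nn_integral_heat_power:
  fixes x :: "'a::euclidean_space" and a t :: real
  assumes t: "t > 0" and a: "a < DIM('a) / 2"
  shows "(\<integral>\<^sup>+y. ennreal (heat t (x - y)) * ennreal (Gamma (DIM('a) / 2 - a) * 4 powr (DIM('a) / 2 - a) * norm y powr (2 * a - DIM('a))) \<partial>lborel)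
    = ennreal ((4 * pi) powr (DIM('a) / 2)) * (\<integral>\<^sup>+r\<in>{0<..}. ennreal (r powr (a - 1) * pos_powr (a - 1) (t / r) * heat r x) \<partial>lborel)"
proof -
  let ?k = "ennreal ((4 * pi) powr (DIM('a) / 2))"
  have "(\<integral>\<^sup>+y. ennreal (heat t (x - y)) * ennreal (Gamma (DIM('a) / 2 - a) * 4 powr (DIM('a) / 2 - a) * norm y powr (2 * a - DIM('a))) \<partial>lborel)
     = (\<integral>\<^sup>+y. ennreal (heat t (x - y)) * (\<integral>\<^sup>+r\<in>{0<..}. ennreal (r powr (a - 1) * heat r y) \<partial>lborel) \<partial>lborel)"
    by (intro nn_integral_cong_AE eventually_mono[OF AE_lborel_singleton[of 0]]) (subst nn_integral_time_heat[OF _ a], auto)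
  also have "\<dots> = (\<integral>\<^sup>+y. (\<integral>\<^sup>+r. ennreal (heat t (x - y)) * (ennreal (r powr (a - 1) * heat r y) * indicator {0<..} r) \<partial>lborel) \<partial>lborel)"
    by (intro nn_integral_cong) (subst nn_integral_cmult, auto)
  also have "\<dots> = (\<integral>\<^sup>+r. (\<integral>\<^sup>+y. ennreal (heat t (x - y)) * (ennreal (r powr (a - 1) * heat r y) * indicator {0<..} r) \<partial>lborel) \<partial>lborel)"
    by (rule lborel_pair.Fubini') measurable
  also have "\<dots> = (\<integral>\<^sup>+r. ?k * (ennreal (r powr (a - 1) * heat (t + r) x) * indicator {0<..} r) \<partial>lborel)"
  proof (intro nn_integral_cong)
    fix r :: real
    show "(\<integral>\<^sup>+y. ennreal (heat t (x - y)) * (ennreal (r powr (a - 1) * heat r y) * indicator {0<..} r) \<partial>lborel)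
      = ?k * (ennreal (r powr (a - 1) * heat (t + r) x) * indicator {0<..} r)"
    proof (cases "r > 0")
      case True
      have "(\<integral>\<^sup>+y. ennreal (heat t (x - y)) * (ennreal (r powr (a - 1) * heat r y) * indicator {0<..} r) \<partial>lborel)
         = (\<integral>\<^sup>+y. ennreal (r powr (a - 1)) * (ennreal (heat t (x - y)) * ennreal (heat r y)) \<partial>lborel)"
        using True by (auto simp: ennreal_mult mult_ac intro!: nn_integral_cong)
      also have "\<dots> = ennreal (r powr (a - 1)) * (?k * ennreal (heat (t + r) x))"
        using nn_integral_heat_heat[OF t True, of x] by (subst nn_integral_cmult) auto
      finally show ?thesis using True by (simp add: ennreal_mult mult_ac)
    qed simp
  qed
  also have "\<dots> = ?k * (\<integral>\<^sup>+r. ennreal (r powr (a - 1) * heat (t + r) x) * indicator {0<..} r \<partial>lborel)"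
    by (subst nn_integral_cmult) auto
  also have "(\<integral>\<^sup>+r. ennreal (r powr (a - 1) * heat (t + r) x) * indicator {0<..} r \<partial>lborel)
     = (\<integral>\<^sup>+r. ennreal ((r - t) powr (a - 1) * heat r x) * indicator {t<..} r \<partial>lborel)"
    by (subst nn_integral_translate[of "\<lambda>r. ennreal ((r - t) powr (a - 1) * heat r x) * indicator {t<..} r" t, symmetric])
       (auto intro!: nn_integral_cong simp: indicator_def)
  also have "\<dots> = (\<integral>\<^sup>+r\<in>{0<..}. ennreal (r powr (a - 1) * pos_powr (a - 1) (t / r) * heat r x) \<partial>lborel)"
  proof (intro nn_integral_cong)
    fix r :: real
    have "r powr (a - 1) * pos_powr (a - 1) (t / r) = (r - t) powr (a - 1)" if "r > t"
    proof -
      have "r powr (a - 1) * pos_powr (a - 1) (t / r) = (r * (1 - t / r)) powr (a - 1)"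
        using that t by (subst powr_mult) (auto simp: pos_powr_def)
      also have "r * (1 - t / r) = r - t" using that t by (simp add: field_simps)
      finally show ?thesis .
    qed
    moreover have "pos_powr (a - 1) (t / r) = 0" if "0 < r" "r \<le> t"
      using that by (simp add: pos_powr_def)
    ultimately show "ennreal ((r - t) powr (a - 1) * heat r x) * indicator {t<..} r
       = ennreal (r powr (a - 1) * pos_powr (a - 1) (t / r) * heat r x) * indicator {0<..} r"
      using t by (auto simp: indicator_def)
  qed
  finally show ?thesis .
qed

section \<open>Dirichlet form, Hardy integral and their heat kernel representation\<close>

definition dirichlet :: "real \<Rightarrow> ('a::euclidean_space \<Rightarrow> real) \<Rightarrow> ennreal" where
  "dirichlet s u = (\<integral>\<^sup>+x. (\<integral>\<^sup>+y. ennreal ((u x - u y)\<^sup>2) * ennreal (norm (x - y) powr (- (real DIM('a) + 2 * s))) \<partial>lborel) \<partial>lborel)"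

definition hardy_int :: "real \<Rightarrow> ('a::euclidean_space \<Rightarrow> real) \<Rightarrow> ennreal" where
  "hardy_int s u = (\<integral>\<^sup>+x. ennreal ((u x)\<^sup>2) * ennreal (norm x powr (- 2 * s)) \<partial>lborel)"

text \<open>In the variable z = y - x the kernel separates from \<open>u\<close>, so a mixture
  formula for kernels of one variable applies to the whole double integral.\<close>

lemma nn_integral_increments:
  fixes u :: "'a::euclidean_space \<Rightarrow> real" and k :: "'a \<Rightarrow> ennreal"
  assumes [measurable]: "u \<in> borel_measurable borel" "k \<in> borel_measurable borel" and k: "\<And>z. k (- z) = k z"
  shows "(\<integral>\<^sup>+x. (\<integral>\<^sup>+y. ennreal ((u x - u y)\<^sup>2) * k (x - y) \<partial>lborel) \<partial>lborel)
    = (\<integral>\<^sup>+z. (\<integral>\<^sup>+x. ennreal ((u (x + z) - u x)\<^sup>2) \<partial>lborel) * k z \<partial>lborel)"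
proof -
  have "(\<integral>\<^sup>+y. ennreal ((u x - u y)\<^sup>2) * k (x - y) \<partial>lborel) = (\<integral>\<^sup>+z. ennreal ((u (x + z) - u x)\<^sup>2) * k z \<partial>lborel)" for x
    by (subst nn_integral_translate[of _ x, symmetric]) (auto simp: k power2_commute)
  then have "(\<integral>\<^sup>+x. (\<integral>\<^sup>+y. ennreal ((u x - u y)\<^sup>2) * k (x - y) \<partial>lborel) \<partial>lborel)
    = (\<integral>\<^sup>+x. (\<integral>\<^sup>+z. ennreal ((u (x + z) - u x)\<^sup>2) * k z \<partial>lborel) \<partial>lborel)" by simp
  also have "\<dots> = (\<integral>\<^sup>+z. (\<integral>\<^sup>+x. ennreal ((u (x + z) - u x)\<^sup>2) * k z \<partial>lborel) \<partial>lborel)"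
    by (rule lborel_pair.Fubini') measurable
  also have "\<dots> = (\<integral>\<^sup>+z. (\<integral>\<^sup>+x. ennreal ((u (x + z) - u x)\<^sup>2) \<partial>lborel) * k z \<partial>lborel)"
    by (intro nn_integral_cong nn_integral_multc) measurable
  finally show ?thesis .
qed

lemma dirichlet_subordination:
  fixes u :: "'a::euclidean_space \<Rightarrow> real"
  assumes [measurable]: "u \<in> borel_measurable borel" and "0 < s"
  shows "ennreal (Gamma (DIM('a) / 2 + s) * 4 powr (DIM('a) / 2 + s)) * dirichlet s u
    = (\<integral>\<^sup>+t\<in>{0<..}. ennreal (t powr (- 1 - s)) *
        (\<integral>\<^sup>+x. (\<integral>\<^sup>+y. ennreal ((u x - u y)\<^sup>2) * ennreal (heat t (x - y)) \<partial>lborel) \<partial>lborel) \<partial>lborel)"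
proof -
  have h: "heat t (- z) = heat t z" for t and z :: 'a by (simp add: heat_def)
  define I where "I = (\<lambda>z. \<integral>\<^sup>+x. ennreal ((u (x + z) - u x)\<^sup>2) \<partial>lborel)"
  have [measurable]: "I \<in> borel_measurable borel" unfolding I_def by measurable
  have "dirichlet s u = (\<integral>\<^sup>+z. I z * ennreal (norm z powr (- (DIM('a) + 2 * s))) \<partial>lborel)"
    unfolding dirichlet_def I_def by (subst nn_integral_increments) auto
  moreover have "(\<integral>\<^sup>+x. (\<integral>\<^sup>+y. ennreal ((u x - u y)\<^sup>2) * ennreal (heat t (x - y)) \<partial>lborel) \<partial>lborel)
      = (\<integral>\<^sup>+z. I z * ennreal (heat t z) \<partial>lborel)" for t
    unfolding I_def by (subst nn_integral_increments) (auto simp: h)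
  ultimately show ?thesis
    using nn_integral_subordination[of I s] assms(2) by simp
qed

text \<open>Finiteness of \<open>H\<close> permits cancelling b H without subtracting in
  \<open>ennreal\<close>. If b exceeds a, the coefficient truncates to 0 and nothing is
  claimed.\<close>

lemma ennreal_diff_mult_le:
  fixes X H :: ennreal
  assumes "ennreal a * H \<le> X + ennreal b * H" "H < \<infinity>" "0 \<le> b"
  shows "ennreal (a - b) * H \<le> X"
proof (cases "b \<le> a")
  case True
  then have "ennreal a * H = ennreal (a - b) * H + ennreal b * H"
    using assms by (simp add: distrib_right[symmetric] ennreal_plus[symmetric] del: ennreal_plus)
  then show ?thesis using assms by (simp add: ennreal_mult_less_top less_top[symmetric] ennreal_mult_eq_top_iff)
next
  case False
  then show ?thesis by (simp add: ennreal_neg)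
qed

text \<open>The two finiteness hypotheses serve two cancellations: the L2 norm is removed at each
  fixed time, the Hardy integral after integrating over time. Test functions satisfy both.\<close>

theorem hardy_inequality_integrable:
  fixes u :: "'a::euclidean_space \<Rightarrow> real" and s :: real
  assumes [measurable]: "u \<in> borel_measurable borel"
    and s: "0 < s" "s < 1" "2 * s < DIM('a)"
    and L2: "(\<integral>\<^sup>+x. ennreal ((u x)\<^sup>2) \<partial>lborel) < \<infinity>"
    and H: "hardy_int s u < \<infinity>"
  shows "ennreal (2 * (4 * pi) powr (DIM('a) / 2) * (Gamma (1 - s) / s) * hardy_const DIM('a) s) * hardy_int s u
     \<le> ennreal (Gamma (DIM('a) / 2 + s) * 4 powr (DIM('a) / 2 + s)) * dirichlet s u"
proof -
  \<comment> \<open>Then 2a - N = -(N - 2s)/2, the exponent of the ground state. Since N/2 - a = a -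
    s and N/2 - a + s = a, all Gamma factors end up at a and a - s, as in
    \<open>hardy_const\<close>.\<close>
  define a where "a = (DIM('a) + 2 * s) / 4"
  have as: "a > 0" "a - s > 0" "DIM('a) / 2 - a = a - s" "a < DIM('a) / 2" "a - s < DIM('a) / 2"
    using s by (auto simp: a_def field_simps)
  define k where "k = (4 * pi) powr (DIM('a) / 2)"
  define c where "c = Gamma (a - s) * 4 powr (a - s)"
  define d where "d = Gamma a * 4 powr a"
  have cd: "c > 0" "d > 0" "k > 0" unfolding c_def d_def k_def using as by (auto intro!: mult_pos_pos Gamma_real_pos)
  define W where "W = (\<lambda>x::'a. c * norm x powr (2 * a - DIM('a)))"
  have W: "W x > 0" if "x \<noteq> 0" for x using that cd by (simp add: W_def)
  have [measurable]: "W \<in> borel_measurable borel" unfolding W_def by measurable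
  \<comment> \<open>Heat mixtures with a profile \<open>g\<close> in t / r. The profile 1 gives
    \<open>W\<close>, and \<open>k\<close> times the profile \<open>pos_powr (a - 1)\<close> gives
    the convolution of \<open>W\<close> with the heat kernel.\<close>
  define T where "T = (\<lambda>(g::real\<Rightarrow>real) t (x::'a). \<integral>\<^sup>+r\<in>{0<..}. ennreal (r powr (a - 1) * g (t / r) * heat r x) \<partial>lborel)"
  define Y where "Y = (\<lambda>(g::real\<Rightarrow>real) t. \<integral>\<^sup>+x. ennreal ((u x)\<^sup>2) * ennreal (1 / W x) * T g t x \<partial>lborel)"
  define E where "E = (\<lambda>t. \<integral>\<^sup>+x. (\<integral>\<^sup>+y. ennreal ((u x - u y)\<^sup>2) * ennreal (heat t (x - y)) \<partial>lborel) \<partial>lborel)"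
  define L where "L = (\<integral>\<^sup>+x. ennreal ((u x)\<^sup>2) \<partial>lborel)"
  define gA where "gA = (\<lambda>t. 1 - pos_powr a t)"
  define gB where "gB = (\<lambda>t. t * pos_powr (a - 1) t)"
  have [measurable]: "gA \<in> borel_measurable borel" "gB \<in> borel_measurable borel"
    unfolding gA_def gB_def by measurable
  have g0: "gA t \<ge> 0" "gB t \<ge> 0" if "t > 0" for t
    using that as pos_powr_le_1[of a t] by (auto simp: gA_def gB_def)
  have Tm: "(\<lambda>p. T g (fst p) (snd p)) \<in> borel_measurable (borel \<Otimes>\<^sub>M borel)" if [measurable]: "g \<in> borel_measurable borel" for g
    unfolding T_def by measurable
  have T1 [measurable]: "T g t \<in> borel_measurable borel" if [measurable]: "g \<in> borel_measurable borel" for g t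
    unfolding T_def by measurable
  have Tadd: "T (\<lambda>t. g t + h t) t x = T g t x + T h t x"
    if [measurable]: "g \<in> borel_measurable borel" "h \<in> borel_measurable borel" and "\<And>t. t > 0 \<Longrightarrow> g t \<ge> 0" "\<And>t. t > 0 \<Longrightarrow> h t \<ge> 0" "t > 0"
    for g h t x
  proof -
    have "T (\<lambda>t. g t + h t) t x = (\<integral>\<^sup>+r. ennreal (r powr (a - 1) * g (t / r) * heat r x) * indicator {0<..} r +
        ennreal (r powr (a - 1) * h (t / r) * heat r x) * indicator {0<..} r \<partial>lborel)"
      unfolding T_def using that by (intro nn_integral_cong) (auto simp: indicator_def ennreal_plus[symmetric] algebra_simps simp del: ennreal_plus)
    also have "\<dots> = T g t x + T h t x"
      unfolding T_def by (intro nn_integral_add) measurable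
    finally show ?thesis .
  qed
  \<comment> \<open>For \<open>N \<le> 3\<close> the exponent \<open>a - 1\<close> may be negative and \<open>1 - pos_powr (a - 1)\<close> changes sign;
    this splits it into two nonnegative parts with separately convergent integrals.\<close>
  have split: "pos_powr (a - 1) t + gA t = 1 + gB t" if "t > 0" for t
  proof (cases "t < 1")
    case True
    then have "(1 - t) powr a = (1 - t) powr (a - 1) * (1 - t)" by (simp add: powr_diff)
    then show ?thesis using True by (simp add: gA_def gB_def pos_powr_def algebra_simps)
  qed (simp add: gA_def gB_def pos_powr_def)
  have one: "T (\<lambda>_. 1) t x = ennreal (W x)" if "x \<noteq> 0" for t x
    unfolding T_def W_def c_def using nn_integral_time_heat[OF that as(4)] unfolding as(3) by simp
  \<comment> \<open>\<open>Y gA t\<close> is added to both sides of Picone so that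
    \<open>split\<close> applies; the right side then contains L + \<open>Y gB t\<close>, and the
    finite L cancels.\<close>
  have step: "2 * ennreal k * Y gA t \<le> E t + 2 * ennreal k * Y gB t" if t: "t > 0" for t
  proof -
    have key: "T (pos_powr (a - 1)) t x + T gA t x = ennreal (W x) + T gB t x" if "x \<noteq> 0" for x
    proof -
      have "T (pos_powr (a - 1)) t x + T gA t x = T (\<lambda>t. pos_powr (a - 1) t + gA t) t x"
        using t g0 by (subst Tadd) auto
      also have "\<dots> = T (\<lambda>t. 1 + gB t) t x"
        unfolding T_def using t by (intro nn_integral_cong) (auto simp: indicator_def split)
      also have "\<dots> = ennreal (W x) + T gB t x"
        using t g0 one[OF that] by (subst Tadd) auto
      finally show ?thesis .
    qed
    have pic: "2 * ennreal k * L \<le> E t + 2 * (ennreal k * Y (pos_powr (a - 1)) t)"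
    proof -
      have "(\<integral>\<^sup>+y. ennreal (heat t (x - y)) * ennreal (W y) \<partial>lborel) = ennreal k * T (pos_powr (a - 1)) t x" for x
        using nn_integral_heat_power[OF t as(4), of x] unfolding as(3) W_def c_def k_def T_def .
      then have "2 * ennreal k * L \<le> E t + 2 * (\<integral>\<^sup>+x. ennreal ((u x)\<^sup>2) * ennreal (1 / W x) * (ennreal k * T (pos_powr (a - 1)) t x) \<partial>lborel)"
        using heat_picone[of u W t] W t unfolding L_def E_def k_def by simp
      also have "(\<integral>\<^sup>+x. ennreal ((u x)\<^sup>2) * ennreal (1 / W x) * (ennreal k * T (pos_powr (a - 1)) t x) \<partial>lborel)
          = ennreal k * Y (pos_powr (a - 1)) t"
        unfolding Y_def by (subst nn_integral_cmult[symmetric]) (auto simp: mult_ac)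
      finally show ?thesis .
    qed
    have "Y (pos_powr (a - 1)) t + Y gA t = (\<integral>\<^sup>+x. ennreal ((u x)\<^sup>2) * ennreal (1 / W x) * (T (pos_powr (a - 1)) t x + T gA t x) \<partial>lborel)"
      unfolding Y_def distrib_left by (subst nn_integral_add) auto
    also have "\<dots> = (\<integral>\<^sup>+x. ennreal ((u x)\<^sup>2) + ennreal ((u x)\<^sup>2) * ennreal (1 / W x) * T gB t x \<partial>lborel)"
    proof (intro nn_integral_cong_AE eventually_mono[OF AE_lborel_singleton[of 0]])
      fix x :: 'a assume x: "x \<noteq> 0"
      have "ennreal (1 / W x) * ennreal (W x) = 1"
        using W[OF x] by (simp add: ennreal_mult'[symmetric])
      then show "ennreal ((u x)\<^sup>2) * ennreal (1 / W x) * (T (pos_powr (a - 1)) t x + T gA t x)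
         = ennreal ((u x)\<^sup>2) + ennreal ((u x)\<^sup>2) * ennreal (1 / W x) * T gB t x"
        unfolding key[OF x] by (simp add: distrib_left mult.assoc)
    qed
    also have "\<dots> = L + Y gB t"
      unfolding Y_def L_def by (subst nn_integral_add) auto
    finally have Yeq: "Y (pos_powr (a - 1)) t + Y gA t = L + Y gB t" .
    have "2 * ennreal k * L + 2 * ennreal k * Y gA t \<le> E t + 2 * (ennreal k * Y (pos_powr (a - 1)) t) + 2 * ennreal k * Y gA t"
      using pic by (intro add_right_mono)
    also have "\<dots> = E t + 2 * ennreal k * (L + Y gB t)"
      unfolding Yeq[symmetric] by (simp add: distrib_left add_ac mult.assoc)
    also have "\<dots> = 2 * ennreal k * L + (E t + 2 * ennreal k * Y gB t)"
      by (simp add: distrib_left add_ac)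
    finally show ?thesis
      using L2 unfolding L_def[symmetric]
      by (subst (asm) ennreal_add_left_cancel_le) (auto simp: ennreal_mult_eq_top_iff)
  qed
  \<comment> \<open>Tonelli reduces the time integral to the moment \<open>G\<close> of the profile,
    and dividing by \<open>W\<close> leaves |x| powr (-2s); every profile thus yields a multiple of
    the same Hardy integral.\<close>
  have int: "(\<integral>\<^sup>+t\<in>{0<..}. ennreal (t powr (- 1 - s)) * Y g t \<partial>lborel) = ennreal (G * d / c) * hardy_int s u"
    if [measurable]: "g \<in> borel_measurable borel" and g: "\<And>t. t > 0 \<Longrightarrow> g t \<ge> 0"
      and G: "(\<integral>\<^sup>+t\<in>{0<..}. ennreal (t powr (- 1 - s) * g t) \<partial>lborel) = ennreal G" "G \<ge> 0" for g G
  proof -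
    have "(\<integral>\<^sup>+t\<in>{0<..}. ennreal (t powr (- 1 - s)) * Y g t \<partial>lborel)
       = (\<integral>\<^sup>+t. (\<integral>\<^sup>+x. ennreal ((u x)\<^sup>2) * ennreal (1 / W x) * (ennreal (t powr (- 1 - s)) * T g t x * indicator {0<..} t) \<partial>lborel) \<partial>lborel)"
      unfolding Y_def by (intro nn_integral_cong) (auto simp: indicator_def nn_integral_cmult[symmetric] mult_ac)
    also have "\<dots> = (\<integral>\<^sup>+x. (\<integral>\<^sup>+t. ennreal ((u x)\<^sup>2) * ennreal (1 / W x) * (ennreal (t powr (- 1 - s)) * T g t x * indicator {0<..} t) \<partial>lborel) \<partial>lborel)"
      unfolding T_def by (rule lborel_pair.Fubini') measurable
    also have "\<dots> = (\<integral>\<^sup>+x. ennreal (G * d / c) * (ennreal ((u x)\<^sup>2) * ennreal (norm x powr (- 2 * s))) \<partial>lborel)"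
    proof (intro nn_integral_cong_AE eventually_mono[OF AE_lborel_singleton[of 0]])
      fix x :: 'a assume x: "x \<noteq> 0"
      have mT: "(\<lambda>t. T g t x) \<in> borel_measurable borel" unfolding T_def by measurable
      have e: "DIM('a) / 2 - a + s = a" by (simp add: a_def field_simps)
      have "(\<integral>\<^sup>+t. ennreal ((u x)\<^sup>2) * ennreal (1 / W x) * (ennreal (t powr (- 1 - s)) * T g t x * indicator {0<..} t) \<partial>lborel)
         = ennreal ((u x)\<^sup>2) * ennreal (1 / W x) * (\<integral>\<^sup>+t\<in>{0<..}. ennreal (t powr (- 1 - s)) * T g t x \<partial>lborel)"
        using mT by (subst nn_integral_cmult) auto
      also have "(\<integral>\<^sup>+t\<in>{0<..}. ennreal (t powr (- 1 - s)) * T g t x \<partial>lborel) = ennreal (G * (d * norm x powr (2 * (a - s) - DIM('a))))"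
        using nn_integral_power_kernel_heat[OF that(1) g G x as(5)] unfolding T_def e d_def by simp
      also have "ennreal ((u x)\<^sup>2) * ennreal (1 / W x) * \<dots> = ennreal ((u x)\<^sup>2 * (1 / W x) * (G * (d * norm x powr (2 * (a - s) - DIM('a)))))"
        using W[OF x] cd G(2) by (simp add: ennreal_mult'[symmetric])
      also have "(u x)\<^sup>2 * (1 / W x) * (G * (d * norm x powr (2 * (a - s) - DIM('a)))) = G * d / c * ((u x)\<^sup>2 * norm x powr (- 2 * s))"
      proof -
        have "norm x powr (2 * (a - s) - DIM('a)) = norm x powr (2 * a - DIM('a)) * norm x powr (- 2 * s)"
          by (simp add: powr_add[symmetric] algebra_simps)
        then show ?thesis using x cd by (simp add: W_def)
      qed
      also have "ennreal \<dots> = ennreal (G * d / c) * (ennreal ((u x)\<^sup>2) * ennreal (norm x powr (- 2 * s)))"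
        using cd G(2) by (simp add: ennreal_mult'[symmetric])
      finally show "(\<integral>\<^sup>+t. ennreal ((u x)\<^sup>2) * ennreal (1 / W x) * (ennreal (t powr (- 1 - s)) * T g t x * indicator {0<..} t) \<partial>lborel) = \<dots>" .
    qed
    also have "\<dots> = ennreal (G * d / c) * hardy_int s u"
      unfolding hardy_int_def by (subst nn_integral_cmult) auto
    finally show ?thesis .
  qed
  define \<beta> where "\<beta> = Beta (1 - s) a"
  have \<beta>: "\<beta> \<ge> 0" unfolding \<beta>_def Beta_def using s as by (auto intro!: mult_nonneg_nonneg divide_nonneg_nonneg Gamma_real_nonneg)
  have intA: "(\<integral>\<^sup>+t\<in>{0<..}. ennreal (t powr (- 1 - s)) * Y gA t \<partial>lborel) = ennreal (a / s * \<beta> * d / c) * hardy_int s u"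
    using nn_integral_one_minus_pos_powr[OF s(1,2) as(1)] g0 \<beta> s as
    by (intro int) (auto simp: gA_def \<beta>_def)
  have "(\<integral>\<^sup>+t\<in>{0<..}. ennreal (t powr (- 1 - s) * gB t) \<partial>lborel) = (\<integral>\<^sup>+t\<in>{0<..}. ennreal (t powr (- s) * pos_powr (a - 1) t) \<partial>lborel)"
    by (intro nn_integral_cong) (auto simp: indicator_def gB_def powr_diff powr_minus field_simps)
  then have intB: "(\<integral>\<^sup>+t\<in>{0<..}. ennreal (t powr (- 1 - s)) * Y gB t \<partial>lborel) = ennreal (\<beta> * d / c) * hardy_int s u"
    using nn_integral_pos_powr[OF s(2) as(1)] g0 \<beta>
    by (intro int) (auto simp: \<beta>_def)
  have Ym [measurable]: "Y g \<in> borel_measurable borel" if [measurable]: "g \<in> borel_measurable borel" for g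
    unfolding Y_def T_def by measurable
  have Em [measurable]: "E \<in> borel_measurable borel"
    unfolding E_def by measurable
  have "2 * ennreal k * (ennreal (a / s * \<beta> * d / c) * hardy_int s u)
      = (\<integral>\<^sup>+t\<in>{0<..}. ennreal (t powr (- 1 - s)) * (2 * ennreal k * Y gA t) \<partial>lborel)"
    unfolding intA[symmetric] by (subst nn_integral_cmult[symmetric]) (auto simp: mult_ac)
  also have "\<dots> \<le> (\<integral>\<^sup>+t\<in>{0<..}. ennreal (t powr (- 1 - s)) * (E t + 2 * ennreal k * Y gB t) \<partial>lborel)"
    using step by (intro nn_integral_mono) (auto simp: indicator_def intro!: mult_left_mono)
  also have "\<dots> = (\<integral>\<^sup>+t. ennreal (t powr (- 1 - s)) * E t * indicator {0<..} t + 2 * ennreal k * (ennreal (t powr (- 1 - s)) * Y gB t * indicator {0<..} t) \<partial>lborel)"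
    by (intro nn_integral_cong) (simp add: algebra_simps)
  also have "\<dots> = (\<integral>\<^sup>+t\<in>{0<..}. ennreal (t powr (- 1 - s)) * E t \<partial>lborel) + 2 * ennreal k * (ennreal (\<beta> * d / c) * hardy_int s u)"
    unfolding intB[symmetric] by (subst nn_integral_add) (auto simp: nn_integral_cmult)
  also have "(\<integral>\<^sup>+t\<in>{0<..}. ennreal (t powr (- 1 - s)) * E t \<partial>lborel) = ennreal (Gamma (DIM('a) / 2 + s) * 4 powr (DIM('a) / 2 + s)) * dirichlet s u"
    unfolding E_def using s by (subst dirichlet_subordination) auto
  finally have main: "2 * ennreal k * (ennreal (a / s * \<beta> * d / c) * hardy_int s u) \<le>
      ennreal (Gamma (DIM('a) / 2 + s) * 4 powr (DIM('a) / 2 + s)) * dirichlet s u + 2 * ennreal k * (ennreal (\<beta> * d / c) * hardy_int s u)" .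
  have conv: "2 * ennreal k * (ennreal z * hardy_int s u) = ennreal (2 * k * z) * hardy_int s u" if "z \<ge> 0" for z
    using that cd by (simp add: ennreal_mult mult_ac)
  have pos: "a / s * \<beta> * d / c \<ge> 0" "\<beta> * d / c \<ge> 0"
    using as s \<beta> cd by auto
  have "ennreal (2 * k * (a / s * \<beta> * d / c) - 2 * k * (\<beta> * d / c)) * hardy_int s u \<le>
     ennreal (Gamma (DIM('a) / 2 + s) * 4 powr (DIM('a) / 2 + s)) * dirichlet s u"
  proof (rule ennreal_diff_mult_le)
    show "0 \<le> 2 * k * (\<beta> * d / c)" using pos(2) cd by (intro mult_nonneg_nonneg) auto
  qed (use main H in \<open>simp_all only: conv[OF pos(1)] conv[OF pos(2)]\<close>)
  \<comment> \<open>The difference of the two moments contributes (a - s) / s, whose numerator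
    cancels against Beta (1 - s) a = Gamma (1 - s) Gamma a / ((a - s) Gamma (a - s)). One factor
    Gamma a / Gamma (a - s) comes from there, the other from d / c together with 4 powr s.\<close>
  also have "2 * k * (a / s * \<beta> * d / c) - 2 * k * (\<beta> * d / c) = 2 * k * (Gamma (1 - s) / s) * hardy_const DIM('a) s"
  proof -
    have h: "hardy_const DIM('a) s = 4 powr s * (Gamma a)\<^sup>2 / (Gamma (a - s))\<^sup>2"
    proof -
      have e: "(DIM('a) + 2 * s) / 4 = a" "(DIM('a) - 2 * s) / 4 = a - s" by (simp_all add: a_def field_simps)
      have "2 powr (2 * s) = 4 powr s" using powr_powr[of 2 2 s] by simp
      then show ?thesis unfolding hardy_const_def e by simp
    qed
    have "Gamma (a - s + 1) = (a - s) * Gamma (a - s)"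
      using as by (intro Gamma_plus1) (auto dest: nonpos_Ints_nonpos)
    moreover have e: "1 - s + a = a - s + 1" by simp
    ultimately have \<beta>e: "\<beta> = Gamma (1 - s) * Gamma a / ((a - s) * Gamma (a - s))"
      unfolding \<beta>_def Beta_def e by simp
    have "4 powr a = 4 powr s * 4 powr (a - s)" by (simp add: powr_add[symmetric])
    moreover have "Gamma (a - s) > 0" using as by (intro Gamma_real_pos)
    ultimately have dc: "d / c = 4 powr s * Gamma a / Gamma (a - s)" by (simp add: d_def c_def)
    have "2 * k * (a / s * \<beta> * d / c) - 2 * k * (\<beta> * d / c) = 2 * k * ((a - s) * \<beta> / s) * (d / c)"
      using s cd by (simp add: field_simps)
    also have "(a - s) * \<beta> / s = Gamma (1 - s) / s * (Gamma a / Gamma (a - s))"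
      unfolding \<beta>e using as by simp
    finally show ?thesis unfolding dc h by (simp add: power2_eq_square mult_ac)
  qed
  finally show ?thesis by (simp add: k_def)
qed

section \<open>Sobolev inequality and Morrey norm\<close>

lemma morrey_pointwise:
  fixes u :: "'a::euclidean_space \<Rightarrow> real" and s :: real
  assumes [measurable]: "u \<in> borel_measurable borel" and "0 < s" "r > 0"
  shows "ennreal ((u x)\<^sup>2) * emeasure lborel (cball x r) \<le>
     2 * (ennreal (r powr (real DIM('a) + 2 * s)) * (\<integral>\<^sup>+y. ennreal ((u x - u y)\<^sup>2) * ennreal (norm (x - y) powr (- (real DIM('a) + 2 * s))) \<partial>lborel)
        + (\<integral>\<^sup>+y\<in>cball x r. ennreal ((u y)\<^sup>2) \<partial>lborel))"
proof -
  let ?q = "real DIM('a) + 2 * s"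
  have pt: "ennreal ((u x)\<^sup>2) * indicator (cball x r) y \<le> 2 * (ennreal (r powr ?q) * (ennreal ((u x - u y)\<^sup>2) * ennreal (norm (x - y) powr (- ?q)))
      + ennreal ((u y)\<^sup>2) * indicator (cball x r) y)" for y
  proof (cases "y \<in> cball x r")
    case True
    \<comment> \<open>This square is 2(a - b)^2 + 2b^2 - a^2 with a = u x and b = u y.\<close>
    have "0 \<le> (u x - 2 * u y)\<^sup>2" by simp
    then have "(u x)\<^sup>2 \<le> 2 * ((u x - u y)\<^sup>2 + (u y)\<^sup>2)"
      by (simp add: power2_eq_square algebra_simps)
    moreover have "(u x - u y)\<^sup>2 \<le> r powr ?q * ((u x - u y)\<^sup>2 * norm (x - y) powr (- ?q))"
    proof (cases "x = y")
      case False
      \<comment> \<open>On the ball the kernel is at least r powr (-q), so the squared increments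
        over the ball are bounded by the full singular integral.\<close>
      have "norm (x - y) powr ?q \<le> r powr ?q"
        using True assms by (intro powr_mono2) (auto simp: dist_norm)
      then have "1 \<le> r powr ?q * norm (x - y) powr (- ?q)"
        using False unfolding powr_minus by (simp add: field_simps)
      then show ?thesis
        using mult_right_mono[of 1 "r powr ?q * norm (x - y) powr (- ?q)" "(u x - u y)\<^sup>2"] by (simp add: mult_ac)
    qed simp
    ultimately have "(u x)\<^sup>2 \<le> 2 * (r powr ?q * ((u x - u y)\<^sup>2 * norm (x - y) powr (- ?q)) + (u y)\<^sup>2)"
      by (meson add_right_mono mult_left_mono order_trans zero_le_numeral)
    then have "ennreal ((u x)\<^sup>2) \<le> ennreal (2 * (r powr ?q * ((u x - u y)\<^sup>2 * norm (x - y) powr (- ?q)) + (u y)\<^sup>2))"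
      by (rule ennreal_leI)
    then show ?thesis using True by (simp add: ennreal_mult ennreal_plus del: ennreal_plus[symmetric])
  qed simp
  have "ennreal ((u x)\<^sup>2) * emeasure lborel (cball x r) = (\<integral>\<^sup>+y. ennreal ((u x)\<^sup>2) * indicator (cball x r) y \<partial>lborel)"
    by (simp add: nn_integral_cmult_indicator)
  also have "\<dots> \<le> (\<integral>\<^sup>+y. 2 * (ennreal (r powr ?q) * (ennreal ((u x - u y)\<^sup>2) * ennreal (norm (x - y) powr (- ?q)))
      + ennreal ((u y)\<^sup>2) * indicator (cball x r) y) \<partial>lborel)"
    by (intro nn_integral_mono pt)
  also have "\<dots> = 2 * (ennreal (r powr ?q) * (\<integral>\<^sup>+y. ennreal ((u x - u y)\<^sup>2) * ennreal (norm (x - y) powr (- ?q)) \<partial>lborel)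
        + (\<integral>\<^sup>+y\<in>cball x r. ennreal ((u y)\<^sup>2) \<partial>lborel))"
  proof -
    have [measurable]: "cball x r \<in> sets borel" by simp
    have "(\<integral>\<^sup>+y. ennreal (r powr ?q) * (ennreal ((u x - u y)\<^sup>2) * ennreal (norm (x - y) powr (- ?q))) \<partial>lborel)
       = ennreal (r powr ?q) * (\<integral>\<^sup>+y. ennreal ((u x - u y)\<^sup>2) * ennreal (norm (x - y) powr (- ?q)) \<partial>lborel)"
      by (rule nn_integral_cmult) measurable
    moreover have "(\<integral>\<^sup>+y. ennreal (r powr ?q) * (ennreal ((u x - u y)\<^sup>2) * ennreal (norm (x - y) powr (- ?q)))
      + ennreal ((u y)\<^sup>2) * indicator (cball x r) y \<partial>lborel)
       = (\<integral>\<^sup>+y. ennreal (r powr ?q) * (ennreal ((u x - u y)\<^sup>2) * ennreal (norm (x - y) powr (- ?q))) \<partial>lborel)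
        + (\<integral>\<^sup>+y\<in>cball x r. ennreal ((u y)\<^sup>2) \<partial>lborel)"
      by (rule nn_integral_add) measurable
    moreover have "(\<integral>\<^sup>+y. 2 * (ennreal (r powr ?q) * (ennreal ((u x - u y)\<^sup>2) * ennreal (norm (x - y) powr (- ?q)))
      + ennreal ((u y)\<^sup>2) * indicator (cball x r) y) \<partial>lborel)
       = 2 * (\<integral>\<^sup>+y. ennreal (r powr ?q) * (ennreal ((u x - u y)\<^sup>2) * ennreal (norm (x - y) powr (- ?q)))
      + ennreal ((u y)\<^sup>2) * indicator (cball x r) y \<partial>lborel)"
      by (rule nn_integral_cmult) measurable
    ultimately show ?thesis by (simp only:)
  qed
  finally show ?thesis .
qed

lemma crit_exponent_gt_2:
  assumes "0 < s" "2 * s < real N"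
  shows "crit_exponent N s > 2"
  using assms by (simp add: crit_exponent_def field_simps)

text \<open>The 4 collects the factor 2 of the pointwise inequality and the two equal terms at the
  balancing radius; the volume comes from averaging over a ball.\<close>

definition sobolev_const :: "nat \<Rightarrow> real \<Rightarrow> real" where
  "sobolev_const N s = (4 / unit_ball_vol N) powr (crit_exponent N s / 2)"

lemma sobolev_const_pos: "sobolev_const N s > 0"
  using unit_ball_vol_pos[of "real N", OF of_nat_0_le_iff, THEN less_imp_neq] by (simp add: sobolev_const_def)

text \<open>
  The radius in \<open>morrey_pointwise\<close> is chosen with \<open>r\<^sup>N = m / g\<close>, where the two terms on its right balance.
\<close>

lemma critical_power_pointwise:
  fixes u :: "'a::euclidean_space \<Rightarrow> real" and s m :: real
  defines "N \<equiv> DIM('a)"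
  defines "p \<equiv> crit_exponent N s"
  assumes [measurable]: "u \<in> borel_measurable borel" and s: "0 < s" "2 * s < real N" and m: "m > 0"
    and M: "\<And>x r. r > 0 \<Longrightarrow> (\<integral>\<^sup>+y\<in>cball x r. ennreal ((u y)\<^sup>2) \<partial>lborel) \<le> ennreal (m * r powr (2 * s))"
  shows "ennreal (\<bar>u x\<bar> powr p) \<le> ennreal (sobolev_const N s * m powr (p / 2 - 1)) *
    (\<integral>\<^sup>+y. ennreal ((u x - u y)\<^sup>2) * ennreal (norm (x - y) powr (- (real N + 2 * s))) \<partial>lborel)"
proof -
  define G where "G = (\<integral>\<^sup>+y. ennreal ((u x - u y)\<^sup>2) * ennreal (norm (x - y) powr (- (real N + 2 * s))) \<partial>lborel)"
  define K where "K = sobolev_const N s * m powr (p / 2 - 1)"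
  define \<omega> where "\<omega> = unit_ball_vol N"
  have \<omega>: "\<omega> > 0" by (simp add: \<omega>_def unit_ball_vol_pos)
  have K: "K > 0" using m sobolev_const_pos by (simp add: K_def)
  have N: "real N > 0" using s by simp
  have p: "p = 2 * real N / (real N - 2 * s)" "p > 2" using crit_exponent_gt_2[OF s] by (auto simp: p_def crit_exponent_def)
  \<comment> \<open>The balancing radius makes no sense for G = 0 or G infinite, so it is computed
    from an arbitrary finite g > 0 above G, which is afterwards lowered to G.\<close>
  have bound: "\<bar>u x\<bar> powr p \<le> K * g" if g: "g > 0" "G \<le> ennreal g" for g
  proof -
    define r where "r = (m / g) powr (1 / real N)"
    have r: "r > 0" "r powr real N = m / g" using m g N by (auto simp: r_def powr_powr)
    have rq: "r powr (real N + 2 * s) * g = m * r powr (2 * s)"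
      using r g by (simp add: powr_add)
    have "ennreal ((u x)\<^sup>2 * (\<omega> * r powr real N)) = ennreal ((u x)\<^sup>2) * emeasure lborel (cball x r)"
      using r \<omega> by (simp add: emeasure_cball \<omega>_def N_def ennreal_mult'[symmetric] powr_realpow)
    also have "\<dots> \<le> 2 * (ennreal (r powr (real N + 2 * s)) * G + (\<integral>\<^sup>+y\<in>cball x r. ennreal ((u y)\<^sup>2) \<partial>lborel))"
      unfolding G_def N_def using s r by (intro morrey_pointwise) auto
    also have "\<dots> \<le> 2 * (ennreal (r powr (real N + 2 * s)) * ennreal g + ennreal (m * r powr (2 * s)))"
      using g r by (intro mult_left_mono add_mono M) auto
    also have "\<dots> = ennreal (4 * m * r powr (2 * s))"
    proof -
      define b where "b = ennreal (m * r powr (2 * s))"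
      have "ennreal (r powr (real N + 2 * s)) * ennreal g = b"
        using g by (simp add: ennreal_mult'[symmetric] rq b_def)
      moreover have "ennreal (4 * m * r powr (2 * s)) = 4 * b"
        using m by (simp add: b_def ennreal_mult mult.assoc)
      moreover have "2 * (b + b) = 4 * b" by (simp add: mult_2[symmetric] mult.assoc[symmetric])
      ultimately show ?thesis by (simp only: b_def)
    qed
    finally have "(u x)\<^sup>2 * (\<omega> * r powr real N) \<le> 4 * m * r powr (2 * s)"
      using m by (subst (asm) ennreal_le_iff) auto
    then have "(u x)\<^sup>2 \<le> 4 / \<omega> * (g * r powr (2 * s))"
      using \<omega> g m unfolding r by (simp add: field_simps)
    then have "((u x)\<^sup>2) powr (p / 2) \<le> (4 / \<omega> * (g * r powr (2 * s))) powr (p / 2)"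
      using p(2) by (intro powr_mono2) auto
    also have "((u x)\<^sup>2) powr (p / 2) = \<bar>u x\<bar> powr p"
    proof -
      have "(u x)\<^sup>2 = \<bar>u x\<bar> powr 2" by (cases "u x = 0") auto
      then have "((u x)\<^sup>2) powr (p / 2) = (\<bar>u x\<bar> powr 2) powr (p / 2)" by (rule arg_cong)
      then show ?thesis unfolding powr_powr by simp
    qed
    also have "(4 / \<omega> * (g * r powr (2 * s))) powr (p / 2) = sobolev_const N s * (g powr (p / 2) * r powr (s * p))"
      using \<omega> g by (simp add: powr_mult powr_powr sobolev_const_def \<omega>_def p_def mult_ac powr_divide)
    also have "r powr (s * p) = (m / g) powr (p / 2 - 1)"
    proof -
      have "1 / real N * (s * p) = p / 2 - 1" unfolding p(1) using s N by (simp add: field_simps)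
      then show ?thesis by (simp add: r_def powr_powr)
    qed
    also have "g powr (p / 2) * (m / g) powr (p / 2 - 1) = m powr (p / 2 - 1) * g"
    proof -
      have "g powr (p / 2) = g * g powr (p / 2 - 1)" using g by (simp add: powr_diff)
      then show ?thesis using g m by (simp only: powr_divide) simp
    qed
    finally show ?thesis by (simp add: K_def mult_ac)
  qed
  have "ennreal (\<bar>u x\<bar> powr p) \<le> ennreal K * G"
  proof (cases G)
    case (real g)
    have "\<bar>u x\<bar> powr p \<le> K * g + e" if "e > 0" for e
      using bound[of "g + e / K"] real that K by (simp add: distrib_left add_nonneg_pos ennreal_leI)
    then have "\<bar>u x\<bar> powr p \<le> K * g" by (rule field_le_epsilon)
    then show ?thesis using real K by (simp add: ennreal_mult[symmetric])
  next
    case top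
    then show ?thesis using K by (simp add: ennreal_mult_top)
  qed
  then show ?thesis by (simp add: G_def K_def)
qed

text \<open>The last hypothesis bounds the Morrey norm by \<open>d\<close> times the squared
  critical norm; integrating the pointwise bound gives a Sobolev constant that tends to 0 with
  \<open>d\<close>. The scaling by \<open>i powr (2 / p)\<close> keeps everything homogeneous in
  \<open>u\<close>.\<close>

lemma improved_sobolev:
  fixes u :: "'a::euclidean_space \<Rightarrow> real" and s i d :: real
  defines "N \<equiv> DIM('a)"
  defines "p \<equiv> crit_exponent N s"
  assumes [measurable]: "u \<in> borel_measurable borel" and s: "0 < s" "2 * s < real N" and i: "i > 0" and d: "d > 0"
    and I: "(\<integral>\<^sup>+x. ennreal (\<bar>u x\<bar> powr p) \<partial>lborel) = ennreal i"
    and M: "\<And>x r. r > 0 \<Longrightarrow> (\<integral>\<^sup>+y\<in>cball x r. ennreal ((u y)\<^sup>2) \<partial>lborel) \<le> ennreal (d * i powr (2 / p) * r powr (2 * s))"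
  shows "ennreal (i powr (2 / p)) \<le> ennreal (sobolev_const N s * d powr (p / 2 - 1)) * dirichlet s u"
proof -
  have p: "p > 2" using crit_exponent_gt_2[OF s] by (auto simp: p_def)
  define K where "K = sobolev_const N s * (d * i powr (2 / p)) powr (p / 2 - 1)"
  have "ennreal i \<le> (\<integral>\<^sup>+x. ennreal K * (\<integral>\<^sup>+y. ennreal ((u x - u y)\<^sup>2) * ennreal (norm (x - y) powr (- (real N + 2 * s))) \<partial>lborel) \<partial>lborel)"
    unfolding I[symmetric] K_def p_def N_def using s i d M
    by (intro nn_integral_mono critical_power_pointwise) (auto simp: N_def p_def)
  also have "\<dots> = ennreal K * dirichlet s u"
    unfolding dirichlet_def N_def by (subst nn_integral_cmult) auto
  finally have "ennreal (i powr (2 / p - 1)) * ennreal i \<le> ennreal (i powr (2 / p - 1)) * (ennreal K * dirichlet s u)"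
    by (rule mult_left_mono) simp
  also have "ennreal (i powr (2 / p - 1)) * ennreal i = ennreal (i powr (2 / p))"
    using i by (simp add: ennreal_mult'[symmetric] powr_diff)
  also have "ennreal (i powr (2 / p - 1)) * (ennreal K * dirichlet s u) = ennreal (i powr (2 / p - 1) * K) * dirichlet s u"
    by (simp add: ennreal_mult' mult.assoc)
  also have "i powr (2 / p - 1) * K = sobolev_const N s * d powr (p / 2 - 1)"
  proof -
    have "i powr (2 / p - 1) * i powr (2 / p * (p / 2 - 1)) = 1"
      using p i by (simp add: powr_add[symmetric] algebra_simps)
    then show ?thesis using i d unfolding K_def powr_mult powr_powr by (simp add: powr_mult powr_powr)
  qed
  finally show ?thesis .
qed

lemma square_le_powr_split:
  fixes a l p :: real
  assumes "l > 0" "p > 2"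
  shows "a\<^sup>2 \<le> l\<^sup>2 + \<bar>a\<bar> powr p * l powr (2 - p)"
proof (cases "\<bar>a\<bar> \<le> l")
  case True
  then have "a\<^sup>2 \<le> l\<^sup>2" using assms by (simp add: abs_le_square_iff[symmetric])
  then show ?thesis by (simp add: add_increasing2)
next
  case False
  then have a: "\<bar>a\<bar> > l" by simp
  have "a\<^sup>2 = \<bar>a\<bar> powr p * \<bar>a\<bar> powr (2 - p)"
    using a assms by (simp add: powr_add[symmetric])
  also have "\<dots> \<le> \<bar>a\<bar> powr p * l powr (2 - p)"
    using a assms by (intro mult_left_mono powr_mono2') auto
  finally show ?thesis by (simp add: add_increasing)
qed

text \<open>\<open>square_le_powr_split\<close> is used at the level with
  \<open>l powr p = i / r powr real N\<close>, which brings the ball term and the tail term to the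
  same scale. Hence d = \<open>unit_ball_vol N + 1\<close> is always admissible in
  \<open>improved_sobolev\<close>, and the ordinary Sobolev inequality follows.\<close>

lemma morrey_le_critical_power:
  fixes u :: "'a::euclidean_space \<Rightarrow> real" and s i r :: real
  defines "N \<equiv> DIM('a)"
  defines "p \<equiv> crit_exponent N s"
  assumes [measurable]: "u \<in> borel_measurable borel" and s: "0 < s" "2 * s < real N" and i: "i > 0" and r: "r > 0"
    and I: "(\<integral>\<^sup>+x. ennreal (\<bar>u x\<bar> powr p) \<partial>lborel) = ennreal i"
  shows "(\<integral>\<^sup>+y\<in>cball x r. ennreal ((u y)\<^sup>2) \<partial>lborel) \<le> ennreal ((unit_ball_vol N + 1) * i powr (2 / p) * r powr (2 * s))"
proof -
  have p: "p > 2" using crit_exponent_gt_2[OF s] by (auto simp: p_def)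
  have N: "real N > 0" using s by simp
  define \<omega> where "\<omega> = unit_ball_vol N"
  have \<omega>: "\<omega> > 0" by (simp add: \<omega>_def unit_ball_vol_pos)
  define l where "l = (i / r powr real N) powr (1 / p)"
  have l: "l > 0" "l powr p = i / r powr real N" using i r p by (auto simp: l_def powr_powr)
  have [measurable]: "cball x r \<in> sets borel" by simp
  have "(\<integral>\<^sup>+y\<in>cball x r. ennreal ((u y)\<^sup>2) \<partial>lborel)
     \<le> (\<integral>\<^sup>+y. ennreal (l\<^sup>2) * indicator (cball x r) y + ennreal (l powr (2 - p)) * ennreal (\<bar>u y\<bar> powr p) \<partial>lborel)"
  proof (intro nn_integral_mono)
    fix y
    show "ennreal ((u y)\<^sup>2) * indicator (cball x r) y \<le> ennreal (l\<^sup>2) * indicator (cball x r) y + ennreal (l powr (2 - p)) * ennreal (\<bar>u y\<bar> powr p)"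
      using square_le_powr_split[OF l(1) p, of "u y"]
      by (auto simp: indicator_def ennreal_mult'[symmetric] ennreal_plus[symmetric] mult.commute simp del: ennreal_plus intro!: ennreal_leI)
  qed
  also have "\<dots> = ennreal (l\<^sup>2) * emeasure lborel (cball x r) + ennreal (l powr (2 - p)) * ennreal i"
    by (subst nn_integral_add) (auto simp: nn_integral_cmult nn_integral_cmult_indicator I)
  also have "\<dots> = ennreal (l\<^sup>2 * (\<omega> * r powr real N) + l powr (2 - p) * i)"
    using r \<omega> i by (simp add: emeasure_cball \<omega>_def N_def ennreal_mult'[symmetric] powr_realpow ennreal_plus[symmetric] del: ennreal_plus)
  also have "l\<^sup>2 * (\<omega> * r powr real N) + l powr (2 - p) * i = (\<omega> + 1) * i powr (2 / p) * r powr (2 * s)"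
  proof -
    have l2: "l\<^sup>2 = l powr 2" using l by simp
    have "l powr (2 - p) * i = l powr 2 * r powr real N"
      using l i r by (simp add: powr_diff)
    moreover have "l powr 2 * r powr real N = i powr (2 / p) * r powr (2 * s)"
    proof -
      have "l powr 2 = i powr (2 / p) * r powr (- (real N * (2 / p)))"
        using i r by (simp add: l_def powr_powr powr_divide powr_minus field_simps)
      moreover have "- (real N * (2 / p)) + real N = 2 * s"
        using s N by (simp add: p_def crit_exponent_def field_simps)
      ultimately show ?thesis by (simp add: powr_add[symmetric] mult.assoc)
    qed
    ultimately show ?thesis unfolding l2 by (simp add: algebra_simps)
  qed
  finally show ?thesis by (simp add: \<omega>_def)
qed

lemma sobolev_inequality:
  fixes u :: "'a::euclidean_space \<Rightarrow> real" and s i :: real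
  defines "N \<equiv> DIM('a)"
  defines "p \<equiv> crit_exponent N s"
  assumes [measurable]: "u \<in> borel_measurable borel" and s: "0 < s" "2 * s < real N" and i: "i \<ge> 0"
    and I: "(\<integral>\<^sup>+x. ennreal (\<bar>u x\<bar> powr p) \<partial>lborel) = ennreal i"
  shows "ennreal (i powr (2 / p)) \<le> ennreal (sobolev_const N s * (unit_ball_vol N + 1) powr (p / 2 - 1)) * dirichlet s u"
proof (cases "i = 0")
  case False
  then have i: "i > 0" using i by simp
  show ?thesis
    unfolding N_def p_def using s i I
    by (intro improved_sobolev morrey_le_critical_power)
       (auto simp: N_def p_def intro!: add_pos_pos unit_ball_vol_pos)
qed simp

section \<open>Finiteness of the singular integrals\<close>

text \<open>Subordination replaces polar coordinates. The inner Gaussian integral is bounded by a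
  constant and by a multiple of t; the smaller bound is at most a multiple of
  \<open>1 - exp (- t)\<close>, whose weighted time integral is known.\<close>

lemma nn_integral_truncated_kernel_finite:
  fixes s :: real
  assumes s: "0 < s" "s < 1"
  shows "(\<integral>\<^sup>+(z::'a::euclidean_space). ennreal (min 1 ((norm z)\<^sup>2)) * ennreal (norm z powr (- (real DIM('a) + 2 * s))) \<partial>lborel) < \<infinity>"
proof -
  define n where "n = real DIM('a) / 2"
  define k where "k = (4 * pi) powr n"
  define C where "C = 8 * 2 powr n"
  have n: "n \<ge> 0" by (simp add: n_def)
  have C: "C \<ge> 1" using n ge_one_powr_ge_zero[of 2 n] by (simp add: C_def)
  define K where "K = Gamma (DIM('a) / 2 + s) * 4 powr (DIM('a) / 2 + s)"
  have K: "K > 0" unfolding K_def using s by (intro mult_pos_pos Gamma_real_pos) (auto intro: add_nonneg_pos)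
  let ?X = "(\<integral>\<^sup>+(z::'a). ennreal (min 1 ((norm z)\<^sup>2)) * ennreal (norm z powr (- (real DIM('a) + 2 * s))) \<partial>lborel)"
  have inner: "(\<integral>\<^sup>+(z::'a). ennreal (min 1 ((norm z)\<^sup>2)) * ennreal (heat t z) \<partial>lborel) \<le> ennreal (2 * C * k * (1 - exp (- t)))"
    if t: "t > 0" for t
  proof -
    have "(\<integral>\<^sup>+(z::'a). ennreal (min 1 ((norm z)\<^sup>2)) * ennreal (heat t z) \<partial>lborel) \<le> (\<integral>\<^sup>+(z::'a). ennreal (heat t (z - 0)) \<partial>lborel)"
      by (intro nn_integral_mono) (auto simp: ennreal_mult'[symmetric] intro!: ennreal_leI mult_left_le_one_le)
    also have "\<dots> = ennreal k"
      using nn_integral_heat[OF t, of "0::'a"] by (simp add: k_def n_def)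
    finally have 1: "(\<integral>\<^sup>+(z::'a). ennreal (min 1 ((norm z)\<^sup>2)) * ennreal (heat t z) \<partial>lborel) \<le> ennreal k" .
    have "(\<integral>\<^sup>+(z::'a). ennreal (min 1 ((norm z)\<^sup>2)) * ennreal (heat t z) \<partial>lborel) \<le> (\<integral>\<^sup>+(z::'a). ennreal (C * t) * ennreal (heat (2 * t) (z - 0)) \<partial>lborel)"
    proof (intro nn_integral_mono)
      fix z :: 'a
      define y where "y = (norm z)\<^sup>2 / (8 * t)"
      have y: "y \<ge> 0" using t by (simp add: y_def)
      \<comment> \<open>Half of the Gaussian exponent absorbs |z|^2, the other half is a heat kernel
        at time 2t. This is the source of 8 and \<open>2 powr n\<close> in \<open>C\<close>.\<close>
      have "y * exp (- y) \<le> 1"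
      proof -
        have "y \<le> exp y" using exp_ge_add_one_self[of y] by linarith
        then show ?thesis by (simp add: exp_minus divide_inverse[symmetric])
      qed
      then have "8 * t * y * (exp (- y) * exp (- y)) \<le> 8 * t * exp (- y)"
        using t mult_right_mono[of "y * exp (- y)" 1 "8 * t * exp (- y)"] by (simp add: mult_ac)
      also have "exp (- y) * exp (- y) = exp (- (norm z)\<^sup>2 / (4 * t))"
        by (simp add: exp_add[symmetric] y_def)
      finally have "(norm z)\<^sup>2 * exp (- (norm z)\<^sup>2 / (4 * t)) \<le> 8 * t * exp (- (norm z)\<^sup>2 / (4 * (2 * t)))"
        using t by (simp add: y_def)
      then have "t powr (- n) * ((norm z)\<^sup>2 * exp (- (norm z)\<^sup>2 / (4 * t))) \<le> t powr (- n) * (8 * t * exp (- (norm z)\<^sup>2 / (4 * (2 * t))))"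
        by (rule mult_left_mono) simp
      moreover have "t powr (- n) = 2 powr n * (2 * t) powr (- n)"
        using t by (simp add: powr_mult powr_minus)
      ultimately have "(norm z)\<^sup>2 * heat t z \<le> C * t * heat (2 * t) z"
        unfolding heat_def C_def n_def[symmetric] by (simp add: mult_ac)
      moreover have "min 1 ((norm z)\<^sup>2) * heat t z \<le> (norm z)\<^sup>2 * heat t z"
        by (intro mult_right_mono) auto
      ultimately have "min 1 ((norm z)\<^sup>2) * heat t z \<le> C * t * heat (2 * t) z" by linarith
      then show "ennreal (min 1 ((norm z)\<^sup>2)) * ennreal (heat t z) \<le> ennreal (C * t) * ennreal (heat (2 * t) (z - 0))"
        using C t by (simp add: ennreal_mult'[symmetric] ennreal_leI)
    qed
    also have "\<dots> = ennreal (C * t) * ennreal k"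
      using nn_integral_heat[of "2 * t" "0::'a"] t by (subst nn_integral_cmult) (auto simp: k_def n_def)
    also have "\<dots> = ennreal (C * t * k)" using C t by (simp add: ennreal_mult')
    finally have 2: "(\<integral>\<^sup>+(z::'a). ennreal (min 1 ((norm z)\<^sup>2)) * ennreal (heat t z) \<partial>lborel) \<le> ennreal (C * t * k)" .
    \<comment> \<open>The quotient is at least 1/2 for t \<ge> 1 and at least t/2 below 1, matching
      the constant bound and the linear bound respectively.\<close>
    have e: "1 - exp (- t) \<ge> t / (1 + t)"
      using exp_ge_add_one_self[of t] t by (simp add: exp_minus field_simps)
    have k0: "k \<ge> 0" by (simp add: k_def)
    show ?thesis
    proof (cases "t \<ge> 1")
      case True
      then have "1 / 2 \<le> t / (1 + t)" by (simp add: field_simps)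
      then have "1 / 2 \<le> 1 - exp (- t)" using e by linarith
      then have "1 \<le> 2 * C * (1 - exp (- t))" using C mult_mono[of 1 C "1/2" "1 - exp (- t)"] by simp
      then have "k \<le> 2 * C * k * (1 - exp (- t))" using k0 mult_right_mono[of 1 "2 * C * (1 - exp (- t))" k] by (simp add: mult_ac)
      then show ?thesis using 1 by (meson ennreal_leI order_trans)
    next
      case False
      then have "t / 2 \<le> t / (1 + t)" using t by (intro divide_left_mono) auto
      then have "t / 2 \<le> 1 - exp (- t)" using e by (rule order_trans)
      then have "t \<le> 2 * (1 - exp (- t))" by simp
      then have "C * k * t \<le> C * k * (2 * (1 - exp (- t)))" using C k0 by (intro mult_left_mono) auto
      then have "C * t * k \<le> 2 * C * k * (1 - exp (- t))" by (simp add: mult_ac)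
      then show ?thesis using 2 by (meson ennreal_leI order_trans)
    qed
  qed
  have "ennreal K * ?X = (\<integral>\<^sup>+t\<in>{0<..}. ennreal (t powr (- 1 - s)) * (\<integral>\<^sup>+(z::'a). ennreal (min 1 ((norm z)\<^sup>2)) * ennreal (heat t z) \<partial>lborel) \<partial>lborel)"
    unfolding K_def using s by (intro nn_integral_subordination) auto
  also have "\<dots> \<le> (\<integral>\<^sup>+t. ennreal (2 * C * k) * (ennreal (t powr (- 1 - s) * (1 - exp (- t))) * indicator {0<..} t) \<partial>lborel)"
  proof (intro nn_integral_mono)
    fix t :: real
    have "ennreal (t powr (- 1 - s)) * ennreal (2 * C * k * (1 - exp (- t))) = ennreal (2 * C * k) * ennreal (t powr (- 1 - s) * (1 - exp (- t)))"
      if "t > 0"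
      using that C by (simp add: ennreal_mult'[symmetric] k_def mult_ac)
    then show "ennreal (t powr (- 1 - s)) * (\<integral>\<^sup>+(z::'a). ennreal (min 1 ((norm z)\<^sup>2)) * ennreal (heat t z) \<partial>lborel) * indicator {0<..} t
       \<le> ennreal (2 * C * k) * (ennreal (t powr (- 1 - s) * (1 - exp (- t))) * indicator {0<..} t)"
      using mult_left_mono[OF inner[of t], of "ennreal (t powr (- 1 - s))"] by (auto simp: indicator_def)
  qed
  also have "\<dots> = ennreal (2 * C * k) * ennreal (Gamma (1 - s) / s)"
    using nn_integral_one_minus_exp[OF s] by (subst nn_integral_cmult) auto
  also have "\<dots> < \<infinity>" by (simp add: ennreal_mult_less_top)
  finally show ?thesis using K by (auto simp: ennreal_mult_less_top less_top)
qed

text \<open>The weight is a heat mixture with exponent n - s. For t \<le> 1 the mass of the kernel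
  bounds the integral over \<open>A\<close>, for t > 1 its supremum times the volume does; n > s and
  s > 0 give convergence at the two ends.\<close>

lemma nn_integral_inverse_power_finite:
  fixes A :: "'a::euclidean_space set" and s :: real
  assumes s: "0 < s" "2 * s < DIM('a)" and A [measurable]: "A \<in> sets borel" and fin: "emeasure lborel A < \<infinity>"
  shows "(\<integral>\<^sup>+x\<in>A. ennreal (norm x powr (- 2 * s)) \<partial>lborel) < \<infinity>"
proof -
  define n where "n = real DIM('a) / 2"
  define k where "k = (4 * pi) powr n"
  define c where "c = Gamma s * 4 powr s"
  have c: "c > 0" unfolding c_def using s by (intro mult_pos_pos Gamma_real_pos) auto
  have ns: "n - s < DIM('a) / 2" "n - s > 0" using s by (auto simp: n_def)
  have eq: "ennreal c * ennreal (norm x powr (- 2 * s)) = (\<integral>\<^sup>+t\<in>{0<..}. ennreal (t powr (n - s - 1) * heat t x) \<partial>lborel)" if "x \<noteq> 0" for x :: 'a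
  proof -
    have e: "DIM('a) / 2 - (n - s) = s" "2 * (n - s) - DIM('a) = - 2 * s" by (auto simp: n_def)
    from nn_integral_time_heat[OF that ns(1)] show ?thesis unfolding e c_def using s by (simp add: ennreal_mult'[symmetric])
  qed
  have "ennreal c * (\<integral>\<^sup>+x\<in>A. ennreal (norm x powr (- 2 * s)) \<partial>lborel) = (\<integral>\<^sup>+x. ennreal c * (ennreal (norm x powr (- 2 * s)) * indicator A x) \<partial>lborel)"
    by (subst nn_integral_cmult) auto
  also have "\<dots> = (\<integral>\<^sup>+x. (\<integral>\<^sup>+t. indicator A x * (ennreal (t powr (n - s - 1) * heat t x) * indicator {0<..} t) \<partial>lborel) \<partial>lborel)"
  proof (intro nn_integral_cong_AE eventually_mono[OF AE_lborel_singleton[of 0]])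
    fix x :: 'a assume x: "x \<noteq> 0"
    have "ennreal c * (ennreal (norm x powr (- 2 * s)) * indicator A x) = indicator A x * (ennreal c * ennreal (norm x powr (- 2 * s)))"
      by (simp only: mult_ac)
    then show "ennreal c * (ennreal (norm x powr (- 2 * s)) * indicator A x) =
       (\<integral>\<^sup>+t. indicator A x * (ennreal (t powr (n - s - 1) * heat t x) * indicator {0<..} t) \<partial>lborel)"
      by (subst nn_integral_cmult, measurable, simp only: eq[OF x])
  qed
  also have "\<dots> = (\<integral>\<^sup>+t. (\<integral>\<^sup>+x. indicator A x * (ennreal (t powr (n - s - 1) * heat t x) * indicator {0<..} t) \<partial>lborel) \<partial>lborel)"
    by (rule lborel_pair.Fubini') measurable
  also have "\<dots> \<le> (\<integral>\<^sup>+t. ennreal k * (ennreal (t powr (n - s - 1)) * indicator {0..1} t)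
       + emeasure lborel A * (ennreal (t powr (- 1 - s)) * indicator {1<..} t) \<partial>lborel)"
  proof (intro nn_integral_mono)
    fix t :: real
    show "(\<integral>\<^sup>+x. indicator A x * (ennreal (t powr (n - s - 1) * heat t x) * indicator {0<..} t) \<partial>lborel) \<le>
      ennreal k * (ennreal (t powr (n - s - 1)) * indicator {0..1} t) + emeasure lborel A * (ennreal (t powr (- 1 - s)) * indicator {1<..} t)"
    proof -
      consider "t \<le> 0" | "0 < t" "t \<le> 1" | "t > 1" by linarith
      then show ?thesis
      proof cases
        case 1
        then show ?thesis by simp
      next
        case 2
        have "(\<integral>\<^sup>+x. indicator A x * (ennreal (t powr (n - s - 1) * heat t x) * indicator {0<..} t) \<partial>lborel) \<le> (\<integral>\<^sup>+x. ennreal (t powr (n - s - 1)) * ennreal (heat t (x - (0::'a))) \<partial>lborel)"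
          by (intro nn_integral_mono) (auto simp: indicator_def ennreal_mult'[symmetric])
        also have "\<dots> = ennreal k * ennreal (t powr (n - s - 1))"
          using nn_integral_heat[OF 2(1), of "0::'a"] by (subst nn_integral_cmult) (auto simp: k_def n_def mult.commute)
        finally show ?thesis using 2 by simp
      next
        case 3
        have "(\<integral>\<^sup>+x. indicator A x * (ennreal (t powr (n - s - 1) * heat t x) * indicator {0<..} t) \<partial>lborel) \<le> (\<integral>\<^sup>+x. ennreal (t powr (- 1 - s)) * indicator A x \<partial>lborel)"
        proof (intro nn_integral_mono)
          fix x :: 'a
          have "t powr (n - s - 1) * heat t x \<le> t powr (n - s - 1) * t powr (- n)"
            unfolding heat_def n_def[symmetric] using 3 by (intro mult_left_mono mult_right_le_one_le) auto
          also have "\<dots> = t powr (- 1 - s)" by (simp add: powr_add[symmetric] algebra_simps)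
          finally show "indicator A x * (ennreal (t powr (n - s - 1) * heat t x) * indicator {0<..} t) \<le> ennreal (t powr (- 1 - s)) * indicator A x"
            by (auto simp: indicator_def intro!: ennreal_leI)
        qed
        also have "\<dots> = emeasure lborel A * ennreal (t powr (- 1 - s))"
          by (subst nn_integral_cmult_indicator) (auto simp: mult.commute)
        finally show ?thesis using 3 by simp
      qed
    qed
  qed
  also have "\<dots> = ennreal k * (\<integral>\<^sup>+t\<in>{0..1}. ennreal (t powr (n - s - 1)) \<partial>lborel) + emeasure lborel A * (\<integral>\<^sup>+t\<in>{1<..}. ennreal (t powr (- 1 - s)) \<partial>lborel)"
    by (subst nn_integral_add) (auto simp: nn_integral_cmult)
  also have "(\<integral>\<^sup>+t\<in>{0..1}. ennreal (t powr (n - s - 1)) \<partial>lborel) = ennreal (1 powr (n - s - 1 + 1) / (n - s - 1 + 1))"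
    using ns by (intro nn_integral_has_integral_lebesgue' has_integral_powr_from_0) auto
  also have "(\<integral>\<^sup>+t\<in>{1<..}. ennreal (t powr (- 1 - s)) \<partial>lborel) = ennreal (1 powr (- s) / s)"
    using s by (intro nn_integral_powr_tail) auto
  also have "ennreal k * ennreal (1 powr (n - s - 1 + 1) / (n - s - 1 + 1)) + emeasure lborel A * ennreal (1 powr (- s) / s) < \<infinity>"
    using fin by (auto simp: ennreal_mult_less_top)
  finally show ?thesis using c by (auto simp: ennreal_mult_less_top less_top)
qed

section \<open>Test functions and their completion\<close>

lemma continuous_compact_support_bounded:
  fixes f :: "'a::metric_space \<Rightarrow> real"
  assumes "continuous_on UNIV f" "compact K" "\<And>x. x \<notin> K \<Longrightarrow> f x = 0"
  shows "\<exists>B\<ge>0. \<forall>x. \<bar>f x\<bar> \<le> B"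
proof -
  have "bounded (f ` K)"
    using assms by (intro compact_imp_bounded compact_continuous_image) (auto intro: continuous_on_subset)
  then obtain B where B: "\<forall>x\<in>K. \<bar>f x\<bar> \<le> B" by (auto simp: bounded_iff)
  have "\<bar>f x\<bar> \<le> max B 0" for x
    using B assms(3)[of x] by (cases "x \<in> K") (auto simp: le_max_iff_disj)
  then show ?thesis by (intro exI[of _ "max B 0"]) auto
qed

text \<open>First-order smoothness gives all of this: directional derivatives are continuous and
  vanish off the closed support, hence are bounded, and the bounds over a basis add up to a
  Lipschitz constant.\<close>

lemma test_function_bounds:
  fixes \<phi> :: "'a::euclidean_space \<Rightarrow> real"
  assumes "\<phi> \<in> test_functions"
  obtains K B L where "compact K" "\<And>x. x \<notin> K \<Longrightarrow> \<phi> x = 0" "\<And>x. \<bar>\<phi> x\<bar> \<le> B"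
    "\<And>x y. \<bar>\<phi> x - \<phi> y\<bar> \<le> L * norm (x - y)" "continuous_on UNIV \<phi>"
proof -
  define K where "K = closure {x. \<phi> x \<noteq> 0}"
  have K: "compact K" using assms by (simp add: test_functions_def K_def)
  have zero: "\<phi> x = 0" if "x \<notin> K" for x
    using that closure_subset[of "{x. \<phi> x \<noteq> 0}"] by (auto simp: K_def)
  have "C_k 0 \<phi>" "C_k (Suc 0) \<phi>" using assms by (auto simp: test_functions_def)
  then have cont: "continuous_on UNIV \<phi>" and diff: "\<And>x. \<phi> differentiable (at x)"
    and dcont: "\<And>v. continuous_on UNIV (\<lambda>x. frechet_derivative \<phi> (at x) v)" by auto
  have der: "(\<phi> has_derivative frechet_derivative \<phi> (at x)) (at x)" for x
    using diff by (simp add: frechet_derivative_works)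
  have dzero: "frechet_derivative \<phi> (at x) v = 0" if "x \<notin> K" for x v
  proof -
    have "(\<phi> has_derivative (\<lambda>_. 0)) (at x)"
    proof (rule has_derivative_transform_within_open[where f = "\<lambda>_. 0" and s = "- K"])
      show "open (- K)" unfolding K_def by (rule open_Compl[OF closed_closure])
    qed (use that zero in auto)
    then show ?thesis by (metis frechet_derivative_at)
  qed
  obtain B where B: "\<And>x. \<bar>\<phi> x\<bar> \<le> B"
    using continuous_compact_support_bounded[OF cont K zero] by blast
  have "\<exists>B\<ge>0. \<forall>x. \<bar>frechet_derivative \<phi> (at x) b\<bar> \<le> B" for b
    by (rule continuous_compact_support_bounded[OF dcont K dzero])
  then obtain D where D: "\<And>b. D b \<ge> 0" "\<And>b x. \<bar>frechet_derivative \<phi> (at x) b\<bar> \<le> D b"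
    by metis
  define L where "L = (\<Sum>b\<in>Basis. D b)"
  have bound: "norm (frechet_derivative \<phi> (at x) v) \<le> L * norm v" for x v
  proof -
    let ?F = "frechet_derivative \<phi> (at x)"
    have lin: "linear ?F" using der has_derivative_linear by blast
    have "?F v = ?F (\<Sum>b\<in>Basis. (v \<bullet> b) *\<^sub>R b)" by (simp add: euclidean_representation)
    also have "\<dots> = (\<Sum>b\<in>Basis. (v \<bullet> b) * ?F b)"
      using lin by (simp add: linear_sum linear_scale)
    finally have "norm (?F v) \<le> (\<Sum>b\<in>Basis. norm ((v \<bullet> b) * ?F b))" by (simp add: sum_abs)
    also have "\<dots> \<le> (\<Sum>b\<in>Basis. norm v * D b)"
      using D by (intro sum_mono) (auto simp: abs_mult Basis_le_norm intro!: mult_mono)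
    finally show ?thesis by (simp add: L_def sum_distrib_left mult.commute)
  qed
  have "\<bar>\<phi> x - \<phi> y\<bar> \<le> L * norm (x - y)" for x y
  proof -
    have "norm (\<phi> x - \<phi> y) \<le> L * norm (x - y)"
    proof (rule differentiable_bound[of UNIV \<phi> "\<lambda>x. frechet_derivative \<phi> (at x)"])
      show "onorm (frechet_derivative \<phi> (at x)) \<le> L" for x
        using bound D by (intro onorm_bound) (auto simp: L_def sum_nonneg)
    qed (use der in auto)
    then show ?thesis by simp
  qed
  with K zero B cont show ?thesis by (intro that)
qed

lemma dirichlet_eq_increments:
  fixes u :: "'a::euclidean_space \<Rightarrow> real"
  assumes [measurable]: "u \<in> borel_measurable borel"
  shows "dirichlet s u = (\<integral>\<^sup>+z. (\<integral>\<^sup>+x. ennreal ((u (x + z) - u x)\<^sup>2) \<partial>lborel) * ennreal (norm z powr (- (real DIM('a) + 2 * s))) \<partial>lborel)"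
  unfolding dirichlet_def by (subst nn_integral_increments) auto

lemma test_function_finite:
  fixes \<phi> :: "'a::euclidean_space \<Rightarrow> real" and s :: real
  assumes \<phi>: "\<phi> \<in> test_functions" and s: "0 < s" "s < 1" "2 * s < DIM('a)" and q: "q > 0"
  shows "\<phi> \<in> borel_measurable borel" "dirichlet s \<phi> < \<infinity>" "hardy_int s \<phi> < \<infinity>"
    "(\<integral>\<^sup>+x. ennreal ((\<phi> x)\<^sup>2) \<partial>lborel) < \<infinity>" "integrable lborel (\<lambda>x. \<bar>\<phi> x\<bar> powr q)"
proof -
  obtain K B L where K: "compact K" and zero: "\<And>x. x \<notin> K \<Longrightarrow> \<phi> x = 0" and B: "\<And>x. \<bar>\<phi> x\<bar> \<le> B"
    and L: "\<And>x y. \<bar>\<phi> x - \<phi> y\<bar> \<le> L * norm (x - y)" and cont: "continuous_on UNIV \<phi>"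
    using test_function_bounds[OF \<phi>] by blast
  show m [measurable]: "\<phi> \<in> borel_measurable borel"
    using cont by (rule borel_measurable_continuous_onI)
  have Km [measurable]: "K \<in> sets borel" using K by (simp add: borel_compact)
  have Kfin: "emeasure lborel K < \<infinity>" using emeasure_bounded_finite[OF compact_imp_bounded[OF K]] by simp
  have B0: "B \<ge> 0" using B[of 0] by linarith
  have sq: "(\<phi> x)\<^sup>2 \<le> B\<^sup>2" for x using B[of x] B0 by (simp add: abs_le_square_iff[symmetric])
  have sqK: "ennreal ((\<phi> x)\<^sup>2) \<le> ennreal (B\<^sup>2) * indicator K x" for x
    using sq[of x] zero[of x] by (auto simp: indicator_def intro!: ennreal_leI)
  have "(\<integral>\<^sup>+x. ennreal ((\<phi> x)\<^sup>2) \<partial>lborel) \<le> (\<integral>\<^sup>+x. ennreal (B\<^sup>2) * indicator K x \<partial>lborel)"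
    by (intro nn_integral_mono sqK)
  also have "\<dots> < \<infinity>" using Kfin by (simp add: nn_integral_cmult_indicator ennreal_mult_less_top)
  finally show "(\<integral>\<^sup>+x. ennreal ((\<phi> x)\<^sup>2) \<partial>lborel) < \<infinity>" .
  have "hardy_int s \<phi> \<le> (\<integral>\<^sup>+x. ennreal (B\<^sup>2) * (ennreal (norm x powr (- 2 * s)) * indicator K x) \<partial>lborel)"
    unfolding hardy_int_def
  proof (intro nn_integral_mono)
    fix x
    show "ennreal ((\<phi> x)\<^sup>2) * ennreal (norm x powr (- 2 * s)) \<le> ennreal (B\<^sup>2) * (ennreal (norm x powr (- 2 * s)) * indicator K x)"
      using mult_right_mono[OF sqK[of x], of "ennreal (norm x powr (- 2 * s))"] by (simp add: mult_ac)
  qed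
  also have "\<dots> = ennreal (B\<^sup>2) * (\<integral>\<^sup>+x\<in>K. ennreal (norm x powr (- 2 * s)) \<partial>lborel)"
    by (subst nn_integral_cmult) auto
  also have "\<dots> < \<infinity>"
    using nn_integral_inverse_power_finite[OF s(1,3) Km Kfin] by (simp add: ennreal_mult_less_top)
  finally show "hardy_int s \<phi> < \<infinity>" .
  have "integrable lborel (\<lambda>x. B powr q * indicat_real K x)"
    using Kfin by (intro integrable_mult_right) (auto simp: integrable_indicator_iff)
  then show "integrable lborel (\<lambda>x. \<bar>\<phi> x\<bar> powr q)"
  proof (rule Bochner_Integration.integrable_bound)
    have "\<bar>\<phi> x\<bar> powr q \<le> B powr q * indicat_real K x" for x
      using B[of x] zero[of x] q by (auto simp: indicator_def intro!: powr_mono2)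
    then show "AE x in lborel. norm (\<bar>\<phi> x\<bar> powr q) \<le> norm (B powr q * indicat_real K x)" by simp
  qed simp
  \<comment> \<open>\<open>A\<close> serves two bounds on an increment at once: the Lipschitz bound
    for small z and 2B for large z. An increment vanishes unless x or x + z lies in K, whence twice
    the volume of K below.\<close>
  define A where "A = L\<^sup>2 + 4 * B\<^sup>2"
  have A: "A \<ge> 0" by (simp add: A_def)
  have incr: "(\<integral>\<^sup>+x. ennreal ((\<phi> (x + z) - \<phi> x)\<^sup>2) \<partial>lborel) \<le> ennreal A * ennreal (min 1 ((norm z)\<^sup>2)) * (2 * emeasure lborel K)" for z
  proof -
    have "(\<integral>\<^sup>+x. ennreal ((\<phi> (x + z) - \<phi> x)\<^sup>2) \<partial>lborel)
      \<le> (\<integral>\<^sup>+x. ennreal A * ennreal (min 1 ((norm z)\<^sup>2)) * (indicator K (z + x) + indicator K x) \<partial>lborel)"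
    proof (intro nn_integral_mono)
      fix x
      show "ennreal ((\<phi> (x + z) - \<phi> x)\<^sup>2) \<le> ennreal A * ennreal (min 1 ((norm z)\<^sup>2)) * (indicator K (z + x) + indicator K x)"
      proof (cases "x \<in> K \<or> z + x \<in> K")
        case True
        have "\<bar>\<phi> (x + z) - \<phi> x\<bar>\<^sup>2 \<le> (L * norm z)\<^sup>2"
          using L[of "x + z" x] by (intro power_mono) auto
        then have 1: "(\<phi> (x + z) - \<phi> x)\<^sup>2 \<le> L\<^sup>2 * (norm z)\<^sup>2" by (simp add: power_mult_distrib)
        have "\<bar>\<phi> (x + z) - \<phi> x\<bar>\<^sup>2 \<le> (2 * B)\<^sup>2"
          using B[of "x + z"] B[of x] by (intro power_mono) auto
        then have 2: "(\<phi> (x + z) - \<phi> x)\<^sup>2 \<le> 4 * B\<^sup>2" by (simp add: power_mult_distrib)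
        have "L\<^sup>2 * (norm z)\<^sup>2 \<le> A * (norm z)\<^sup>2" "4 * B\<^sup>2 \<le> A * 1"
          by (auto simp: A_def intro!: mult_right_mono)
        then have "(\<phi> (x + z) - \<phi> x)\<^sup>2 \<le> A * min 1 ((norm z)\<^sup>2)"
          using 1 2 by (simp add: min_def)
        then have "ennreal ((\<phi> (x + z) - \<phi> x)\<^sup>2) \<le> ennreal A * ennreal (min 1 ((norm z)\<^sup>2)) * 1"
          using A by (simp add: ennreal_mult'[symmetric] ennreal_leI)
        also have "\<dots> \<le> ennreal A * ennreal (min 1 ((norm z)\<^sup>2)) * (indicator K (z + x) + indicator K x)"
          using True by (intro mult_left_mono) (auto simp: indicator_def)
        finally show ?thesis .
      next
        case False
        then show ?thesis using zero[of x] zero[of "z + x"] by (simp add: add.commute)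
      qed
    qed
    also have "\<dots> = ennreal A * ennreal (min 1 ((norm z)\<^sup>2)) * (2 * emeasure lborel K)"
    proof -
      have "(\<integral>\<^sup>+x. indicator K (z + x) + indicator K x \<partial>lborel) = (\<integral>\<^sup>+x. indicator K (z + x) \<partial>lborel) + (\<integral>\<^sup>+x. indicator K x \<partial>lborel)"
        by (rule nn_integral_add) measurable
      also have "\<dots> = 2 * emeasure lborel K"
        using nn_integral_translate[of "indicator K" z] by (simp add: mult_2)
      finally show ?thesis by (subst nn_integral_cmult) auto
    qed
    finally show ?thesis .
  qed
  have "dirichlet s \<phi> \<le> (\<integral>\<^sup>+z. ennreal A * (2 * emeasure lborel K) * (ennreal (min 1 ((norm z)\<^sup>2)) * ennreal (norm (z::'a) powr (- (real DIM('a) + 2 * s)))) \<partial>lborel)"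
    unfolding dirichlet_eq_increments[OF m]
  proof (intro nn_integral_mono)
    fix z :: 'a
    show "(\<integral>\<^sup>+x. ennreal ((\<phi> (x + z) - \<phi> x)\<^sup>2) \<partial>lborel) * ennreal (norm z powr (- (real DIM('a) + 2 * s)))
       \<le> ennreal A * (2 * emeasure lborel K) * (ennreal (min 1 ((norm z)\<^sup>2)) * ennreal (norm (z::'a) powr (- (real DIM('a) + 2 * s))))"
      using mult_right_mono[OF incr[of z], of "ennreal (norm z powr (- (real DIM('a) + 2 * s)))"] by (simp add: mult_ac)
  qed
  also have "\<dots> = ennreal A * (2 * emeasure lborel K) * (\<integral>\<^sup>+z. (ennreal (min 1 ((norm z)\<^sup>2)) * ennreal (norm (z::'a) powr (- (real DIM('a) + 2 * s)))) \<partial>lborel)"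
    by (subst nn_integral_cmult) auto
  also have "\<dots> < \<infinity>"
    using nn_integral_truncated_kernel_finite[OF s(1,2), where 'a = 'a] Kfin by (auto simp: ennreal_mult_less_top)
  finally show "dirichlet s \<phi> < \<infinity>" .
qed

section \<open>Perturbation of the seminorm, and Hardy for test functions\<close>

text \<open>A weighted Young inequality stands in for the triangle inequality, which avoids square
  roots in \<open>ennreal\<close>. The free \<open>e\<close> lets a small perturbation cost only a
  factor close to 1.\<close>

lemma dirichlet_add_le:
  fixes u v :: "'a::euclidean_space \<Rightarrow> real"
  assumes [measurable]: "u \<in> borel_measurable borel" "v \<in> borel_measurable borel" and e: "e > 0"
  shows "dirichlet s (\<lambda>x. u x + v x) \<le> ennreal (1 + e) * dirichlet s u + ennreal (1 + 1 / e) * dirichlet s v"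
proof -
  define k where "k = (\<lambda>x y :: 'a. ennreal (norm (x - y) powr (- (real DIM('a) + 2 * s))))"
  have "(u x + v x - (u y + v y))\<^sup>2 \<le> (1 + e) * (u x - u y)\<^sup>2 + (1 + 1 / e) * (v x - v y)\<^sup>2" for x y
  proof -
    have *: "(a + b)\<^sup>2 \<le> (1 + e) * a\<^sup>2 + (1 + 1 / e) * b\<^sup>2" for a b :: real
    proof -
      have "0 \<le> (e * a - b)\<^sup>2 / e" using e by simp
      also have "(e * a - b)\<^sup>2 / e = (1 + e) * a\<^sup>2 + (1 + 1 / e) * b\<^sup>2 - (a + b)\<^sup>2"
        using e by (simp add: field_simps power2_eq_square)
      finally show ?thesis by simp
    qed
    show ?thesis using *[of "u x - u y" "v x - v y"] by (simp add: algebra_simps)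
  qed
  then have pt: "ennreal ((u x + v x - (u y + v y))\<^sup>2) \<le> ennreal (1 + e) * ennreal ((u x - u y)\<^sup>2) + ennreal (1 + 1 / e) * ennreal ((v x - v y)\<^sup>2)" for x y
    using e by (simp add: ennreal_mult'[symmetric] ennreal_plus[symmetric] ennreal_leI del: ennreal_plus)
  have "dirichlet s (\<lambda>x. u x + v x) \<le> (\<integral>\<^sup>+x. (\<integral>\<^sup>+y. ennreal (1 + e) * (ennreal ((u x - u y)\<^sup>2) * k x y) + ennreal (1 + 1 / e) * (ennreal ((v x - v y)\<^sup>2) * k x y) \<partial>lborel) \<partial>lborel)"
    unfolding dirichlet_def
  proof (intro nn_integral_mono)
    fix x y :: 'a
    show "ennreal ((u x + v x - (u y + v y))\<^sup>2) * ennreal (norm (x - y) powr (- (real DIM('a) + 2 * s)))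
      \<le> ennreal (1 + e) * (ennreal ((u x - u y)\<^sup>2) * k x y) + ennreal (1 + 1 / e) * (ennreal ((v x - v y)\<^sup>2) * k x y)"
      using mult_right_mono[OF pt[of x y], of "k x y"] unfolding k_def by (simp add: distrib_right mult.assoc)
  qed
  also have "\<dots> = (\<integral>\<^sup>+x. ennreal (1 + e) * (\<integral>\<^sup>+y. ennreal ((u x - u y)\<^sup>2) * k x y \<partial>lborel) + ennreal (1 + 1 / e) * (\<integral>\<^sup>+y. ennreal ((v x - v y)\<^sup>2) * k x y \<partial>lborel) \<partial>lborel)"
    unfolding k_def by (intro nn_integral_cong) (simp add: nn_integral_add nn_integral_cmult)
  also have "\<dots> = ennreal (1 + e) * dirichlet s u + ennreal (1 + 1 / e) * dirichlet s v"
    unfolding dirichlet_def k_def by (simp add: nn_integral_add nn_integral_cmult)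
  finally show ?thesis .
qed

lemma gagliardo_sq_eq_dirichlet:
  fixes u :: "real ^ 'n::finite \<Rightarrow> real"
  assumes [measurable]: "u \<in> borel_measurable borel"
  shows "gagliardo_sq s u = ennreal (frac_const TYPE('n) s / 2) * dirichlet s u"
proof -
  have "(\<integral>\<^sup>+ (x, y). ennreal (\<bar>u x - u y\<bar>\<^sup>2 / norm (x - y) powr (real CARD('n) + 2 * s)) \<partial>(lborel \<Otimes>\<^sub>M lborel))
     = (\<integral>\<^sup>+x. (\<integral>\<^sup>+y. ennreal (\<bar>u x - u y\<bar>\<^sup>2 / norm (x - y) powr (real CARD('n) + 2 * s)) \<partial>lborel) \<partial>lborel)"
    by (subst lborel.nn_integral_fst[symmetric]) auto
  also have "\<dots> = dirichlet s u"
    unfolding dirichlet_def divide_powr_eq by (simp add: ennreal_mult')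
  finally show ?thesis by (simp add: gagliardo_sq_def)
qed

lemma frac_const_pos:
  assumes "0 < s" "s < 1"
  shows "frac_const TYPE('n::finite) s > 0"
  unfolding frac_const_eq[OF assms] using assms
  by (intro divide_pos_pos mult_pos_pos Gamma_real_pos) (auto intro: add_nonneg_pos)

lemma hardy_const_pos:
  assumes "0 < s" "2 * s < real N"
  shows "hardy_const N s > 0"
  unfolding hardy_const_def using assms
  by (intro divide_pos_pos mult_pos_pos zero_less_power Gamma_real_pos) auto

text \<open>\<open>R\<close> times the Dirichlet form, the right side of the Hardy bound, is the
  squared seminorm times 2k, and this 2k cancels against the left side. Exactly the sharp constant
  remains.\<close>

lemma hardy_test_function:
  fixes \<phi> :: "real ^ 'n::finite \<Rightarrow> real" and s :: real
  assumes \<phi>: "\<phi> \<in> test_functions" and s: "0 < s" "s < 1" "2 * s < CARD('n)"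
  shows "ennreal (hardy_const CARD('n) s) * hardy_int s \<phi> \<le> gagliardo_sq s \<phi>"
proof -
  have s': "2 * s < DIM(real^'n)" using s by simp
  note f = test_function_finite[OF \<phi> s(1,2) s', of 1, simplified]
  define R where "R = Gamma (CARD('n) / 2 + s) * 4 powr (CARD('n) / 2 + s)"
  define k where "k = (4 * pi) powr (CARD('n) / 2) * (Gamma (1 - s) / s)"
  have k: "k > 0" unfolding k_def using s by (intro mult_pos_pos divide_pos_pos Gamma_real_pos) auto
  have L: "hardy_const CARD('n) s > 0" using s by (intro hardy_const_pos)
  have C: "frac_const TYPE('n) s / 2 = 1 / (2 * k) * R"
    unfolding frac_const_eq[OF s(1,2)] R_def k_def using s by (simp add: mult_ac)
  have main: "ennreal (2 * k * hardy_const CARD('n) s) * hardy_int s \<phi> \<le> ennreal R * dirichlet s \<phi>"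
    using hardy_inequality_integrable[OF f(1) s(1,2) s'] f unfolding R_def k_def by (simp add: mult.assoc)
  have "ennreal (hardy_const CARD('n) s) * hardy_int s \<phi> = ennreal (1 / (2 * k)) * (ennreal (2 * k * hardy_const CARD('n) s) * hardy_int s \<phi>)"
    using k L by (simp add: mult.assoc[symmetric] ennreal_mult'[symmetric])
  also have "\<dots> \<le> ennreal (1 / (2 * k)) * (ennreal R * dirichlet s \<phi>)"
    by (intro mult_left_mono main) simp
  also have "\<dots> = gagliardo_sq s \<phi>"
  proof -
    have "ennreal (1 / (2 * k) * R) = ennreal (1 / (2 * k)) * ennreal R"
      using k by (intro ennreal_mult') simp
    then show ?thesis unfolding gagliardo_sq_eq_dirichlet[OF f(1)] C by (simp only: mult.assoc)
  qed
  finally show ?thesis .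
qed

section \<open>Translations and local mass\<close>

text \<open>Differentiation commutes with translation; the induction passes from \<open>f\<close> to
  its directional derivatives and so ranges over all functions.\<close>

lemma C_k_translate: "C_k k f \<Longrightarrow> C_k k (\<lambda>x. f (a + x))"
proof (induction k arbitrary: f)
  case 0
  then show ?case by (auto intro!: continuous_on_compose2[of UNIV f] continuous_intros)
next
  case (Suc k)
  have der: "((\<lambda>x. f (a + x)) has_derivative frechet_derivative f (at (a + x))) (at x)" for x
  proof -
    have "(f has_derivative frechet_derivative f (at (a + x))) (at (a + x))"
      using Suc.prems by (simp add: frechet_derivative_works)
    moreover have "((\<lambda>x. a + x) has_derivative (\<lambda>v. v)) (at x)"
      by (auto intro!: derivative_eq_intros)
    ultimately show ?thesis using has_derivative_compose by fastforce
  qed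
  then have "frechet_derivative (\<lambda>x. f (a + x)) (at x) = frechet_derivative f (at (a + x))" for x
    using frechet_derivative_at by metis
  then have eq: "(\<lambda>x. frechet_derivative (\<lambda>x. f (a + x)) (at x) v) = (\<lambda>x. frechet_derivative f (at (a + x)) v)" for v
    by simp
  show ?case
    unfolding C_k.simps eq
  proof (intro conjI allI)
    show "(\<lambda>x. f (a + x)) differentiable (at x)" for x
      using der differentiable_def by blast
    show "C_k k (\<lambda>x. frechet_derivative f (at (a + x)) v)" for v
      using Suc.prems Suc.IH[of "\<lambda>x. frechet_derivative f (at x) v"] by simp
  qed
qed

lemma test_functions_translate:
  fixes \<phi> :: "'a::euclidean_space \<Rightarrow> real"
  assumes "\<phi> \<in> test_functions"
  shows "(\<lambda>x. \<phi> (a + x)) \<in> test_functions"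
proof -
  have "{x. \<phi> (a + x) \<noteq> 0} = (+) (- a) ` {x. \<phi> x \<noteq> 0}"
    by (auto simp: image_iff intro!: exI[of _ "a + _"])
  then have "closure {x. \<phi> (a + x) \<noteq> 0} = (+) (- a) ` closure {x. \<phi> x \<noteq> 0}"
    by (simp only: closure_translation)
  moreover have "compact ((+) (- a) ` closure {x. \<phi> x \<noteq> 0})"
    using assms by (intro compact_translation) (auto simp: test_functions_def)
  ultimately have "compact (closure {x. \<phi> (a + x) \<noteq> 0})" by (simp only:)
  moreover have "\<forall>k. C_k k (\<lambda>x. \<phi> (a + x))"
    using assms unfolding test_functions_def by (blast intro: C_k_translate)
  ultimately show ?thesis unfolding test_functions_def by blast
qed

lemma dirichlet_translate:
  fixes u :: "'a::euclidean_space \<Rightarrow> real"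
  assumes [measurable]: "u \<in> borel_measurable borel"
  shows "dirichlet s (\<lambda>x. u (a + x)) = dirichlet s u"
proof -
  define k where "k = (\<lambda>z::'a. ennreal (norm z powr (- (real DIM('a) + 2 * s))))"
  have [measurable]: "k \<in> borel_measurable borel" unfolding k_def by measurable
  have "dirichlet s (\<lambda>x. u (a + x)) = (\<integral>\<^sup>+x. (\<integral>\<^sup>+y. ennreal ((u (a + x) - u (a + y))\<^sup>2) * k ((a + x) - (a + y)) \<partial>lborel) \<partial>lborel)"
    by (simp add: dirichlet_def k_def)
  also have "\<dots> = (\<integral>\<^sup>+x. (\<integral>\<^sup>+y. ennreal ((u (a + x) - u y)\<^sup>2) * k ((a + x) - y) \<partial>lborel) \<partial>lborel)"
    by (intro nn_integral_cong nn_integral_translate[where f = "\<lambda>y. ennreal ((u (a + _) - u y)\<^sup>2) * k ((a + _) - y)"]) measurable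
  also have "\<dots> = (\<integral>\<^sup>+x. (\<integral>\<^sup>+y. ennreal ((u x - u y)\<^sup>2) * k (x - y) \<partial>lborel) \<partial>lborel)"
    by (intro nn_integral_translate[where f = "\<lambda>x. \<integral>\<^sup>+y. ennreal ((u x - u y)\<^sup>2) * k (x - y) \<partial>lborel"]) measurable
  finally show ?thesis by (simp add: dirichlet_def k_def)
qed

lemma gagliardo_sq_translate:
  fixes u :: "real ^ 'n::finite \<Rightarrow> real"
  assumes [measurable]: "u \<in> borel_measurable borel"
  shows "gagliardo_sq s (\<lambda>x. u (a + x)) = gagliardo_sq s u"
  by (simp add: gagliardo_sq_eq_dirichlet dirichlet_translate)

lemma gagliardo_sq_add_le:
  fixes u v :: "real ^ 'n::finite \<Rightarrow> real"
  assumes [measurable]: "u \<in> borel_measurable borel" "v \<in> borel_measurable borel" and e: "e > 0"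
  shows "gagliardo_sq s (\<lambda>x. u x + v x) \<le> ennreal (1 + e) * gagliardo_sq s u + ennreal (1 + 1 / e) * gagliardo_sq s v"
  using mult_left_mono[OF dirichlet_add_le[OF assms, of s], of "ennreal (frac_const TYPE('n) s / 2)"]
  by (simp add: gagliardo_sq_eq_dirichlet distrib_left mult_ac)

lemma nn_integral_ball_translate:
  fixes u :: "'a::euclidean_space \<Rightarrow> real"
  assumes [measurable]: "u \<in> borel_measurable borel"
  shows "(\<integral>\<^sup>+y\<in>cball x r. ennreal ((u y)\<^sup>2) \<partial>lborel) = (\<integral>\<^sup>+y\<in>cball 0 r. ennreal ((u (x + y))\<^sup>2) \<partial>lborel)"
proof -
  have [measurable]: "cball x r \<in> sets borel" by simp
  have "(\<integral>\<^sup>+y\<in>cball x r. ennreal ((u y)\<^sup>2) \<partial>lborel) = (\<integral>\<^sup>+y. ennreal ((u (x + y))\<^sup>2) * indicator (cball x r) (x + y) \<partial>lborel)"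
    by (rule nn_integral_translate[symmetric]) measurable
  also have "\<dots> = (\<integral>\<^sup>+y\<in>cball 0 r. ennreal ((u (x + y))\<^sup>2) \<partial>lborel)"
    by (intro nn_integral_cong) (auto simp: indicator_def dist_norm)
  finally show ?thesis .
qed

text \<open>On the ball the Hardy weight is at least its boundary value. Applied to all translates,
  this bounds the Morrey norm by Hardy integrals.\<close>

lemma hardy_int_ge_ball:
  fixes u :: "'a::euclidean_space \<Rightarrow> real"
  assumes [measurable]: "u \<in> borel_measurable borel" and "r > 0" "s > 0"
  shows "ennreal (r powr (- 2 * s)) * (\<integral>\<^sup>+y\<in>cball 0 r. ennreal ((u y)\<^sup>2) \<partial>lborel) \<le> hardy_int s u"
proof -
  have [measurable]: "cball (0::'a) r \<in> sets borel" by simp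
  have "ennreal (r powr (- 2 * s)) * (\<integral>\<^sup>+y\<in>cball 0 r. ennreal ((u y)\<^sup>2) \<partial>lborel)
      = (\<integral>\<^sup>+y. ennreal (r powr (- 2 * s)) * (ennreal ((u y)\<^sup>2) * indicator (cball 0 r) y) \<partial>lborel)"
    by (subst nn_integral_cmult) auto
  also have "\<dots> \<le> hardy_int s u"
    unfolding hardy_int_def
  proof (intro nn_integral_mono_AE eventually_mono[OF AE_lborel_singleton[of 0]])
    fix y :: 'a assume "y \<noteq> 0"
    then have "r powr (- 2 * s) \<le> norm y powr (- 2 * s)" if "y \<in> cball 0 r"
      using that assms by (intro powr_mono2') auto
    then show "ennreal (r powr (- 2 * s)) * (ennreal ((u y)\<^sup>2) * indicator (cball 0 r) y) \<le> ennreal ((u y)\<^sup>2) * ennreal (norm y powr (- 2 * s))"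
      by (auto simp: indicator_def mult.commute intro!: mult_left_mono ennreal_leI)
  qed
  finally show ?thesis .
qed

lemma critical_power_diff_integrable:
  fixes u v :: "'a::euclidean_space \<Rightarrow> real"
  assumes [measurable]: "u \<in> borel_measurable borel" "v \<in> borel_measurable borel" and p: "p > 0"
    and "integrable lborel (\<lambda>x. \<bar>u x\<bar> powr p)" "integrable lborel (\<lambda>x. \<bar>v x\<bar> powr p)"
  shows "integrable lborel (\<lambda>x. \<bar>u x - v x\<bar> powr p)"
proof (rule Bochner_Integration.integrable_bound)
  show "integrable lborel (\<lambda>x. 2 powr p * (\<bar>u x\<bar> powr p + \<bar>v x\<bar> powr p))"
    using assms by (intro integrable_mult_right Bochner_Integration.integrable_add)
  have "\<bar>a - b\<bar> powr p \<le> 2 powr p * (\<bar>a\<bar> powr p + \<bar>b\<bar> powr p)" for a b :: real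
  proof -
    have "\<bar>a - b\<bar> powr p \<le> (2 * max \<bar>a\<bar> \<bar>b\<bar>) powr p"
      using p by (intro powr_mono2) auto
    also have "\<dots> = 2 powr p * (max \<bar>a\<bar> \<bar>b\<bar>) powr p" by (simp add: powr_mult)
    also have "\<dots> \<le> 2 powr p * (\<bar>a\<bar> powr p + \<bar>b\<bar> powr p)"
      by (intro mult_left_mono) (auto simp: max_def)
    finally show ?thesis .
  qed
  then show "AE x in lborel. norm (\<bar>u x - v x\<bar> powr p) \<le> norm (2 powr p * (\<bar>u x\<bar> powr p + \<bar>v x\<bar> powr p))"
    by (simp add: abs_of_nonneg)
qed simp

section \<open>Sobolev, concentration and Hardy for the normalised seminorm\<close>

lemma dirichlet_eq_gagliardo_sq:
  fixes u :: "real ^ 'n::finite \<Rightarrow> real"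
  assumes [measurable]: "u \<in> borel_measurable borel" and s: "0 < s" "s < 1"
  shows "dirichlet s u = ennreal (2 / frac_const TYPE('n) s) * gagliardo_sq s u"
  using frac_const_pos[OF s, where 'n = 'n]
  by (simp add: gagliardo_sq_eq_dirichlet mult.assoc[symmetric] ennreal_mult'[symmetric])

lemma sobolev_gagliardo:
  fixes s :: real
  assumes s: "0 < s" "s < 1" "2 * s < real CARD('n::finite)"
  defines "p \<equiv> crit_exponent CARD('n) s"
  obtains C where "C > 0" "\<And>u :: real^'n \<Rightarrow> real. u \<in> borel_measurable borel \<Longrightarrow> integrable lborel (\<lambda>x. \<bar>u x\<bar> powr p) \<Longrightarrow>
    ennreal ((LINT x|lborel. \<bar>u x\<bar> powr p) powr (2 / p)) \<le> ennreal C * gagliardo_sq s u"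
proof -
  define A where "A = sobolev_const CARD('n) s * (unit_ball_vol CARD('n) + 1) powr (p / 2 - 1)"
  define C where "C = A * (2 / frac_const TYPE('n) s)"
  have v: "unit_ball_vol (real CARD('n)) + 1 > 0" by (intro add_pos_pos unit_ball_vol_pos) auto
  have A: "A > 0" unfolding A_def using sobolev_const_pos v by (intro mult_pos_pos) auto
  have C: "C > 0" unfolding C_def using A frac_const_pos[OF s(1,2), where 'n = 'n] by auto
  show ?thesis
  proof (rule that[OF C])
    fix u :: "real^'n \<Rightarrow> real"
    assume [measurable]: "u \<in> borel_measurable borel" and int: "integrable lborel (\<lambda>x. \<bar>u x\<bar> powr p)"
    have "ennreal ((LINT x|lborel. \<bar>u x\<bar> powr p) powr (2 / p)) \<le> ennreal A * dirichlet s u"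
      using sobolev_inequality[of u s "LINT x|lborel. \<bar>u x\<bar> powr p"] s int
      by (simp add: p_def A_def nn_integral_eq_integral)
    also have "\<dots> = ennreal C * gagliardo_sq s u"
    proof -
      have "ennreal C = ennreal A * ennreal (2 / frac_const TYPE('n) s)"
        unfolding C_def using A by (intro ennreal_mult') simp
      then show ?thesis using s by (simp only: dirichlet_eq_gagliardo_sq mult.assoc \<open>u \<in> borel_measurable borel\<close>)
    qed
    finally show "ennreal ((LINT x|lborel. \<bar>u x\<bar> powr p) powr (2 / p)) \<le> ennreal C * gagliardo_sq s u" .
  qed
qed

text \<open>This is \<open>improved_sobolev\<close> read backwards: a bounded Sobolev quotient
  excludes a small Morrey norm, so some ball carries much L2 mass, and moving its centre to the
  origin turns that mass into a Hardy integral. \<open>d\<close> is chosen before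
  \<open>u\<close>.\<close>

lemma concentration:
  fixes s M :: real
  assumes s: "0 < s" "s < 1" "2 * s < real CARD('n::finite)" and M: "M > 0"
  defines "p \<equiv> crit_exponent CARD('n) s"
  obtains d where "d > 0" "\<And>(u :: real^'n \<Rightarrow> real) i. u \<in> borel_measurable borel \<Longrightarrow>
    (\<integral>\<^sup>+x. ennreal (\<bar>u x\<bar> powr p) \<partial>lborel) = ennreal i \<Longrightarrow> i > 0 \<Longrightarrow> gagliardo_sq s u \<le> ennreal (M * i powr (2 / p)) \<Longrightarrow>
    \<exists>x. ennreal (d * i powr (2 / p)) \<le> hardy_int s (\<lambda>y. u (x + y))"
proof -
  have p: "p > 2" using crit_exponent_gt_2[OF s(1,3)] by (simp add: p_def)
  define C where "C = 2 / frac_const TYPE('n) s"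
  have C: "C > 0" using frac_const_pos[OF s(1,2), where 'n = 'n] by (simp add: C_def)
  define K where "K = sobolev_const CARD('n) s"
  have K: "K > 0" by (simp add: K_def sobolev_const_pos)
  \<comment> \<open>Chosen so that K C M times d powr (p/2 - 1) is 1/2: a Morrey norm below this
    level would bound the squared critical norm by half of itself.\<close>
  define d where "d = (1 / (2 * K * C * M)) powr (1 / (p / 2 - 1))"
  have d: "d > 0" using K C M by (simp add: d_def)
  have "1 / (p / 2 - 1) * (p / 2 - 1) = 1" using p by simp
  then have dp: "d powr (p / 2 - 1) = 1 / (2 * K * C * M)"
    unfolding d_def powr_powr using K C M by simp
  show ?thesis
  proof (rule that[OF d])
    fix u :: "real^'n \<Rightarrow> real" and i
    assume [measurable]: "u \<in> borel_measurable borel" and I: "(\<integral>\<^sup>+x. ennreal (\<bar>u x\<bar> powr p) \<partial>lborel) = ennreal i"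
      and i: "i > 0" and G: "gagliardo_sq s u \<le> ennreal (M * i powr (2 / p))"
    have "\<exists>x r. r > 0 \<and> \<not> (\<integral>\<^sup>+y\<in>cball x r. ennreal ((u y)\<^sup>2) \<partial>lborel) \<le> ennreal (d * i powr (2 / p) * r powr (2 * s))"
    proof (rule ccontr)
      assume "\<not> ?thesis"
      then have "\<And>x r. r > 0 \<Longrightarrow> (\<integral>\<^sup>+y\<in>cball x r. ennreal ((u y)\<^sup>2) \<partial>lborel) \<le> ennreal (d * i powr (2 / p) * r powr (2 * s))"
        by blast
      then have "ennreal (i powr (2 / p)) \<le> ennreal (K * d powr (p / 2 - 1)) * dirichlet s u"
        using improved_sobolev[of u s i d] s i d I by (simp add: K_def p_def)
      also have "\<dots> \<le> ennreal (K * d powr (p / 2 - 1)) * (ennreal C * ennreal (M * i powr (2 / p)))"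
        using G s by (simp add: dirichlet_eq_gagliardo_sq C_def mult_left_mono)
      also have "\<dots> = ennreal (i powr (2 / p) / 2)"
        unfolding dp using K C M by (simp add: ennreal_mult'[symmetric])
      finally show False using i by simp
    qed
    then obtain x r where r: "r > 0" and "\<not> (\<integral>\<^sup>+y\<in>cball x r. ennreal ((u y)\<^sup>2) \<partial>lborel) \<le> ennreal (d * i powr (2 / p) * r powr (2 * s))"
      by blast
    then have le: "ennreal (d * i powr (2 / p) * r powr (2 * s)) \<le> (\<integral>\<^sup>+y\<in>cball 0 r. ennreal ((u (x + y))\<^sup>2) \<partial>lborel)"
      using nn_integral_ball_translate[of u x r] by simp
    have "ennreal (d * i powr (2 / p)) = ennreal (r powr (- 2 * s)) * ennreal (d * i powr (2 / p) * r powr (2 * s))"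
      using r d by (simp add: ennreal_mult'[symmetric] powr_minus)
    also have "\<dots> \<le> ennreal (r powr (- 2 * s)) * (\<integral>\<^sup>+y\<in>cball 0 r. ennreal ((u (x + y))\<^sup>2) \<partial>lborel)"
      by (intro mult_left_mono le) simp
    also have "\<dots> \<le> hardy_int s (\<lambda>y. u (x + y))"
      using r s by (intro hardy_int_ge_ball) auto
    finally show "\<exists>x. ennreal (d * i powr (2 / p)) \<le> hardy_int s (\<lambda>y. u (x + y))" ..
  qed
qed

lemma gagliardo_sq_zero [simp]: "gagliardo_sq s (\<lambda>x. 0) = 0"
  by (simp add: gagliardo_sq_def case_prod_unfold)

lemma gagliardo_sq_uminus:
  fixes u :: "real ^ 'n::finite \<Rightarrow> real"
  shows "gagliardo_sq s (\<lambda>x. - u x) = gagliardo_sq s u"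
  by (simp add: gagliardo_sq_def abs_minus_commute)

lemma test_functions_finite:
  fixes \<phi> :: "real ^ 'n::finite \<Rightarrow> real" and s :: real
  assumes \<phi>: "\<phi> \<in> test_functions" and s: "0 < s" "s < 1" "2 * s < CARD('n)"
  shows "\<phi> \<in> borel_measurable borel" "gagliardo_sq s \<phi> < \<infinity>" "integrable lborel (\<lambda>x. \<bar>\<phi> x\<bar> powr crit_exponent CARD('n) s)"
proof -
  have s': "2 * s < DIM(real^'n)" using s by simp
  have p: "crit_exponent CARD('n) s > 0" using crit_exponent_gt_2[OF s(1,3)] by simp
  note f = test_function_finite[OF \<phi> s(1,2) s' p]
  show "\<phi> \<in> borel_measurable borel" "integrable lborel (\<lambda>x. \<bar>\<phi> x\<bar> powr crit_exponent CARD('n) s)" using f by auto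
  show "gagliardo_sq s \<phi> < \<infinity>" using f(2) unfolding gagliardo_sq_eq_dirichlet[OF f(1)] by (simp add: ennreal_mult_less_top)
qed

lemma test_functions_subset_Hdot:
  fixes s :: real
  assumes s: "0 < s" "s < 1" "2 * s < CARD('n::finite)"
  shows "test_functions \<subseteq> (Hdot s :: (real^'n \<Rightarrow> real) set)"
  using test_functions_finite[OF _ s] by (auto simp: Hdot_def intro!: exI[of _ "\<lambda>_. _"])

lemma Hdot_translate:
  fixes u :: "real ^ 'n::finite \<Rightarrow> real"
  assumes "u \<in> Hdot s"
  shows "(\<lambda>x. u (a + x)) \<in> Hdot s"
proof -
  obtain \<phi> where m [measurable]: "u \<in> borel_measurable borel" and int: "integrable lborel (\<lambda>x. \<bar>u x\<bar> powr crit_exponent CARD('n) s)"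
    and \<phi>: "\<And>m. \<phi> m \<in> test_functions" and lim: "(\<lambda>m::nat. gagliardo_sq s (\<lambda>x. u x - \<phi> m x)) \<longlonglongrightarrow> 0"
    using assms by (auto simp: Hdot_def)
  have [measurable]: "\<phi> m \<in> borel_measurable borel" for m
  proof -
    have "C_k 0 (\<phi> m)" using \<phi>[of m] unfolding test_functions_def by blast
    then show ?thesis by (auto intro: borel_measurable_continuous_onI)
  qed
  have "integrable (distr lborel borel ((+) a)) (\<lambda>x. \<bar>u x\<bar> powr crit_exponent CARD('n) s)"
    using int by (simp add: lborel_distr_plus)
  then have int': "integrable lborel (\<lambda>x. \<bar>u (a + x)\<bar> powr crit_exponent CARD('n) s)"
    by (subst (asm) integrable_distr_eq) auto
  have "gagliardo_sq s (\<lambda>x. u (a + x) - \<phi> m (a + x)) = gagliardo_sq s (\<lambda>x. u x - \<phi> m x)" for m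
    by (rule gagliardo_sq_translate[of "\<lambda>x. u x - \<phi> m x"]) measurable
  then have lim': "(\<lambda>m. gagliardo_sq s (\<lambda>x. u (a + x) - \<phi> m (a + x))) \<longlonglongrightarrow> 0" using lim by simp
  show ?thesis
    unfolding Hdot_def using int' lim' \<phi>
  proof (intro CollectI conjI exI[of _ "\<lambda>m x. \<phi> m (a + x)"] allI)
    show "(\<lambda>x. \<phi> m (a + x)) \<in> test_functions" for m by (intro test_functions_translate \<phi>)
  qed simp_all
qed

lemma Hdot_gagliardo_finite:
  fixes u :: "real ^ 'n::finite \<Rightarrow> real" and s :: real
  assumes u: "u \<in> Hdot s" and s: "0 < s" "s < 1" "2 * s < CARD('n)"
  shows "gagliardo_sq s u < \<infinity>"
proof -
  obtain \<phi> where [measurable]: "u \<in> borel_measurable borel"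
    and \<phi>: "\<And>m. \<phi> m \<in> test_functions" and lim: "(\<lambda>m::nat. gagliardo_sq s (\<lambda>x. u x - \<phi> m x)) \<longlonglongrightarrow> 0"
    using u by (auto simp: Hdot_def)
  note f = test_functions_finite[OF \<phi> s]
  note [measurable] = f(1)
  have "eventually (\<lambda>m. gagliardo_sq s (\<lambda>x. u x - \<phi> m x) < 1) sequentially"
    using order_tendstoD(2)[OF lim, of 1] by simp
  then obtain m where m: "gagliardo_sq s (\<lambda>x. u x - \<phi> m x) < 1"
    unfolding eventually_sequentially by blast
  have "gagliardo_sq s u = gagliardo_sq s (\<lambda>x. (u x - \<phi> m x) + \<phi> m x)" by simp
  also have "\<dots> \<le> ennreal (1 + 1) * gagliardo_sq s (\<lambda>x. u x - \<phi> m x) + ennreal (1 + 1 / 1) * gagliardo_sq s (\<phi> m)"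
    by (rule gagliardo_sq_add_le) auto
  also have "\<dots> < \<infinity>"
    using m f(2)[of m] by (auto simp: ennreal_mult_less_top intro: less_trans)
  finally show ?thesis .
qed

text \<open>Membership in \<open>Hdot\<close> only says that the seminorm of u - \<phi> m tends to
  0. Sobolev upgrades this to convergence in the critical norm, a subsequence converges almost
  everywhere, and Fatou carries the Hardy integral to the limit.\<close>

lemma hardy_Hdot:
  fixes u :: "real ^ 'n::finite \<Rightarrow> real" and s :: real
  assumes u: "u \<in> Hdot s" and s: "0 < s" "s < 1" "2 * s < CARD('n)"
  shows "ennreal (hardy_const CARD('n) s) * hardy_int s u \<le> gagliardo_sq s u"
proof -
  define p where "p = crit_exponent CARD('n) s"
  have p: "p > 2" using crit_exponent_gt_2[OF s(1,3)] by (simp add: p_def)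
  define L where "L = ennreal (hardy_const CARD('n) s)"
  obtain \<phi> where [measurable]: "u \<in> borel_measurable borel" and uint: "integrable lborel (\<lambda>x. \<bar>u x\<bar> powr p)"
    and \<phi>: "\<And>m. \<phi> m \<in> test_functions" and lim: "(\<lambda>m::nat. gagliardo_sq s (\<lambda>x. u x - \<phi> m x)) \<longlonglongrightarrow> 0"
    using u by (auto simp: Hdot_def p_def)
  note f = test_functions_finite[OF \<phi> s, folded p_def]
  note [measurable] = f(1)
  obtain C where C: "C > 0" and sob: "\<And>u :: real^'n \<Rightarrow> real. u \<in> borel_measurable borel \<Longrightarrow> integrable lborel (\<lambda>x. \<bar>u x\<bar> powr p) \<Longrightarrow>
    ennreal ((LINT x|lborel. \<bar>u x\<bar> powr p) powr (2 / p)) \<le> ennreal C * gagliardo_sq s u"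
    using sobolev_gagliardo[OF s] unfolding p_def by metis
  define i where "i = (\<lambda>m. LINT x|lborel. \<bar>u x - \<phi> m x\<bar> powr p)"
  have int: "integrable lborel (\<lambda>x. \<bar>u x - \<phi> m x\<bar> powr p)" for m
    using uint f p by (intro critical_power_diff_integrable) auto
  have i0: "i m \<ge> 0" for m by (simp add: i_def)
  have "(\<lambda>m. ennreal (i m powr (2 / p))) \<longlonglongrightarrow> 0"
  proof (rule tendsto_sandwich[OF _ _ tendsto_const])
    show "\<forall>\<^sub>F m in sequentially. ennreal (i m powr (2 / p)) \<le> ennreal C * gagliardo_sq s (\<lambda>x. u x - \<phi> m x)"
      unfolding i_def using sob int by (intro always_eventually allI) auto
    show "(\<lambda>m. ennreal C * gagliardo_sq s (\<lambda>x. u x - \<phi> m x)) \<longlonglongrightarrow> 0"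
      using tendsto_mult_ennreal[OF tendsto_const lim, of "ennreal C"] by simp
  qed auto
  then have "(\<lambda>m. i m powr (2 / p)) \<longlonglongrightarrow> 0"
    using tendsto_ennreal_iff[of "\<lambda>m. i m powr (2 / p)" sequentially 0] by simp
  then have "(\<lambda>m. (i m powr (2 / p)) powr (p / 2)) \<longlonglongrightarrow> 0"
    by (rule tendsto_zero_powrI[OF _ tendsto_const]) (use p in auto)
  then have "i \<longlonglongrightarrow> 0" using p i0 by (simp add: powr_powr)
  then have "(\<lambda>m. LINT x|lborel. norm (\<bar>u x - \<phi> m x\<bar> powr p)) \<longlonglongrightarrow> 0" by (simp add: i_def)
  from tendsto_L1_AE_subseq[OF int this]
  obtain r where r: "strict_mono r" and ae: "AE x in lborel. (\<lambda>m. \<bar>u x - \<phi> (r m) x\<bar> powr p) \<longlonglongrightarrow> 0"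
    by blast
  have ae': "AE x in lborel. ennreal ((u x)\<^sup>2) * ennreal (norm x powr (- 2 * s))
     = liminf (\<lambda>m. ennreal ((\<phi> (r m) x)\<^sup>2) * ennreal (norm x powr (- 2 * s)))"
    using ae
  proof eventually_elim
    fix x assume "(\<lambda>m. \<bar>u x - \<phi> (r m) x\<bar> powr p) \<longlonglongrightarrow> 0"
    then have "(\<lambda>m. (\<bar>u x - \<phi> (r m) x\<bar> powr p) powr (1 / p)) \<longlonglongrightarrow> 0"
      by (rule tendsto_zero_powrI[OF _ tendsto_const]) (use p in auto)
    then have "(\<lambda>m. \<bar>u x - \<phi> (r m) x\<bar>) \<longlonglongrightarrow> 0" using p by (simp add: powr_powr)
    then have "(\<lambda>m. u x - \<phi> (r m) x) \<longlonglongrightarrow> 0" by (simp add: tendsto_rabs_zero_iff)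
    then have "(\<lambda>m. u x - (u x - \<phi> (r m) x)) \<longlonglongrightarrow> u x - 0" by (intro tendsto_diff tendsto_const)
    then have "(\<lambda>m. \<phi> (r m) x) \<longlonglongrightarrow> u x" by simp
    then have "(\<lambda>m. ennreal ((\<phi> (r m) x)\<^sup>2 * norm x powr (- 2 * s))) \<longlonglongrightarrow> ennreal ((u x)\<^sup>2 * norm x powr (- 2 * s))"
      by (intro tendsto_ennrealI tendsto_intros)
    from lim_imp_Liminf[OF trivial_limit_sequentially this, symmetric]
    show "ennreal ((u x)\<^sup>2) * ennreal (norm x powr (- 2 * s))
     = liminf (\<lambda>m. ennreal ((\<phi> (r m) x)\<^sup>2) * ennreal (norm x powr (- 2 * s)))"
      by (simp add: ennreal_mult'[symmetric])
  qed
  have "hardy_int s u = (\<integral>\<^sup>+x. liminf (\<lambda>m. ennreal ((\<phi> (r m) x)\<^sup>2) * ennreal (norm x powr (- 2 * s))) \<partial>lborel)"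
    unfolding hardy_int_def by (rule nn_integral_cong_AE[OF ae'])
  also have "\<dots> \<le> liminf (\<lambda>m. hardy_int s (\<phi> (r m)))"
    unfolding hardy_int_def by (rule nn_integral_liminf) measurable
  finally have fatou: "hardy_int s u \<le> liminf (\<lambda>m. hardy_int s (\<phi> (r m)))" .
  define g where "g = enn2real (gagliardo_sq s u)"
  have g: "gagliardo_sq s u = ennreal g" "g \<ge> 0" using Hdot_gagliardo_finite[OF u s] by (auto simp: g_def)
  have Lpos: "hardy_const CARD('n) s > 0" using s by (intro hardy_const_pos)
  define l where "l = hardy_const CARD('n) s"
  have l: "l > 0" "L = ennreal l" using Lpos by (auto simp: l_def L_def)
  \<comment> \<open>Passing from \<phi> m to u costs the factor 1 + e from
    \<open>gagliardo_sq_add_le\<close> and, for large m, an additive e.\<close>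
  have bound: "hardy_int s u \<le> ennreal (((1 + e) * g + e) / l)" if e: "e > 0" for e
  proof -
    have "(\<lambda>m. ennreal (1 + 1 / e) * gagliardo_sq s (\<lambda>x. u x - \<phi> m x)) \<longlonglongrightarrow> 0"
      using tendsto_mult_ennreal[OF tendsto_const lim, of "ennreal (1 + 1 / e)"] by simp
    then have "eventually (\<lambda>m. ennreal (1 + 1 / e) * gagliardo_sq s (\<lambda>x. u x - \<phi> m x) < ennreal e) sequentially"
      using e by (intro order_tendstoD(2)) auto
    then have "eventually (\<lambda>m. hardy_int s (\<phi> m) \<le> ennreal (((1 + e) * g + e) / l)) sequentially"
    proof eventually_elim
      case (elim m)
      have "L * hardy_int s (\<phi> m) \<le> gagliardo_sq s (\<phi> m)"
        unfolding L_def by (rule hardy_test_function[OF \<phi> s])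
      also have "\<dots> = gagliardo_sq s (\<lambda>x. u x + - (u x - \<phi> m x))" by simp
      also have "\<dots> \<le> ennreal (1 + e) * gagliardo_sq s u + ennreal (1 + 1 / e) * gagliardo_sq s (\<lambda>x. - (u x - \<phi> m x))"
        using e by (intro gagliardo_sq_add_le) auto
      also have "\<dots> \<le> ennreal (1 + e) * ennreal g + ennreal e"
        unfolding gagliardo_sq_uminus g(1) using elim by (intro add_left_mono) simp
      also have "\<dots> = ennreal ((1 + e) * g + e)"
        using e g by (simp add: ennreal_mult' ennreal_plus)
      finally have "ennreal (1 / l) * (L * hardy_int s (\<phi> m)) \<le> ennreal (1 / l) * ennreal ((1 + e) * g + e)"
        by (intro mult_left_mono) auto
      then show ?case using l by (simp add: mult.assoc[symmetric] ennreal_mult'[symmetric])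
    qed
    then have "eventually (\<lambda>m. hardy_int s (\<phi> (r m)) \<le> ennreal (((1 + e) * g + e) / l)) sequentially"
      using eventually_subseq[OF r] by blast
    then have "liminf (\<lambda>m. hardy_int s (\<phi> (r m))) \<le> liminf (\<lambda>m. ennreal (((1 + e) * g + e) / l))"
      by (rule Liminf_mono)
    then show ?thesis using fatou by (simp add: Liminf_const)
  qed
  have "hardy_int s u \<noteq> \<infinity>" using bound[of 1] by (auto simp: top_unique)
  then obtain h where h: "hardy_int s u = ennreal h" "h \<ge> 0" by (cases "hardy_int s u") auto
  have "l * h \<le> g"
  proof (rule field_le_epsilon)
    fix e :: real assume e: "e > 0"
    \<comment> \<open>Scaled so that the total loss e' (g + 1) is e; the 1 keeps the quotient
      meaningful for g = 0.\<close>
    define e' where "e' = e / (g + 1)"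
    have e': "e' > 0" using e g by (simp add: e'_def)
    have "h \<le> ((1 + e') * g + e') / l"
      using bound[OF e'] h g e' l by simp
    then have "l * h \<le> (1 + e') * g + e'" using l by (simp add: field_simps)
    also have "\<dots> = g + e' * (g + 1)" by (simp add: algebra_simps)
    also have "e' * (g + 1) = e" using g by (simp add: e'_def)
    finally show "l * h \<le> g + e" .
  qed
  then show ?thesis unfolding g(1) h(1) L_def[symmetric] l(2) using l h by (simp add: ennreal_mult'[symmetric] ennreal_leI)
qed

section \<open>Bump functions\<close>

text \<open>The classical flat function is j = 0; its derivatives are combinations of members with
  larger j, so carrying j turns smoothness into closure under differentiation.\<close>

definition flat_exp :: "nat \<Rightarrow> real \<Rightarrow> real" where
  "flat_exp j t = (if t > 0 then exp (- 1 / t) / t ^ j else 0)"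

lemma flat_exp_tendsto_0: "(flat_exp j \<longlongrightarrow> 0) (at 0)"
proof (rule filterlim_split_at)
  show "(flat_exp j \<longlongrightarrow> 0) (at_left 0)"
    by (rule tendsto_eventually) (auto simp: eventually_at_filter flat_exp_def)
  have "((\<lambda>t::real. inverse t ^ j / exp (inverse t)) \<longlongrightarrow> 0) (at_right 0)"
    by (rule filterlim_compose[OF tendsto_power_div_exp_0 filterlim_inverse_at_top_right])
  then show "(flat_exp j \<longlongrightarrow> 0) (at_right 0)"
  proof (rule Lim_transform_eventually)
    show "\<forall>\<^sub>F t in at_right 0. inverse t ^ j / exp (inverse t) = flat_exp j t"
      by (auto simp: eventually_at_filter flat_exp_def exp_minus field_simps)
  qed
qed

lemma flat_exp_derivative:
  "(flat_exp j has_real_derivative flat_exp (j + 2) t - j * flat_exp (j + 1) t) (at t)"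
proof -
  consider "t > 0" | "t < 0" | "t = 0" by linarith
  then show ?thesis
  proof cases
    case 1
    have d1: "((\<lambda>t. exp (- 1 / t)) has_real_derivative exp (- 1 / t) / t\<^sup>2) (at t)"
      using 1 by (auto intro!: derivative_eq_intros simp: power2_eq_square)
    have d2: "((\<lambda>t. t ^ j) has_real_derivative real j * t ^ (j - Suc 0)) (at t)"
      by (rule DERIV_pow)
    have "(exp (- 1 / t) / t\<^sup>2 * t ^ j - exp (- 1 / t) * (real j * t ^ (j - Suc 0))) / (t ^ j * t ^ j)
        = flat_exp (j + 2) t - j * flat_exp (j + 1) t"
      using 1 by (cases j) (simp_all add: flat_exp_def field_simps power2_eq_square)
    then have "((\<lambda>t. exp (- 1 / t) / t ^ j) has_real_derivative flat_exp (j + 2) t - j * flat_exp (j + 1) t) (at t)"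
      using DERIV_divide[OF d1 d2] 1 by simp
    then show ?thesis
      by (rule has_field_derivative_transform_within_open[where S = "{0<..}"]) (use 1 in \<open>auto simp: flat_exp_def\<close>)
  next
    case 2
    have "((\<lambda>_. 0) has_real_derivative flat_exp (j + 2) t - j * flat_exp (j + 1) t) (at t)"
      using 2 by (simp add: flat_exp_def)
    then show ?thesis
      by (rule has_field_derivative_transform_within_open[where S = "{..<0}"]) (use 2 in \<open>auto simp: flat_exp_def\<close>)
  next
    case 3
    \<comment> \<open>At 0 the difference quotient of \<open>flat_exp j\<close> is
      \<open>flat_exp (Suc j)\<close>, whose limit is already known.\<close>
    have "((\<lambda>h. (flat_exp j (0 + h) - flat_exp j 0) / h) \<longlongrightarrow> 0) (at 0)"
    proof (rule Lim_transform_eventually[OF flat_exp_tendsto_0[of "Suc j"]])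
      show "\<forall>\<^sub>F h in at 0. flat_exp (Suc j) h = (flat_exp j (0 + h) - flat_exp j 0) / h"
        by (auto simp: eventually_at_filter flat_exp_def)
    qed
    then show ?thesis
      using 3 by (simp add: DERIV_def flat_exp_def)
  qed
qed

text \<open>
  An algebra of functions that is closed under directional derivatives, hence consists of
  smooth functions, and that contains a bump function.
\<close>

inductive_set bump_algebra :: "('a::euclidean_space \<Rightarrow> real) set" where
  const: "(\<lambda>x. c) \<in> bump_algebra"
| inner: "(\<lambda>x. x \<bullet> v) \<in> bump_algebra"
| flat: "(\<lambda>x. flat_exp j (1 - x \<bullet> x)) \<in> bump_algebra"
| add: "f \<in> bump_algebra \<Longrightarrow> g \<in> bump_algebra \<Longrightarrow> (\<lambda>x. f x + g x) \<in> bump_algebra"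
| mult: "f \<in> bump_algebra \<Longrightarrow> g \<in> bump_algebra \<Longrightarrow> (\<lambda>x. f x * g x) \<in> bump_algebra"

lemma bump_algebra_derivative:
  fixes f :: "'a::euclidean_space \<Rightarrow> real"
  assumes "f \<in> bump_algebra"
  shows "\<exists>D. (\<forall>x. (f has_derivative D x) (at x)) \<and> (\<forall>v. (\<lambda>x. D x v) \<in> bump_algebra)"
  using assms
proof induction
  case (const c)
  show ?case by (rule exI[of _ "\<lambda>x v. 0"]) (auto intro: bump_algebra.const)
next
  case (inner w)
  show ?case
    by (rule exI[of _ "\<lambda>x v. v \<bullet> w"]) (auto intro!: derivative_eq_intros bump_algebra.const)
next
  case (flat j)
  \<comment> \<open>The chain rule contributes x \<bullet> v, which is why linear forms are among
    the generators.\<close>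
  define D where "D = (\<lambda>x v :: 'a. (flat_exp (j + 2) (1 - x \<bullet> x) + - real j * flat_exp (j + 1) (1 - x \<bullet> x)) * (- 2 * (x \<bullet> v)))"
  have "((\<lambda>x. flat_exp j (1 - x \<bullet> x)) has_derivative D x) (at x)" for x
  proof -
    have 1: "((\<lambda>x::'a. 1 - x \<bullet> x) has_derivative (\<lambda>v. - 2 * (x \<bullet> v))) (at x)"
      by (auto intro!: derivative_eq_intros simp: inner_commute)
    have "(flat_exp j has_derivative (*) (flat_exp (j + 2) (1 - x \<bullet> x) - j * flat_exp (j + 1) (1 - x \<bullet> x))) (at (1 - x \<bullet> x))"
      using flat_exp_derivative unfolding has_field_derivative_def by blast
    from has_derivative_compose[OF 1 this] show ?thesis by (simp add: D_def)
  qed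
  moreover have "(\<lambda>x. D x v) \<in> bump_algebra" for v
    unfolding D_def by (intro bump_algebra.intros)
  ultimately show ?case by blast
next
  case (add f g)
  then obtain Df Dg where "\<And>x. (f has_derivative Df x) (at x)" "\<And>v. (\<lambda>x. Df x v) \<in> bump_algebra"
    "\<And>x. (g has_derivative Dg x) (at x)" "\<And>v. (\<lambda>x. Dg x v) \<in> bump_algebra" by blast
  then show ?case
    by (intro exI[of _ "\<lambda>x v. Df x v + Dg x v"]) (auto intro!: derivative_intros bump_algebra.add)
next
  case (mult f g)
  then obtain Df Dg where D: "\<And>x. (f has_derivative Df x) (at x)" "\<And>v. (\<lambda>x. Df x v) \<in> bump_algebra"
    "\<And>x. (g has_derivative Dg x) (at x)" "\<And>v. (\<lambda>x. Dg x v) \<in> bump_algebra" by blast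
  show ?case
  proof (intro exI[of _ "\<lambda>x v. f x * Dg x v + Df x v * g x"] conjI allI)
    show "((\<lambda>x. f x * g x) has_derivative (\<lambda>v. f x * Dg x v + Df x v * g x)) (at x)" for x
      using D by (intro has_derivative_mult)
    show "(\<lambda>x. f x * Dg x v + Df x v * g x) \<in> bump_algebra" for v
      by (rule bump_algebra.add[OF bump_algebra.mult[OF mult(1) D(4)] bump_algebra.mult[OF D(2) mult(2)]])
  qed
qed

lemma bump_algebra_C_k:
  fixes f :: "'a::euclidean_space \<Rightarrow> real"
  assumes "f \<in> bump_algebra"
  shows "C_k k f"
  using assms
proof (induction k arbitrary: f)
  case 0
  then obtain D where "\<And>x. (f has_derivative D x) (at x)" using bump_algebra_derivative by blast
  then show ?case by (auto intro!: continuous_at_imp_continuous_on has_derivative_continuous)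
next
  case (Suc k)
  then obtain D where D: "\<And>x. (f has_derivative D x) (at x)" "\<And>v. (\<lambda>x. D x v) \<in> bump_algebra"
    using bump_algebra_derivative by blast
  then have "frechet_derivative f (at x) = D x" for x
    by (metis frechet_derivative_at)
  then show ?case using D Suc.IH by (auto simp: differentiable_def)
qed

text \<open>Guarantees a nonempty set of competitors, without which the real infimum carries no
  information. The bump is positive exactly on the open unit ball.\<close>

lemma exists_test_function:
  obtains \<phi> :: "'a::euclidean_space \<Rightarrow> real" where "\<phi> \<in> test_functions" "\<not> (AE x in lborel. \<phi> x = 0)"
proof
  define \<phi> :: "'a \<Rightarrow> real" where "\<phi> = (\<lambda>x. flat_exp 0 (1 - x \<bullet> x))"
  have supp: "{x. \<phi> x \<noteq> 0} = ball 0 1"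
    by (auto simp: \<phi>_def flat_exp_def dot_square_norm abs_square_less_1)
  have "\<phi> \<in> bump_algebra" unfolding \<phi>_def by (rule bump_algebra.flat)
  then show "\<phi> \<in> test_functions"
    by (auto simp: test_functions_def supp bump_algebra_C_k)
  show "\<not> (AE x in lborel. \<phi> x = 0)"
  proof
    assume "AE x in lborel. \<phi> x = 0"
    moreover have "{x \<in> space lborel. \<not> \<phi> x = 0} = ball 0 1" using supp by auto
    ultimately have "emeasure lborel (ball (0::'a) 1) = 0"
      by (subst (asm) AE_iff_measurable[where N = "ball 0 1"]) auto
    moreover have "measure lborel (ball (0::'a) 1) > 0" by (simp add: content_ball_pos)
    ultimately show False by (simp add: measure_def)
  qed
qed

section \<open>Infima of Rayleigh quotients\<close>

text \<open>Here \<open>g\<close> stands for the squared seminorm, \<open>h\<close> for the Hardy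
  integral, \<open>q\<close> for the squared critical norm and \<open>L\<close> for the Hardy
  constant. \<open>conc\<close> takes the place of a minimiser: a competitor with bounded quotient
  can be exchanged for one with the same \<open>g\<close> and \<open>q\<close> whose Hardy term is
  at least a fixed multiple of \<open>q\<close>.\<close>

lemma rayleigh_infimum:
  fixes X :: "'b set" and g h q :: "'b \<Rightarrow> real" and L c :: real
  assumes ne: "X \<noteq> {}" and q: "\<And>u. u \<in> X \<Longrightarrow> q u > 0" and h: "\<And>u. u \<in> X \<Longrightarrow> h u \<ge> 0"
    and L: "L > 0" "\<And>u. u \<in> X \<Longrightarrow> L * h u \<le> g u" and c: "c > 0" "\<And>u. u \<in> X \<Longrightarrow> c * q u \<le> g u"
    and conc: "\<And>M. M > 0 \<Longrightarrow> \<exists>d>0. \<forall>u\<in>X. g u \<le> M * q u \<longrightarrow> (\<exists>v\<in>X. g v = g u \<and> q v = q u \<and> d * q u \<le> h v)"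
  defines "S \<equiv> \<lambda>\<mu>. INF u\<in>X. (g u - \<mu> * h u) / q u"
  shows "\<And>\<mu>. 0 \<le> \<mu> \<Longrightarrow> \<mu> < L \<Longrightarrow> (1 - \<mu> / L) * S 0 \<le> S \<mu>" "S 0 > 0" "strict_antimono_on {0..<L} S"
proof -
  have g: "g u \<ge> 0" if "u \<in> X" for u using c(2)[OF that] c(1) q[OF that] by (meson less_imp_le mult_nonneg_nonneg order_trans)
  have lower: "(1 - \<mu> / L) * (g u / q u) \<le> (g u - \<mu> * h u) / q u" if "u \<in> X" "0 \<le> \<mu>" for u \<mu>
  proof -
    have "\<mu> * h u \<le> \<mu> / L * g u"
      using mult_left_mono[OF L(2)[OF that(1)], of "\<mu> / L"] that L by simp
    then have "(1 - \<mu> / L) * g u \<le> g u - \<mu> * h u" by (simp add: algebra_simps)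
    from divide_right_mono[OF this, of "q u"] q[OF that(1)] show ?thesis by simp
  qed
  \<comment> \<open>\<open>cINF_lower\<close> needs a lower bound of the quotients; 0 is one because
    1 - \<mu> / L is positive.\<close>
  have bdd: "bdd_below ((\<lambda>u. (g u - \<mu> * h u) / q u) ` X)" if "0 \<le> \<mu>" "\<mu> < L" for \<mu>
  proof (rule bdd_belowI2)
    fix u assume u: "u \<in> X"
    have "0 \<le> (1 - \<mu> / L) * (g u / q u)" using that L g[OF u] q[OF u] by (intro mult_nonneg_nonneg divide_nonneg_nonneg) auto
    then show "0 \<le> (g u - \<mu> * h u) / q u" using lower[OF u that(1)] by linarith
  qed
  have S_le: "S \<mu> \<le> (g u - \<mu> * h u) / q u" if "0 \<le> \<mu>" "\<mu> < L" "u \<in> X" for u \<mu>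
    unfolding S_def using bdd[OF that(1,2)] that(3) by (rule cINF_lower)
  have S_ge: "b \<le> S \<mu>" if "\<And>u. u \<in> X \<Longrightarrow> b \<le> (g u - \<mu> * h u) / q u" for b \<mu>
    unfolding S_def using ne that by (rule cINF_greatest)
  have S0: "S 0 \<le> g u / q u" if "u \<in> X" for u using S_le[of 0 u] that L by simp
  show low: "(1 - \<mu> / L) * S 0 \<le> S \<mu>" if "0 \<le> \<mu>" "\<mu> < L" for \<mu>
  proof (rule S_ge)
    fix u assume u: "u \<in> X"
    have "(1 - \<mu> / L) * S 0 \<le> (1 - \<mu> / L) * (g u / q u)"
      using that L S0[OF u] by (intro mult_left_mono) auto
    then show "(1 - \<mu> / L) * S 0 \<le> (g u - \<mu> * h u) / q u" using lower[OF u that(1)] by linarith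
  qed
  have "c \<le> S 0" using c q by (intro S_ge) (simp add: field_simps)
  then show S0pos: "S 0 > 0" using c by linarith
  have less0: "S \<mu> < S 0" if \<mu>: "0 < \<mu>" "\<mu> < L" for \<mu>
  proof -
    \<comment> \<open>The bound S 0 + 1 covers every competitor within 1 of the infimum, so
      \<open>d\<close> is fixed before the competitor is chosen.\<close>
    obtain d where d: "d > 0" "\<And>u. u \<in> X \<Longrightarrow> g u \<le> (S 0 + 1) * q u \<Longrightarrow> (\<exists>v\<in>X. g v = g u \<and> q v = q u \<and> d * q u \<le> h v)"
      using conc[of "S 0 + 1"] S0pos by auto
    have "S \<mu> \<le> g u / q u - \<mu> * d" if u: "u \<in> X" "g u / q u < S 0 + 1" for u
    proof -
      have "g u \<le> (S 0 + 1) * q u" using u q[OF u(1)] by (simp add: field_simps)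
      then obtain v where v: "v \<in> X" "g v = g u" "q v = q u" "d * q u \<le> h v" using d(2)[OF u(1)] by blast
      have "S \<mu> \<le> (g v - \<mu> * h v) / q v" using S_le \<mu> v(1) by simp
      also have "\<dots> \<le> (g u - \<mu> * (d * q u)) / q u"
        unfolding v(2,3) using \<mu> v(4) q[OF u(1)] by (intro divide_right_mono diff_left_mono mult_left_mono) auto
      also have "\<dots> = g u / q u - \<mu> * d" using q[OF u(1)] by (simp add: field_simps)
      finally show ?thesis .
    qed
    note near = this
    \<comment> \<open>The gain \<mu> d must beat the defect e of an almost minimiser, and e \<le> 1
      keeps that competitor in the range where \<open>d\<close> applies.\<close>
    define e where "e = min 1 (\<mu> * d / 2)"
    have e: "e > 0" "e \<le> 1" "e < \<mu> * d" using \<mu> d by (auto simp: e_def min_def)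
    have "\<exists>u\<in>X. g u / q u < S 0 + e"
    proof (rule ccontr)
      assume "\<not> ?thesis"
      then have "S 0 + e \<le> S 0" by (intro S_ge) (auto simp: not_less)
      then show False using e by simp
    qed
    then obtain u where u: "u \<in> X" "g u / q u < S 0 + e" by blast
    then show ?thesis using near[OF u(1)] e by linarith
  qed
  show "strict_antimono_on {0..<L} S"
  proof (rule monotone_onI)
    fix a b assume ab: "a \<in> {0..<L}" "b \<in> {0..<L}" "a < b"
    have b: "0 < b" "b < L" using ab by auto
    \<comment> \<open>Concavity between 0 and b: for fixed u the quotient is affine in the mass, and
      a is the combination of 0 and b with weights 1 - a/b and a/b. Since S b < S 0, the left side
      exceeds S b.\<close>
    have "(1 - a / b) * S 0 + a / b * S b \<le> S a"
    proof (rule S_ge)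
      fix u assume u: "u \<in> X"
      have "(g u - a * h u) / q u = (1 - a / b) * (g u / q u) + a / b * ((g u - b * h u) / q u)"
        using b q[OF u] by (simp add: field_simps)
      moreover have "(1 - a / b) * S 0 \<le> (1 - a / b) * (g u / q u)"
        using ab S0[OF u] by (intro mult_left_mono) auto
      moreover have "a / b * S b \<le> a / b * ((g u - b * h u) / q u)"
        using ab S_le[of b u] u by (intro mult_left_mono) auto
      ultimately show "(1 - a / b) * S 0 + a / b * S b \<le> (g u - a * h u) / q u" by linarith
    qed
    moreover have "(1 - a / b) * S b < (1 - a / b) * S 0"
      using ab less0[OF b] by (intro mult_strict_left_mono) auto
    ultimately show "S b < S a" by (simp add: algebra_simps)
  qed
qed

lemma Lp_norm_square:
  assumes "p > 0"
  shows "(Lp_norm p u)\<^sup>2 = (LINT x|lborel. \<bar>u x\<bar> powr p) powr (2 / p)"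
  by (simp add: Lp_norm_def power2_eq_square powr_add[symmetric])

lemma hardy_integral_eq:
  fixes u :: "real ^ 'n::finite \<Rightarrow> real"
  assumes [measurable]: "u \<in> borel_measurable borel"
  shows "(LINT x|lborel. norm x powr (- 2 * s) * (u x)\<^sup>2) = enn2real (hardy_int s u)"
proof -
  have "(LINT x|lborel. norm x powr (- 2 * s) * (u x)\<^sup>2) = enn2real (\<integral>\<^sup>+x. ennreal (norm x powr (- 2 * s) * (u x)\<^sup>2) \<partial>lborel)"
    by (intro integral_eq_nn_integral) auto
  then show ?thesis by (simp add: hardy_int_def ennreal_mult' mult.commute)
qed

lemma S_mu_properties:
  fixes s :: real
  assumes s: "0 < s" "s < 1" "2 * s < real CARD('n::finite)"
  defines "S \<equiv> S_mu TYPE('n) s" and "L \<equiv> hardy_const CARD('n) s"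
  shows "\<And>\<mu>. 0 \<le> \<mu> \<Longrightarrow> \<mu> < L \<Longrightarrow> (1 - \<mu> / L) * S 0 \<le> S \<mu>" "S 0 > 0" "strict_antimono_on {0..<L} S"
proof -
  define p where "p = crit_exponent CARD('n) s"
  have p: "p > 2" using crit_exponent_gt_2[OF s(1,3)] by (simp add: p_def)
  define X where "X = {u \<in> (Hdot s :: (real^'n \<Rightarrow> real) set). \<not> (AE x in lborel. u x = 0)}"
  define g where "g = (\<lambda>u :: real^'n \<Rightarrow> real. enn2real (gagliardo_sq s u))"
  define h where "h = (\<lambda>u :: real^'n \<Rightarrow> real. enn2real (hardy_int s u))"
  define i where "i = (\<lambda>u :: real^'n \<Rightarrow> real. LINT x|lborel. \<bar>u x\<bar> powr p)"
  define q where "q = (\<lambda>u. i u powr (2 / p))"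
  have L: "L > 0" using hardy_const_pos s by (simp add: L_def)
  have X: "u \<in> borel_measurable borel" "integrable lborel (\<lambda>x. \<bar>u x\<bar> powr p)" "u \<in> Hdot s" if "u \<in> X" for u
    using that by (auto simp: X_def Hdot_def p_def)
  have gfin: "gagliardo_sq s u = ennreal (g u)" if "u \<in> X" for u
    using Hdot_gagliardo_finite[OF X(3)[OF that] s] by (simp add: g_def)
  have hfin: "hardy_int s u = ennreal (h u)" and hardy: "L * h u \<le> g u" if u: "u \<in> X" for u
  proof -
    have *: "ennreal L * hardy_int s u \<le> ennreal (g u)"
      using hardy_Hdot[OF X(3)[OF u] s] by (simp add: L_def gfin[OF u])
    \<comment> \<open>\<open>enn2real\<close> sends infinity to 0, so finiteness has to be known
      before the real Hardy term means anything; the Hardy inequality supplies it.\<close>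
    then have "hardy_int s u \<noteq> \<infinity>" using L by (auto simp: ennreal_mult_top top_unique)
    then show hf: "hardy_int s u = ennreal (h u)" by (simp add: h_def less_top)
    show "L * h u \<le> g u"
      using * L unfolding hf by (simp add: ennreal_mult'[symmetric] h_def g_def)
  qed
  have ipos: "i u > 0" if "u \<in> X" for u
  proof -
    have "i u \<noteq> 0"
      unfolding i_def using integral_nonneg_eq_0_iff_AE[OF X(2)[OF that]] that by (auto simp: X_def)
    moreover have "i u \<ge> 0" by (simp add: i_def)
    ultimately show ?thesis by simp
  qed
  have qpos: "q u > 0" if "u \<in> X" for u using ipos[OF that] by (simp add: q_def)
  have S_eq: "S = (\<lambda>\<mu>. INF u\<in>X. (g u - \<mu> * h u) / q u)"
  proof
    fix \<mu>
    have "rayleigh_quotient s \<mu> u = (g u - \<mu> * h u) / q u" if "u \<in> X" for u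
      unfolding rayleigh_quotient_def hardy_integral_eq[OF X(1)[OF that]] p_def[symmetric]
      using p by (simp add: g_def h_def q_def i_def Lp_norm_square)
    then show "S \<mu> = (INF u\<in>X. (g u - \<mu> * h u) / q u)"
      unfolding S_def S_mu_def X_def[symmetric] by (intro arg_cong[where f = Inf] image_cong) auto
  qed
  have ne: "X \<noteq> {}"
  proof -
    obtain \<phi> :: "real^'n \<Rightarrow> real" where "\<phi> \<in> test_functions" "\<not> (AE x in lborel. \<phi> x = 0)"
      using exists_test_function by blast
    then have "\<phi> \<in> X" using test_functions_subset_Hdot[OF s] by (auto simp: X_def)
    then show ?thesis by blast
  qed
  obtain C where C: "C > 0" and sob: "\<And>u :: real^'n \<Rightarrow> real. u \<in> borel_measurable borel \<Longrightarrow> integrable lborel (\<lambda>x. \<bar>u x\<bar> powr p) \<Longrightarrow>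
    ennreal ((LINT x|lborel. \<bar>u x\<bar> powr p) powr (2 / p)) \<le> ennreal C * gagliardo_sq s u"
    using sobolev_gagliardo[OF s] unfolding p_def by metis
  have sob': "1 / C * q u \<le> g u" if u: "u \<in> X" for u
  proof -
    have "ennreal (q u) \<le> ennreal (C * g u)"
      using sob[OF X(1,2)[OF u]] C unfolding gfin[OF u] by (simp add: q_def i_def ennreal_mult')
    then have "q u \<le> C * g u" using C by (subst (asm) ennreal_le_iff) (auto simp: g_def)
    then show ?thesis using C by (simp add: field_simps)
  qed
  have conc: "\<exists>d>0. \<forall>u\<in>X. g u \<le> M * q u \<longrightarrow> (\<exists>v\<in>X. g v = g u \<and> q v = q u \<and> d * q u \<le> h v)" if M: "M > 0" for M
  proof -
    obtain d where d: "d > 0" and dd: "\<And>(u :: real^'n \<Rightarrow> real) i. u \<in> borel_measurable borel \<Longrightarrow>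
      (\<integral>\<^sup>+x. ennreal (\<bar>u x\<bar> powr p) \<partial>lborel) = ennreal i \<Longrightarrow> i > 0 \<Longrightarrow> gagliardo_sq s u \<le> ennreal (M * i powr (2 / p)) \<Longrightarrow>
      \<exists>x. ennreal (d * i powr (2 / p)) \<le> hardy_int s (\<lambda>y. u (x + y))"
      using concentration[OF s M] unfolding p_def by metis
    have "\<exists>v\<in>X. g v = g u \<and> q v = q u \<and> d * q u \<le> h v" if u: "u \<in> X" and le: "g u \<le> M * q u" for u
    proof -
      note [measurable] = X(1)[OF u]
      have "(\<integral>\<^sup>+x. ennreal (\<bar>u x\<bar> powr p) \<partial>lborel) = ennreal (i u)"
        unfolding i_def using X(2)[OF u] by (intro nn_integral_eq_integral) auto
      moreover have "gagliardo_sq s u \<le> ennreal (M * i u powr (2 / p))"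
        using le unfolding gfin[OF u] q_def by (rule ennreal_leI)
      ultimately obtain x where x: "ennreal (d * q u) \<le> hardy_int s (\<lambda>y. u (x + y))"
        using dd[OF X(1)[OF u] _ ipos[OF u]] unfolding q_def by blast
      \<comment> \<open>The translate with large Hardy integral; \<open>g\<close> and
        \<open>q\<close> do not see the translation, only \<open>h\<close> does.\<close>
      define v where "v = (\<lambda>y. u (x + y))"
      have iv: "i v = i u"
      proof -
        have "i u = (LINT y|distr lborel borel ((+) x). \<bar>u y\<bar> powr p)" by (simp add: i_def lborel_distr_plus)
        also have "\<dots> = i v" unfolding i_def v_def by (subst integral_distr) auto
        finally show ?thesis ..
      qed
      have vH: "v \<in> Hdot s" unfolding v_def using X(3)[OF u] by (rule Hdot_translate)
      have vX: "v \<in> X"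
      proof -
        have "\<not> (AE x in lborel. v x = 0)"
        proof
          assume "AE x in lborel. v x = 0"
          then have "i v = (LINT x|(lborel :: (real^'n) measure). 0)"
            unfolding i_def using vH by (intro integral_cong_AE) (auto simp: Hdot_def)
          then show False using iv ipos[OF u] by simp
        qed
        then show ?thesis using vH by (simp add: X_def)
      qed
      have gv: "g v = g u" unfolding g_def v_def by (simp add: gagliardo_sq_translate)
      have "d * q u \<le> h v"
      proof -
        have "ennreal (d * q u) \<le> ennreal (h v)"
          using x unfolding v_def[symmetric] hfin[OF vX] .
        then show ?thesis by (subst (asm) ennreal_le_iff) (simp_all add: h_def)
      qed
      moreover have "q v = q u" by (simp only: q_def iv)
      ultimately show ?thesis using vX gv by blast
    qed
    then show ?thesis using d by blast
  qed
  have hnn: "h u \<ge> 0" if "u \<in> X" for u by (simp add: h_def)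
  have C': "1 / C > 0" using C by simp
  note R = rayleigh_infimum[of X q h L g "1 / C", OF ne qpos hnn L hardy C' sob' conc]
  show "(1 - \<mu> / L) * S 0 \<le> S \<mu>" if "0 \<le> \<mu>" "\<mu> < L" for \<mu>
    using R(1)[of \<mu>] that unfolding S_eq by blast
  show "S 0 > 0" using R(2) unfolding S_eq by blast
  show "strict_antimono_on {0..<L} S" using R(3) unfolding S_eq by blast
qed

section \<open>The estimates for S_mu and the case of several masses\<close>

theorem proposition3p5:
  fixes s :: real
  assumes "0 < s" and "s < 1" and "2 * s < real CARD('n::finite)"
  shows "(\<forall>\<mu>. 0 \<le> \<mu> \<and> \<mu> < hardy_const CARD('n) s \<longrightarrow>
            S_mu TYPE('n) s \<mu> \<ge> (1 - \<mu> / hardy_const CARD('n) s) * S_0 TYPE('n) s \<and>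
            (1 - \<mu> / hardy_const CARD('n) s) * S_0 TYPE('n) s > 0) \<and>
         strict_antimono_on {0..<hardy_const CARD('n) s} (S_mu TYPE('n) s) \<and>
         (\<forall>(k::nat) (\<mu> :: nat \<Rightarrow> real).
            1 \<le> k \<and> (\<forall>i\<in>{1..k}. 0 \<le> \<mu> i) \<and> (\<Sum>i=1..k. \<mu> i) < hardy_const CARD('n) s \<longrightarrow>
            S_star TYPE('n) s k \<mu> = S_mu TYPE('n) s (mu_max k \<mu>) \<and>
            {j \<in> {1..k}. S_mu TYPE('n) s (\<mu> j) = S_star TYPE('n) s k \<mu>} = J_star k \<mu>)"
proof -
  define L where "L = hardy_const CARD('n) s"
  define S where "S = S_mu TYPE('n) s"
  have L: "L > 0" using hardy_const_pos assms by (simp add: L_def)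
  note P = S_mu_properties[OF assms, folded S_def L_def]
  have anti: "S b \<le> S a" if "0 \<le> a" "a \<le> b" "b < L" for a b
    using that monotone_onD[OF P(3), of a b] by (cases "a = b") auto
  have inj: "a = b" if "S a = S b" "a \<in> {0..<L}" "b \<in> {0..<L}" for a b
    using that monotone_onD[OF P(3), of a b] monotone_onD[OF P(3), of b a] by (cases a b rule: linorder_cases) auto
  have masses: "S_star TYPE('n) s k \<mu> = S (mu_max k \<mu>) \<and> {j \<in> {1..k}. S (\<mu> j) = S_star TYPE('n) s k \<mu>} = J_star k \<mu>"
    if k: "1 \<le> k" and nn: "\<forall>i\<in>{1..k}. 0 \<le> \<mu> i" and sum: "(\<Sum>i=1..k. \<mu> i) < L" for k and \<mu> :: "nat \<Rightarrow> real"
  proof -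
    \<comment> \<open>The masses are nonnegative, so each is at most their sum and lies in the
      interval of strict monotonicity.\<close>
    have in_range: "\<mu> i \<in> {0..<L}" if "i \<in> {1..k}" for i
      using member_le_sum[of i "{1..k}" \<mu>] that nn sum by auto
    have "mu_max k \<mu> \<in> \<mu> ` {1..k}" unfolding mu_max_def using k by (intro Max_in) auto
    then obtain m where m: "m \<in> {1..k}" "mu_max k \<mu> = \<mu> m" by blast
    have le: "\<mu> i \<le> \<mu> m" if "i \<in> {1..k}" for i
      unfolding m(2)[symmetric] mu_max_def using that by (intro Max_ge) auto
    have star: "S_star TYPE('n) s k \<mu> = S (\<mu> m)"
      unfolding S_star_def S_0_def S_def[symmetric]
    proof (rule Min_eqI)
      fix y assume "y \<in> insert (S 0) ((\<lambda>i. S (\<mu> i)) ` {1..k})"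
      then show "S (\<mu> m) \<le> y"
      proof
        \<comment> \<open>The unweighted level is the value at mass 0, and 0 is at most the largest
          mass, so it never undercuts the minimum.\<close>
        assume "y = S 0"
        then show ?thesis using anti[of 0 "\<mu> m"] in_range[OF m(1)] by simp
      next
        assume "y \<in> (\<lambda>i. S (\<mu> i)) ` {1..k}"
        then obtain i where "i \<in> {1..k}" "y = S (\<mu> i)" by blast
        then show ?thesis using anti[of "\<mu> i" "\<mu> m"] in_range[of i] in_range[OF m(1)] le[of i] by simp
      qed
    qed (use m in auto)
    \<comment> \<open>Strict monotonicity makes \<open>S\<close> injective on the interval, so the
      minimum is shared only by equal masses.\<close>
    moreover have "S (\<mu> j) = S (\<mu> m) \<longleftrightarrow> \<mu> j = \<mu> m" if "j \<in> {1..k}" for j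
      using inj[OF _ in_range[OF that] in_range[OF m(1)]] by auto
    ultimately show ?thesis unfolding m(2) J_star_def by auto
  qed
  show ?thesis
    unfolding L_def[symmetric] S_def[symmetric] S_0_def
  proof (intro conjI allI impI)
    show "(1 - \<mu> / L) * S 0 \<le> S \<mu>" if "0 \<le> \<mu> \<and> \<mu> < L" for \<mu>
      using P(1) that by blast
    show "(1 - \<mu> / L) * S 0 > 0" if "0 \<le> \<mu> \<and> \<mu> < L" for \<mu>
      using P(2) that L by (intro mult_pos_pos) auto
    show "strict_antimono_on {0..<L} S" by (rule P(3))
  qed (use masses in blast)+
qed

end
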